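(* Let $\Omega$ be a parapolar space of symplectic rank at least $3$. Then either $\Omega$ is locally connected, or $\Omega$ is isomorphic to the buttoned parapolar space $\Omega(\mathcal F,\mathcal R)$, where the sheet space $\mathcal F$ is the family of connected components of the unbuttoning $\widetilde\Omega$ of $\Omega$ (which are locally connected polar or parapolar spaces of symplectic rank at least $3$) and the (non-trivial) equivalence relation $\mathcal R$ on the points of $\widetilde\Omega$ is defined by "sharing the first coordinate".
   Context: A point-line geometry $\Omega=(X,\mathcal L)$ is a set $X$ of points with a set $\mathcal L$ of subsets of $X$ (lines), each of size at least 2, covering $X$. Distinct points on a common line are called collinear ($x\perp y$); $x^\perp$ is the set of points equal or collinear to $x$. A subspace is a set of points containing every line joining two of its collinear points; it is singular if its points are pairwise collinear. Distance $\delta$ is taken in the collinearity graph; points in different components have distance $\infty$. A subspace is convex if it contains all points of all shortest paths between its points; the convex closure of a set is the intersection of all convex subspaces containing it. Polar space: a point-line geometry such that every line has at least three points; no point is collinear to all other points; every nested sequence of singular subspaces is finite; for every point $x$ and line $L$, either one or all points of $L$ are collinear to $x$. Its rank is the integer $r\ge2$ such that its maximal singular subspaces (projective spaces) have dimension $r-1$; only finite rank is considered. Parapolar space: a point-line geometry $\Omega$ such that (PPS1) $\Omega$ is connected; for each line $L$ and point $p\notin L$, $p$ is collinear to none, one or all points of $L$; and some pair $(p,L)$ has $p$ collinear to no point of $L$; (PPS2) for non-collinear points $p,q$ with $p^\perp\cap q^\perp\neq\emptyset$, either the convex closure of $\{p,q\}$ is a polar space (called a symplecton or symp), or $p^\perp\cap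 q^\perp$ is a single point; (PPS3) every line is contained in a symp. Symplectic rank at least $d$: all symps have rank at least $d$ (for a polar space: its rank is at least $d$). Locally connected: for every point $p$, any two lines through $p$ are contained in a finite sequence of singular planes consecutively intersecting in lines through $p$. For symplectic rank at least 3 this means that every point-residual $\Omega_p$ is connected, where $\Omega_p$ has as points the lines through $p$ and as lines the planar line-pencils with vertex $p$ in singular planes through $p$ contained in a symp. Unbuttoning. For $\Omega=(X,\mathcal L)$ a parapolar space of symplectic rank at least 3, let $\mathfrak C_p$ be the set of connected components of $\Omega_p$. The unbuttoning $\widetilde\Omega=(\widetilde X,\widetilde{\mathcal L})$ has $\widetilde X=\{(p,\Upsilon): p\in X,\ \Upsilon\in\mathfrak C_p\}$ and $\widetilde{\mathcal L}=\{\widetilde L: L\in\mathcal L\}$ with $\widetilde L=\{(p,\Upsilon)\in\widetilde X: p\in L\in\Upsilon\}$. The first coordinate of $(p,\Upsilon)$ is $p$. Buttoning. Let $\mathcal F=\{\Omega_i=(X_i,\mathcal L_i): i\in I\}$ be a family of disjoint locally connected polar or parapolar spaces (of symplectic rank at least $2$), $I\neq\emptyset$, and $\mathcal R$ an equivalence relation on $\widetilde X=\bigcup_i X_i$ such that: (C1) if $\widetilde p,\widetilde q,\widetilde r,\widetilde s$ are not necessarily distinct $\mathcal R$-classes with $\widetilde p\notin\{\widetilde q,\widetilde r,\widetilde s\}$, $p_1\ne p_2$ are in $\widetilde p$, and $q_1,q_2\in\widetilde q$, $r_1,r_2\in\widetilde r$, $s_1,s_2\in\widetilde s$, then $\delta(p_2,q_1)+\delta(q_2,r_1)+\delta(r_2,s_1)+\delta(s_2,p_1)\ge5$;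 (C2) the graph on $\mathcal F$, with $\Omega_i,\Omega_j$ adjacent if some point of $\Omega_i$ is in the same class as some point of $\Omega_j$, is connected. Then $\Omega(\mathcal F,\mathcal R)$ is the point-line geometry with point set $\widetilde X/\mathcal R$ and lines $\{\widetilde p: p\in L\}$ for $L\in\mathcal L_i$, $i\in I$ ($\widetilde p$ being the class of $p$). If $\mathcal R$ is non-trivial it is called a buttoned geometry with sheet space $\mathcal F$. *)

theory Defs
  imports Main "HOL-Library.Extended_Nat" "HOL-Library.Disjoint_Sets"
begin

section \<open>Point-line geometries\<close>

record 'a geometry =
  points :: "'a set"
  lines :: "'a set set"

definition point_line_geometry :: "'a geometry \<Rightarrow> bool" where
  "point_line_geometry G \<longleftrightarrow>
     (\<forall>L\<in>lines G. L \<subseteq> points G \<and> (\<exists>x\<in>L. \<exists>y\<in>L. x \<noteq> y)) \<and>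
     \<Union> (lines G) = points G"

definition thick_lines :: "'a geometry \<Rightarrow> bool" where
  "thick_lines G \<longleftrightarrow> (\<forall>L\<in>lines G. \<exists>x\<in>L. \<exists>y\<in>L. \<exists>z\<in>L. x \<noteq> y \<and> x \<noteq> z \<and> y \<noteq> z)"

definition collin :: "'a geometry \<Rightarrow> 'a \<Rightarrow> 'a \<Rightarrow> bool" where
  "collin G x y \<longleftrightarrow> x \<noteq> y \<and> (\<exists>L\<in>lines G. x \<in> L \<and> y \<in> L)"

definition perp :: "'a geometry \<Rightarrow> 'a \<Rightarrow> 'a set" where
  "perp G x = {y \<in> points G. y = x \<or> collin G x y}"

definition subspace :: "'a geometry \<Rightarrow> 'a set \<Rightarrow> bool" where
  "subspace G S \<longleftrightarrow> S \<subseteq> points G \<and>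
     (\<forall>x\<in>S. \<forall>y\<in>S. \<forall>L\<in>lines G. x \<noteq> y \<and> x \<in> L \<and> y \<in> L \<longrightarrow> L \<subseteq> S)"

definition singular_subspace :: "'a geometry \<Rightarrow> 'a set \<Rightarrow> bool" where
  "singular_subspace G S \<longleftrightarrow> subspace G S \<and> (\<forall>x\<in>S. \<forall>y\<in>S. x \<noteq> y \<longrightarrow> collin G x y)"

definition maximal_singular_subspace :: "'a geometry \<Rightarrow> 'a set \<Rightarrow> bool" where
  "maximal_singular_subspace G S \<longleftrightarrow> singular_subspace G S \<and>
     (\<forall>T. singular_subspace G T \<and> S \<subseteq> T \<longrightarrow> T = S)"

text \<open>The geometry which a subspace (in particular a connected component) inherits.\<close>

definition induced :: "'a geometry \<Rightarrow> 'a set \<Rightarrow> 'a geometry" where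
  "induced G S = \<lparr>points = S, lines = {L \<in> lines G. L \<subseteq> S}\<rparr>"

definition geometry_iso :: "('a \<Rightarrow> 'b) \<Rightarrow> 'a geometry \<Rightarrow> 'b geometry \<Rightarrow> bool" where
  "geometry_iso f G H \<longleftrightarrow>
     bij_betw f (points G) (points H) \<and> (\<lambda>L. f ` L) ` lines G = lines H"

definition isomorphic :: "'a geometry \<Rightarrow> 'b geometry \<Rightarrow> bool" where
  "isomorphic G H \<longleftrightarrow> (\<exists>f. geometry_iso f G H)"


section \<open>Distance, connectedness, convexity\<close>

text \<open>Paths of the collinearity graph, given as vertex lists; their length is the number of edges.\<close>

definition coll_path :: "'a geometry \<Rightarrow> 'a \<Rightarrow> 'a \<Rightarrow> 'a list \<Rightarrow> bool" where
  "coll_path G x y ps \<longleftrightarrow> ps \<noteq> [] \<and> hd ps = x \<and> last ps = y \<and>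
     set ps \<subseteq> points G \<and> successively (collin G) ps"

text \<open>The infimum of the empty set is \<open>\<infinity>\<close>, the distance between different components.\<close>

definition gdist :: "'a geometry \<Rightarrow> 'a \<Rightarrow> 'a \<Rightarrow> enat" where
  "gdist G x y = Inf {enat (length ps - 1) | ps. coll_path G x y ps}"

definition shortest_path :: "'a geometry \<Rightarrow> 'a \<Rightarrow> 'a \<Rightarrow> 'a list \<Rightarrow> bool" where
  "shortest_path G x y ps \<longleftrightarrow> coll_path G x y ps \<and> enat (length ps - 1) = gdist G x y"

definition connected_geometry :: "'a geometry \<Rightarrow> bool" where
  "connected_geometry G \<longleftrightarrow> (\<forall>x\<in>points G. \<forall>y\<in>points G. gdist G x y \<noteq> \<infinity>)"

text \<open>Connected components, as sets of points.\<close>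

definition components :: "'a geometry \<Rightarrow> 'a set set" where
  "components G = {{y \<in> points G. gdist G x y \<noteq> \<infinity>} | x. x \<in> points G}"

definition convex_subspace :: "'a geometry \<Rightarrow> 'a set \<Rightarrow> bool" where
  "convex_subspace G S \<longleftrightarrow> subspace G S \<and>
     (\<forall>x\<in>S. \<forall>y\<in>S. \<forall>ps. shortest_path G x y ps \<longrightarrow> set ps \<subseteq> S)"

definition convex_closure :: "'a geometry \<Rightarrow> 'a set \<Rightarrow> 'a set" where
  "convex_closure G A = \<Inter> {S. convex_subspace G S \<and> A \<subseteq> S}"


section \<open>Projective spaces and their dimension\<close>

text \<open>The last clause is the Veblen--Young axiom: two lines that each meet both of two lines
  through \<open>x\<close> away from \<open>x\<close> also meet each other.\<close>

definition projective_space :: "'a geometry \<Rightarrow> bool" where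
  "projective_space G \<longleftrightarrow> point_line_geometry G \<and> thick_lines G \<and>
     (\<forall>x\<in>points G. \<forall>y\<in>points G. x \<noteq> y \<longrightarrow> (\<exists>!L. L \<in> lines G \<and> x \<in> L \<and> y \<in> L)) \<and>
     (\<forall>K\<in>lines G. \<forall>L\<in>lines G. \<forall>M\<in>lines G. \<forall>N\<in>lines G. \<forall>x.
        K \<noteq> L \<and> x \<in> K \<inter> L \<and> x \<notin> M \<and> x \<notin> N \<and>
        M \<inter> K \<noteq> {} \<and> M \<inter> L \<noteq> {} \<and> N \<inter> K \<noteq> {} \<and> N \<inter> L \<noteq> {} \<longrightarrow> M \<inter> N \<noteq> {})"

definition subspace_span :: "'a geometry \<Rightarrow> 'a set \<Rightarrow> 'a set" where
  "subspace_span G A = \<Inter> {S. subspace G S \<and> A \<subseteq> S}"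

text \<open>The dimension is one less than the least size of a generating set.\<close>

definition projective_space_of_dim :: "'a geometry \<Rightarrow> nat \<Rightarrow> bool" where
  "projective_space_of_dim G n \<longleftrightarrow> projective_space G \<and>
     (\<exists>A\<subseteq>points G. finite A \<and> card A = n + 1 \<and> subspace_span G A = points G) \<and>
     (\<forall>A\<subseteq>points G. finite A \<and> subspace_span G A = points G \<longrightarrow> n + 1 \<le> card A)"

definition singular_plane :: "'a geometry \<Rightarrow> 'a set \<Rightarrow> bool" where
  "singular_plane G S \<longleftrightarrow> singular_subspace G S \<and> projective_space_of_dim (induced G S) 2"


section \<open>Polar and parapolar spaces\<close>

text \<open>A point of \<open>L\<close> counts as collinear to all points of \<open>L\<close>, whence \<^const>\<open>perp\<close> in the last
  clause.\<close>

definition polar_space :: "'a geometry \<Rightarrow> bool" where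
  "polar_space G \<longleftrightarrow> point_line_geometry G \<and> thick_lines G \<and>
     \<not> (\<exists>x\<in>points G. \<forall>y\<in>points G. y \<noteq> x \<longrightarrow> collin G x y) \<and>
     (\<forall>C. (\<forall>S\<in>C. singular_subspace G S) \<and> chain_subset C \<longrightarrow> finite C) \<and>
     (\<forall>x\<in>points G. \<forall>L\<in>lines G. (\<exists>!y. y \<in> L \<and> y \<in> perp G x) \<or> L \<subseteq> perp G x)"

definition has_polar_rank :: "'a geometry \<Rightarrow> nat \<Rightarrow> bool" where
  "has_polar_rank G r \<longleftrightarrow> polar_space G \<and> 2 \<le> r \<and>
     (\<forall>M. maximal_singular_subspace G M \<longrightarrow> projective_space_of_dim (induced G M) (r - 1))"

definition polar_rank_at_least :: "'a geometry \<Rightarrow> nat \<Rightarrow> bool" where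
  "polar_rank_at_least G d \<longleftrightarrow> (\<exists>r\<ge>d. has_polar_rank G r)"

definition symp :: "'a geometry \<Rightarrow> 'a set \<Rightarrow> bool" where
  "symp G S \<longleftrightarrow> (\<exists>p\<in>points G. \<exists>q\<in>points G.
     p \<noteq> q \<and> \<not> collin G p q \<and> perp G p \<inter> perp G q \<noteq> {} \<and>
     S = convex_closure G {p, q} \<and> polar_space (induced G S))"

definition parapolar_space :: "'a geometry \<Rightarrow> bool" where
  "parapolar_space G \<longleftrightarrow> point_line_geometry G \<and>
     connected_geometry G \<and>
     (\<forall>L\<in>lines G. \<forall>p\<in>points G - L.
        (\<forall>x\<in>L. \<not> collin G p x) \<or> (\<exists>!x. x \<in> L \<and> collin G p x) \<or> (\<forall>x\<in>L. collin G p x)) \<and>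
     (\<exists>p\<in>points G. \<exists>L\<in>lines G. \<forall>x\<in>L. x \<notin> perp G p) \<and>
     (\<forall>p\<in>points G. \<forall>q\<in>points G.
        p \<noteq> q \<and> \<not> collin G p q \<and> perp G p \<inter> perp G q \<noteq> {} \<longrightarrow>
        polar_space (induced G (convex_closure G {p, q})) \<or>
        (\<exists>x. perp G p \<inter> perp G q = {x})) \<and>
     (\<forall>L\<in>lines G. \<exists>S. symp G S \<and> L \<subseteq> S)"

definition symplectic_rank_at_least :: "'a geometry \<Rightarrow> nat \<Rightarrow> bool" where
  "symplectic_rank_at_least G d \<longleftrightarrow> (\<forall>S. symp G S \<longrightarrow> polar_rank_at_least (induced G S) d)"

text \<open>For a polar space the symplectic rank is its rank.\<close>

definition polar_or_parapolar_space :: "nat \<Rightarrow> 'a geometry \<Rightarrow> bool" where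
  "polar_or_parapolar_space d G \<longleftrightarrow>
     (polar_space G \<and> polar_rank_at_least G d) \<or>
     (parapolar_space G \<and> symplectic_rank_at_least G d)"

definition locally_connected :: "'a geometry \<Rightarrow> bool" where
  "locally_connected G \<longleftrightarrow>
     (\<forall>p\<in>points G. \<forall>L\<in>lines G. \<forall>M\<in>lines G. p \<in> L \<and> p \<in> M \<and> L \<noteq> M \<longrightarrow>
        (\<exists>Ps. Ps \<noteq> [] \<and> (\<forall>P\<in>set Ps. singular_plane G P) \<and> L \<subseteq> hd Ps \<and> M \<subseteq> last Ps \<and>
           successively (\<lambda>P Q. P \<inter> Q \<in> lines G \<and> p \<in> P \<inter> Q) Ps))"


section \<open>Unbuttoning\<close>

definition point_residual :: "'a geometry \<Rightarrow> 'a \<Rightarrow> 'a set geometry" where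
  "point_residual G p =
     \<lparr>points = {L \<in> lines G. p \<in> L},
      lines = {{L \<in> lines G. p \<in> L \<and> L \<subseteq> P} | P.
                 singular_plane G P \<and> p \<in> P \<and> (\<exists>S. symp G S \<and> P \<subseteq> S)}\<rparr>"

definition unbuttoning_points :: "'a geometry \<Rightarrow> ('a \<times> 'a set set) set" where
  "unbuttoning_points G = {(p, U). p \<in> points G \<and> U \<in> components (point_residual G p)}"

definition unbuttoning_line :: "'a geometry \<Rightarrow> 'a set \<Rightarrow> ('a \<times> 'a set set) set" where
  "unbuttoning_line G L = {(p, U) \<in> unbuttoning_points G. p \<in> L \<and> L \<in> U}"

definition unbuttoning :: "'a geometry \<Rightarrow> ('a \<times> 'a set set) geometry" where
  "unbuttoning G = \<lparr>points = unbuttoning_points G, lines = unbuttoning_line G ` lines G\<rparr>"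

text \<open>The connected components of a geometry as a family of geometries, indexed by
  \<^term>\<open>components G\<close>.\<close>

definition component_family :: "'a geometry \<Rightarrow> 'a set \<Rightarrow> 'a geometry" where
  "component_family G C = induced G C"

definition same_first_coordinate :: "('a \<times> 'b) set \<Rightarrow> (('a \<times> 'b) \<times> ('a \<times> 'b)) set" where
  "same_first_coordinate X = {(x, y). x \<in> X \<and> y \<in> X \<and> fst x = fst y}"


section \<open>Buttoning\<close>

definition family_union :: "'i set \<Rightarrow> ('i \<Rightarrow> 'a geometry) \<Rightarrow> 'a geometry" where
  "family_union I F = \<lparr>points = (\<Union>i\<in>I. points (F i)), lines = (\<Union>i\<in>I. lines (F i))\<rparr>"

definition buttoning_C1 :: "'a geometry \<Rightarrow> ('a \<times> 'a) set \<Rightarrow> bool" where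
  "buttoning_C1 G R \<longleftrightarrow>
     (\<forall>P\<in>points G // R. \<forall>Q\<in>points G // R. \<forall>T\<in>points G // R. \<forall>S\<in>points G // R.
        P \<notin> {Q, T, S} \<longrightarrow>
        (\<forall>p1\<in>P. \<forall>p2\<in>P. \<forall>q1\<in>Q. \<forall>q2\<in>Q. \<forall>t1\<in>T. \<forall>t2\<in>T. \<forall>s1\<in>S. \<forall>s2\<in>S.
           p1 \<noteq> p2 \<longrightarrow>
           gdist G p2 q1 + gdist G q2 t1 + gdist G t2 s1 + gdist G s2 p1 \<ge> 5))"

definition buttoning_C2 :: "'i set \<Rightarrow> ('i \<Rightarrow> 'a geometry) \<Rightarrow> ('a \<times> 'a) set \<Rightarrow> bool" where
  "buttoning_C2 I F R \<longleftrightarrow>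
     (\<forall>i\<in>I. \<forall>j\<in>I. (i, j) \<in> {(k, l). k \<in> I \<and> l \<in> I \<and>
        (\<exists>x\<in>points (F k). \<exists>y\<in>points (F l). (x, y) \<in> R)}\<^sup>*)"

definition buttoning_data :: "'i set \<Rightarrow> ('i \<Rightarrow> 'a geometry) \<Rightarrow> ('a \<times> 'a) set \<Rightarrow> bool" where
  "buttoning_data I F R \<longleftrightarrow> I \<noteq> {} \<and>
     disjoint_family_on (\<lambda>i. points (F i)) I \<and>
     (\<forall>i\<in>I. locally_connected (F i) \<and> polar_or_parapolar_space 2 (F i)) \<and>
     equiv (points (family_union I F)) R \<and>
     buttoning_C1 (family_union I F) R \<and>
     buttoning_C2 I F R"

definition buttoning :: "'i set \<Rightarrow> ('i \<Rightarrow> 'a geometry) \<Rightarrow> ('a \<times> 'a) set \<Rightarrow> 'a set geometry" where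
  "buttoning I F R =
     \<lparr>points = points (family_union I F) // R,
      lines = (\<lambda>L. (\<lambda>p. R `` {p}) ` L) ` lines (family_union I F)\<rparr>"

definition nontrivial_on :: "'a set \<Rightarrow> ('a \<times> 'a) set \<Rightarrow> bool" where
  "nontrivial_on X R \<longleftrightarrow> R \<noteq> Id_on X"

end

theory Submission
  imports Defs
begin

text \<open>The lines through a point \<open>p\<close> of a symp form a connected residue, and three pairwise collinear
  points lie in a common symp. Hence triangles, and quadrangles spanning a symp, lift along the
  projection from the unbuttoning to \<open>G\<close>, and every symp \<open>S\<close> lifts to an isomorphic convex
  subspace. So a component of the unbuttoning inherits the parapolar axioms from \<open>G\<close>, except that
  every point may be collinear to a point of every line; in that case the component consists of a
  single lifted symp. Condition (C1) holds because a closed walk of length at most four in \<open>G\<close> starts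
  and ends in the same component of the residue at its base point. Finally, \<open>G\<close> is recovered by
  identifying the fibres of the projection.\<close>


subsection \<open>Subspaces and induced geometries\<close>

text \<open>Rank three enters through planes: the maximal singular subspaces of a symp have
  dimension at least two, so lines of a symp on one point are linked by planes, and these planes lie
  in a symp, as the lines of a point-residual require. The bound 5 in (C1) separates quadrangles
  from pentagons: two distinct non-collinear opposite vertices of a quadrangle have two common
  neighbours, so (PPS2) yields a symp, whereas a pentagon need not lie in one. The main obstacle is
  that convexity refers to shortest paths, while distances in the unbuttoning can exceed those in
  \<open>G\<close>. But symps have diameter two, so only midpoints of pairs at distance two matter;
  they are controlled in \<open>G\<close> by convexity of the symp, and their residue component is
  then forced. The polar alternative for a sheet comes from a remark on polar spaces: a point off a
  lifted symp is collinear to a clique of it only, and a clique misses some line.\<close>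

lemma collin_sym: "collin G x y \<longleftrightarrow> collin G y x"
  by (auto simp: collin_def)

lemma collinI: "L \<in> lines G \<Longrightarrow> x \<in> L \<Longrightarrow> y \<in> L \<Longrightarrow> x \<noteq> y \<Longrightarrow> collin G x y"
  by (auto simp: collin_def)

lemma line_subset_points: "point_line_geometry G \<Longrightarrow> L \<in> lines G \<Longrightarrow> L \<subseteq> points G"
  by (auto simp: point_line_geometry_def)

lemma collin_points: "point_line_geometry G \<Longrightarrow> collin G x y \<Longrightarrow> x \<in> points G \<and> y \<in> points G"
  by (auto simp: point_line_geometry_def collin_def)

lemma perp_sym: "x \<in> points G \<Longrightarrow> y \<in> perp G x \<Longrightarrow> x \<in> perp G y"
  by (auto simp: perp_def collin_sym)

lemma perp_refl: "x \<in> points G \<Longrightarrow> x \<in> perp G x"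
  by (auto simp: perp_def)

lemma perp_points: "y \<in> perp G x \<Longrightarrow> y \<in> points G"
  by (auto simp: perp_def)

lemma points_induced [simp]: "points (induced G S) = S"
  by (simp add: induced_def)

lemma lines_induced [simp]: "lines (induced G S) = {L \<in> lines G. L \<subseteq> S}"
  by (simp add: induced_def)

lemma collin_inducedD: "collin (induced G S) x y \<Longrightarrow> collin G x y"
  by (auto simp: collin_def)

lemma collin_induced:
  "subspace G S \<Longrightarrow> x \<in> S \<Longrightarrow> y \<in> S \<Longrightarrow> collin (induced G S) x y \<longleftrightarrow> collin G x y"
proof
  assume "subspace G S" "x \<in> S" "y \<in> S" "collin G x y"
  then obtain L where "L \<in> lines G" "x \<in> L" "y \<in> L" "x \<noteq> y" "L \<subseteq> S"
    unfolding collin_def subspace_def by metis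
  then show "collin (induced G S) x y" by (auto intro: collinI)
qed (rule collin_inducedD)

lemma perp_induced: "subspace G S \<Longrightarrow> x \<in> S \<Longrightarrow> perp (induced G S) x = perp G x \<inter> S"
proof -
  assume S: "subspace G S" and x: "x \<in> S"
  have "collin (induced G S) x y \<longleftrightarrow> collin G x y" if "y \<in> S" for y
    using collin_induced[OF S x that] .
  moreover have "S \<subseteq> points G" using S by (simp add: subspace_def)
  ultimately show ?thesis unfolding perp_def by auto
qed

lemma induced_induced: "T \<subseteq> S \<Longrightarrow> induced (induced G S) T = induced G T"
  by (auto simp: induced_def)

lemma subspaceD:
  "subspace G S \<Longrightarrow> x \<in> S \<Longrightarrow> y \<in> S \<Longrightarrow> x \<noteq> y \<Longrightarrow> L \<in> lines G \<Longrightarrow> x \<in> L \<Longrightarrow> y \<in> L \<Longrightarrow> L \<subseteq> S"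
  unfolding subspace_def by blast

lemma subspace_induced:
  "subspace G S \<Longrightarrow> T \<subseteq> S \<Longrightarrow> subspace (induced G S) T \<longleftrightarrow> subspace G T"
proof -
  assume S: "subspace G S" and T: "T \<subseteq> S"
  show ?thesis
  proof
    assume "subspace (induced G S) T"
    then show "subspace G T"
      unfolding subspace_def[of _ T] using subspaceD[OF S] T S
      by (simp add: subspace_def[of G S]) (meson subsetD order_trans)
  next
    assume "subspace G T"
    then show "subspace (induced G S) T"
      unfolding subspace_def[of _ T] using T by simp
  qed
qed

lemma singular_subspace_induced:
  "subspace G S \<Longrightarrow> T \<subseteq> S \<Longrightarrow> singular_subspace (induced G S) T \<longleftrightarrow> singular_subspace G T"
proof -
  assume S: "subspace G S" and T: "T \<subseteq> S"
  have "collin (induced G S) x y \<longleftrightarrow> collin G x y" if "x \<in> T" "y \<in> T" for x y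
    using collin_induced[OF S] T that by blast
  then show ?thesis unfolding singular_subspace_def subspace_induced[OF S T] by simp
qed

lemma singular_plane_induced:
  "subspace G S \<Longrightarrow> T \<subseteq> S \<Longrightarrow> singular_plane (induced G S) T \<longleftrightarrow> singular_plane G T"
  by (simp add: singular_plane_def singular_subspace_induced induced_induced)

lemma subspace_points: "point_line_geometry G \<Longrightarrow> subspace G (points G)"
  by (auto simp: subspace_def dest: line_subset_points)

lemma subspace_Inter:
  "\<lbrakk>\<A> \<noteq> {}; \<And>S. S \<in> \<A> \<Longrightarrow> subspace G S\<rbrakk> \<Longrightarrow> subspace G (\<Inter>\<A>)"
  unfolding subspace_def[of _ "\<Inter>\<A>"]
proof (intro conjI ballI allI impI)
  assume ne: "\<A> \<noteq> {}" and S: "\<And>S. S \<in> \<A> \<Longrightarrow> subspace G S"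
  show "\<Inter>\<A> \<subseteq> points G" using ne S unfolding subspace_def by blast
  fix x y L assume *: "x \<in> \<Inter>\<A>" "y \<in> \<Inter>\<A>" "L \<in> lines G" "x \<noteq> y \<and> x \<in> L \<and> y \<in> L"
  show "L \<subseteq> \<Inter>\<A>"
  proof (rule Inter_greatest)
    fix T assume "T \<in> \<A>"
    then show "L \<subseteq> T" using subspaceD[OF S, of T x y L] * by blast
  qed
qed

lemma subspace_span_subspace:
  assumes "point_line_geometry G" "A \<subseteq> points G"
  shows "subspace G (subspace_span G A)"
  unfolding subspace_span_def
  by (rule subspace_Inter) (use assms subspace_points in auto)

lemma subspace_span_superset: "A \<subseteq> subspace_span G A"
  by (auto simp: subspace_span_def)

lemma subspace_span_least: "subspace G S \<Longrightarrow> A \<subseteq> S \<Longrightarrow> subspace_span G A \<subseteq> S"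
  by (auto simp: subspace_span_def)

subsection \<open>Paths\<close>

text \<open>With a relation in place of vertex lists, finite distance becomes reachability under
  \<open>rtrancl\<close>, and a distance \<open>n\<close> becomes membership in a power of the
  relation.\<close>

definition adj :: "'a geometry \<Rightarrow> ('a \<times> 'a) set" where
  "adj G = {(x, y). x \<in> points G \<and> y \<in> points G \<and> collin G x y}"

lemma sym_adj: "sym (adj G)"
  by (auto simp: sym_def adj_def collin_sym)

lemma sym_adj_rtrancl: "sym ((adj G)\<^sup>*)"
  by (simp add: sym_adj sym_rtrancl)

lemma coll_path_Cons:
  "coll_path G x y (a # b # ps) \<longleftrightarrow> x = a \<and> (a, b) \<in> adj G \<and> coll_path G b y (b # ps)"
  by (auto simp: coll_path_def adj_def)

lemma coll_path_single: "coll_path G x y [a] \<longleftrightarrow> x = a \<and> y = a \<and> a \<in> points G"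
  by (auto simp: coll_path_def)

lemma coll_path_relpow: "coll_path G x y ps \<Longrightarrow> (x, y) \<in> adj G ^^ (length ps - 1)"
proof (induction ps arbitrary: x)
  case Nil then show ?case by (simp add: coll_path_def)
next
  case (Cons a ps)
  show ?case
  proof (cases ps)
    case Nil then show ?thesis using Cons.prems by (simp add: coll_path_single)
  next
    case (Cons b qs)
    then have *: "x = a" "(a, b) \<in> adj G" "coll_path G b y ps"
      using Cons.prems by (auto simp: coll_path_Cons)
    have "(b, y) \<in> adj G ^^ (length ps - 1)" using Cons.IH *(3) .
    then have "(x, y) \<in> adj G ^^ Suc (length ps - 1)"
      using *(1,2) relpow_Suc_I2 by metis
    then show ?thesis using Cons by simp
  qed
qed

lemma relpow_coll_path:
  "(x, y) \<in> adj G ^^ n \<Longrightarrow> x \<in> points G \<Longrightarrow> \<exists>ps. coll_path G x y ps \<and> length ps = Suc n"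
proof (induction n arbitrary: x)
  case 0 then show ?case by (intro exI[of _ "[x]"]) (auto simp: coll_path_single)
next
  case (Suc n)
  then obtain b where b: "(x, b) \<in> adj G" "(b, y) \<in> adj G ^^ n" by (meson relpow_Suc_D2)
  then have "b \<in> points G" by (auto simp: adj_def)
  with Suc.IH b obtain ps where ps: "coll_path G b y ps" "length ps = Suc n" by blast
  then obtain qs where "ps = b # qs" by (cases ps) (auto simp: coll_path_def)
  then show ?case using b ps by (intro exI[of _ "x # ps"]) (auto simp: coll_path_Cons)
qed

text \<open>Every non-empty set of \<open>enat\<close> contains its infimum, and the infimum of the
  empty set is infinite.\<close>

lemma gdist_attained:
  assumes "gdist G x y \<noteq> \<infinity>"
  shows "\<exists>ps. coll_path G x y ps \<and> gdist G x y = enat (length ps - 1)"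
proof -
  let ?A = "{enat (length ps - 1) | ps. coll_path G x y ps}"
  have "?A \<noteq> {}"
  proof
    assume "?A = {}"
    then have "gdist G x y = Inf {}" by (simp only: gdist_def)
    then show False using assms by (simp add: Inf_enat_def)
  qed
  then obtain a where "a \<in> ?A" by blast
  then have "Inf ?A \<in> ?A" unfolding Inf_enat_def by (simp only: \<open>?A \<noteq> {}\<close> if_False) (rule LeastI)
  then show ?thesis unfolding gdist_def by blast
qed

lemma gdist_le: "coll_path G x y ps \<Longrightarrow> gdist G x y \<le> enat (length ps - 1)"
  unfolding gdist_def by (rule Inf_lower) auto

lemma gdist_relpow: "gdist G x y = enat n \<Longrightarrow> (x, y) \<in> adj G ^^ n"
  using gdist_attained[of G x y] coll_path_relpow[of G x y] by auto

lemma gdist_finite_iff: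
  assumes "x \<in> points G"
  shows "gdist G x y \<noteq> \<infinity> \<longleftrightarrow> (x, y) \<in> (adj G)\<^sup>*"
proof
  assume "gdist G x y \<noteq> \<infinity>"
  then show "(x, y) \<in> (adj G)\<^sup>*"
    by (metis gdist_attained coll_path_relpow relpow_imp_rtrancl)
next
  assume "(x, y) \<in> (adj G)\<^sup>*"
  then obtain ps where "coll_path G x y ps"
    using rtrancl_imp_relpow relpow_coll_path[OF _ assms] by blast
  then have "gdist G x y \<le> enat (length ps - 1)" by (rule gdist_le)
  then obtain k where "gdist G x y = enat k" using enat_ile by blast
  then show "gdist G x y \<noteq> \<infinity>" by simp
qed

lemma adj_rtrancl_points: "(x, y) \<in> (adj G)\<^sup>* \<Longrightarrow> x \<in> points G \<Longrightarrow> y \<in> points G"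
  by (induction rule: rtrancl_induct) (auto simp: adj_def)

lemma components_adj: "components G = {(adj G)\<^sup>* `` {x} | x. x \<in> points G}"
proof -
  have "{y \<in> points G. gdist G x y \<noteq> \<infinity>} = (adj G)\<^sup>* `` {x}" if "x \<in> points G" for x
    unfolding gdist_finite_iff[OF that] using adj_rtrancl_points[OF _ that] by auto
  then show ?thesis unfolding components_def by (intro Collect_cong) metis
qed

lemma connected_geometry_adj:
  "connected_geometry G \<longleftrightarrow> (\<forall>x\<in>points G. \<forall>y\<in>points G. (x, y) \<in> (adj G)\<^sup>*)"
proof -
  have "(\<forall>y\<in>points G. gdist G x y \<noteq> \<infinity>) \<longleftrightarrow> (\<forall>y\<in>points G. (x, y) \<in> (adj G)\<^sup>*)"
    if "x \<in> points G" for x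
    unfolding gdist_finite_iff[OF that] ..
  then show ?thesis unfolding connected_geometry_def by (rule ball_cong[OF refl])
qed

subsection \<open>Convexity\<close>

lemma shortest_path_mid:
  assumes "point_line_geometry G" "x \<noteq> y" "\<not> collin G x y" "collin G x z" "collin G z y"
  shows "shortest_path G x y [x, z, y]"
proof -
  have P: "coll_path G x y [x, z, y]"
    using assms collin_points[OF assms(1)] by (auto simp: coll_path_def)
  have "gdist G x y \<le> enat 2" using gdist_le[OF P] by (simp add: numeral_2_eq_2)
  then have "gdist G x y \<noteq> \<infinity>" using enat_ile by fastforce
  from gdist_attained[OF this]
  obtain ps where ps: "coll_path G x y ps" "gdist G x y = enat (length ps - 1)" by auto
  have ne: "ps \<noteq> []" using ps(1) by (simp add: coll_path_def)
  then obtain a qs where 1: "ps = a # qs" by (cases ps) auto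
  then have "qs \<noteq> []" using ps(1) assms(2) by (auto simp: coll_path_single)
  then obtain b rs where 2: "qs = b # rs" by (cases qs) auto
  then have "rs \<noteq> []" using ps(1) assms(3) 1 by (auto simp: coll_path_def)
  then obtain c ts where "rs = c # ts" by (cases rs) auto
  then have "2 \<le> length ps - 1" using 1 2 by simp
  then have "gdist G x y = enat 2" using ps(2) \<open>gdist G x y \<le> enat 2\<close> by simp
  then show ?thesis using P by (simp add: shortest_path_def)
qed

lemma convex_subspace_mid:
  assumes "point_line_geometry G" "convex_subspace G S" "x \<in> S" "y \<in> S"
    "x \<noteq> y" "\<not> collin G x y" "collin G x z" "collin G z y"
  shows "z \<in> S"
proof -
  have "set [x, z, y] \<subseteq> S"
    using shortest_path_mid[OF assms(1,5-8)] assms(2-4) unfolding convex_subspace_def by blast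
  then show ?thesis by simp
qed

text \<open>If non-collinear points of \<open>S\<close> always have a common neighbour, shortest
  paths between points of \<open>S\<close> have at most three vertices, so only their middle
  vertices have to be controlled. All convexity proofs for lifted symps go through this
  criterion.\<close>

lemma convex_subspaceI:
  assumes plg: "point_line_geometry G" and sub: "subspace G S"
    and diam: "\<And>x y. x \<in> S \<Longrightarrow> y \<in> S \<Longrightarrow> x \<noteq> y \<Longrightarrow> \<not> collin G x y \<Longrightarrow> \<exists>z. collin G x z \<and> collin G z y"
    and mid: "\<And>x y z. \<lbrakk>x \<in> S; y \<in> S; x \<noteq> y; \<not> collin G x y; collin G x z; collin G z y\<rbrakk> \<Longrightarrow> z \<in> S"
  shows "convex_subspace G S"
  unfolding convex_subspace_def
proof (intro conjI ballI allI impI sub)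
  fix x y ps assume xy: "x \<in> S" "y \<in> S" and sp: "shortest_path G x y ps"
  have P: "coll_path G x y ps" and D: "enat (length ps - 1) = gdist G x y"
    using sp by (auto simp: shortest_path_def)
  have xp: "x \<in> points G" "y \<in> points G" using xy sub by (auto simp: subspace_def)
  consider "x = y" | "x \<noteq> y" "collin G x y" | "x \<noteq> y" "\<not> collin G x y" by blast
  then show "set ps \<subseteq> S"
  proof cases
    case 1
    then have "gdist G x y \<le> 0" using gdist_le[of G x y "[x]"] xp
      by (auto simp: coll_path_single zero_enat_def)
    then have "length ps - 1 = 0" using D[symmetric] by (simp add: zero_enat_def)
    then obtain a where "ps = [a]" using P by (cases ps) (auto simp: coll_path_def)
    then show ?thesis using P xy by (auto simp: coll_path_def)
  next
    case 2
    then have "gdist G x y \<le> 1" using gdist_le[of G x y "[x, y]"] xp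
      by (auto simp: coll_path_def one_enat_def)
    then have "length ps - 1 \<le> 1" using D by (metis enat_ord_simps(1) one_enat_def)
    moreover have "ps \<noteq> []" using P by (simp add: coll_path_def)
    ultimately obtain a b where "ps = [a] \<or> ps = [a, b]"
      by (cases ps rule: remdups_adj.cases) auto
    then show ?thesis using P xy by (auto simp: coll_path_def)
  next
    case 3
    then obtain z where z: "collin G x z" "collin G z y" using diam xy by blast
    have "enat (length ps - 1) = enat (length [x, z, y] - 1)"
      using D shortest_path_mid[OF plg 3 z] unfolding shortest_path_def by metis
    then have "length ps - 1 = 2" by simp
    then have "length ps = 3" by simp
    then obtain a b c where "ps = [a, b, c]"
      by (auto simp: numeral_3_eq_3 length_Suc_conv)
    then have "ps = [x, b, y]" "collin G x b" "collin G b y" using P by (auto simp: coll_path_def)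
    then show ?thesis using mid[of x y b] xy 3 by auto
  qed
qed

lemma convex_closure_convex:
  assumes "point_line_geometry G" "A \<subseteq> points G"
  shows "convex_subspace G (convex_closure G A)"
proof -
  have "convex_subspace G (points G)"
    using subspace_points[OF assms(1)]
    by (auto simp: convex_subspace_def shortest_path_def coll_path_def)
  then have ne: "{S. convex_subspace G S \<and> A \<subseteq> S} \<noteq> {}" using assms(2) by blast
  have "subspace G (convex_closure G A)" unfolding convex_closure_def
    by (rule subspace_Inter[OF ne]) (auto simp: convex_subspace_def)
  moreover have "set ps \<subseteq> convex_closure G A"
    if "x \<in> convex_closure G A" "y \<in> convex_closure G A" "shortest_path G x y ps" for x y ps
    unfolding convex_closure_def
  proof (rule Inter_greatest)
    fix S assume S: "S \<in> {S. convex_subspace G S \<and> A \<subseteq> S}"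
    then have "x \<in> S" "y \<in> S" using that(1,2) by (auto simp: convex_closure_def)
    then show "set ps \<subseteq> S" using S that(3) unfolding convex_subspace_def by blast
  qed
  ultimately show ?thesis unfolding convex_subspace_def by blast
qed

lemma convex_closure_superset: "A \<subseteq> convex_closure G A"
  by (auto simp: convex_closure_def)

lemma convex_closure_least: "convex_subspace G S \<Longrightarrow> A \<subseteq> S \<Longrightarrow> convex_closure G A \<subseteq> S"
  by (auto simp: convex_closure_def)

subsection \<open>The one-or-all axiom\<close>

text \<open>Keeps the polar axioms in a form inherited by \<open>perp G l \<inter> perp G w\<close>
  for non-perpendicular \<open>l\<close> and \<open>w\<close>. That set need not be covered by
  lines, so \<open>point_line_geometry\<close> is kept apart and supplied where it is used.\<close>

locale one_or_all =
  fixes G :: "'a geometry"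
  assumes line_sub: "L \<in> lines G \<Longrightarrow> L \<subseteq> points G"
    and hit: "x \<in> points G \<Longrightarrow> L \<in> lines G \<Longrightarrow> \<exists>y\<in>L. y \<in> perp G x"
    and all: "\<lbrakk>x \<in> points G; L \<in> lines G; y \<in> L; z \<in> L; y \<noteq> z; y \<in> perp G x; z \<in> perp G x\<rbrakk>
      \<Longrightarrow> L \<subseteq> perp G x"
    and nondeg: "x \<in> points G \<Longrightarrow> \<exists>y\<in>points G. y \<notin> perp G x"
begin

lemma same_line: "L \<in> lines G \<Longrightarrow> x \<in> L \<Longrightarrow> y \<in> L \<Longrightarrow> y \<in> perp G x"
  using line_sub by (auto simp: perp_def collin_def)

lemma psym: "y \<in> perp G x \<Longrightarrow> x \<in> points G \<Longrightarrow> x \<in> perp G y"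
  by (rule perp_sym)

lemma perp_line:
  assumes "y \<in> perp G x" "y \<noteq> x"
  obtains L where "L \<in> lines G" "x \<in> L" "y \<in> L"
  using assms by (auto simp: perp_def collin_def)

text \<open>If \<open>q\<close> were perpendicular to all of \<open>p\<^sup>\<bottom> \<inter> z\<^sup>\<bottom>\<close>, then it would be perpendicular to all of
  \<open>p\<^sup>\<bottom>\<close> and \<open>z\<^sup>\<bottom>\<close>, and from there to every point.\<close>

lemma perp_perp_nondeg:
  assumes p: "p \<in> points G" and z: "z \<in> points G" "z \<notin> perp G p"
    and q: "q \<in> perp G p" "q \<in> perp G z"
  shows "\<exists>c \<in> perp G p \<inter> perp G z. c \<notin> perp G q"
proof (rule ccontr)
  assume "\<not> ?thesis"
  then have H: "c \<in> perp G q" if "c \<in> perp G p" "c \<in> perp G z" for c using that by blast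
  have qp: "q \<in> points G" using q perp_points by metis
  have pz: "p \<notin> perp G z" using z p psym by metis
  have sub: "perp G u \<subseteq> perp G q"
    if u: "u \<in> points G" "v \<in> points G" "v \<notin> perp G u" "u \<notin> perp G v" "q \<in> perp G u"
      and Hu: "\<And>c. c \<in> perp G u \<Longrightarrow> c \<in> perp G v \<Longrightarrow> c \<in> perp G q" for u v
  proof
    fix a assume a: "a \<in> perp G u"
    have uq: "u \<in> perp G q" using u psym by metis
    show "a \<in> perp G q"
    proof (cases "a = u")
      case False
      then obtain N where N: "N \<in> lines G" "u \<in> N" "a \<in> N" using a perp_line by metis
      obtain n where n: "n \<in> N" "n \<in> perp G v" using hit[OF u(2) N(1)] by blast
      have "n \<in> perp G q" using Hu n same_line N by metis
      then show ?thesis using all[OF qp N(1,2) n(1)] uq N n u(4) by blast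
    qed (use uq in simp)
  qed
  have sp: "perp G p \<subseteq> perp G q" using sub[of p z] p z pz q H by blast
  have sz: "perp G z \<subseteq> perp G q" using sub[of z p] p z pz q H by blast
  \<comment> \<open>\<open>w\<close> is not perpendicular to \<open>q\<close>, yet it will lie on a
    line with two points of \<open>perp G q\<close>: \<open>t\<close> on the line \<open>T\<close>
    through \<open>p\<close> and \<open>q\<close>, and \<open>s\<close> in \<open>perp G z\<close>.
    They differ because \<open>t\<close> is not in \<open>perp G z\<close>.\<close>
  obtain w where w: "w \<in> points G" "w \<notin> perp G q" using nondeg[OF qp] by blast
  have "q \<noteq> p" using q pz by blast
  then obtain T where T: "T \<in> lines G" "p \<in> T" "q \<in> T" using q perp_line by metis
  obtain t where t: "t \<in> T" "t \<in> perp G w" using hit[OF w(1) T(1)] by blast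
  have tq: "t \<noteq> q" using t w psym by metis
  have tz: "t \<notin> perp G z" using all[OF z(1) T(1) t(1) T(3) tq] q(2) pz T(2) by blast
  have tp: "t \<in> perp G q" using sp same_line[OF T(1,2) t(1)] by blast
  then have "t \<noteq> w" using w by blast
  then obtain W where W: "W \<in> lines G" "w \<in> W" "t \<in> W" using t perp_line by metis
  obtain s where s: "s \<in> W" "s \<in> perp G z" using hit[OF z(1) W(1)] by blast
  then have "W \<subseteq> perp G q" using all[OF qp W(1,3) s(1)] sz tp tz by blast
  then show False using W w by blast
qed

text \<open>Suppose \<open>perp G p \<subseteq> perp G l\<close>, and let \<open>q\<close> be a
  point of the line on \<open>p\<close> and \<open>l\<close> that is perpendicular to some
  \<open>z\<close> outside \<open>perp G l\<close>. A point perpendicular to \<open>p\<close> and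
  \<open>z\<close> is perpendicular to \<open>l\<close> too, hence to the whole line and to
  \<open>q\<close>, against \<open>perp_perp_nondeg\<close>.\<close>

lemma perp_not_subset:
  assumes p: "p \<in> points G" and l: "l \<in> perp G p" "l \<noteq> p"
  shows "\<exists>w \<in> perp G p. w \<notin> perp G l"
proof (rule ccontr)
  assume "\<not> ?thesis"
  then have H: "perp G p \<subseteq> perp G l" by blast
  have lp: "l \<in> points G" using l perp_points by metis
  obtain L where L: "L \<in> lines G" "p \<in> L" "l \<in> L" using l perp_line by metis
  obtain z where z: "z \<in> points G" "z \<notin> perp G l" using nondeg[OF lp] by blast
  obtain q where q: "q \<in> L" "q \<in> perp G z" using hit[OF z(1) L(1)] by blast
  have zp: "z \<notin> perp G p" using z H by blast
  have "q \<in> perp G p" using same_line L q by metis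
  then obtain c where c: "c \<in> perp G p" "c \<in> perp G z" "c \<notin> perp G q"
    using perp_perp_nondeg[OF p z(1) zp _ q(2)] by blast
  have cp: "c \<in> points G" using c perp_points by metis
  have "p \<in> perp G c" "l \<in> perp G c" using c H psym p lp by blast+
  then have "L \<subseteq> perp G c" using all[OF cp L] l by blast
  then have "q \<in> perp G c" using q by blast
  then show False using c(3) psym cp by blast
qed

lemma perp_perp_subspace:
  assumes "l \<in> points G" "w \<in> points G"
  shows "subspace G (perp G l \<inter> perp G w)"
proof -
  have "L \<subseteq> perp G l \<inter> perp G w"
    if "x \<in> perp G l \<inter> perp G w" "y \<in> perp G l \<inter> perp G w" "L \<in> lines G" "x \<noteq> y" "x \<in> L" "y \<in> L" for x y L
    using all[OF assms(1) that(3,5,6,4)] all[OF assms(2) that(3,5,6,4)] that(1,2) by blast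
  moreover have "perp G l \<inter> perp G w \<subseteq> points G" using perp_points by fast
  ultimately show ?thesis unfolding subspace_def by blast
qed

text \<open>Lines of the induced geometry lie entirely inside the set, so the points where they meet
  \<open>perp G x\<close> are available there; nondegeneracy is exactly
  \<open>perp_perp_nondeg\<close>.\<close>

lemma perp_perp_one_or_all:
  assumes l: "l \<in> points G" and w: "w \<in> points G" "w \<notin> perp G l"
  shows "one_or_all (induced G (perp G l \<inter> perp G w))"
proof -
  let ?S = "perp G l \<inter> perp G w"
  have S: "subspace G ?S" using perp_perp_subspace l w by blast
  have P: "perp (induced G ?S) x = perp G x \<inter> ?S" if "x \<in> ?S" for x
    using perp_induced[OF S that] .
  show ?thesis
  proof
    fix L assume "L \<in> lines (induced G ?S)"
    then show "L \<subseteq> points (induced G ?S)" by auto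
  next
    fix x L assume x: "x \<in> points (induced G ?S)" and L: "L \<in> lines (induced G ?S)"
    then obtain y where "y \<in> L" "y \<in> perp G x" using hit[of x L] perp_points by fastforce
    then show "\<exists>y\<in>L. y \<in> perp (induced G ?S) x" using P[of x] x L by auto
  next
    fix x L y z assume *: "x \<in> points (induced G ?S)" "L \<in> lines (induced G ?S)"
      "y \<in> L" "z \<in> L" "y \<noteq> z" "y \<in> perp (induced G ?S) x" "z \<in> perp (induced G ?S) x"
    then have "L \<subseteq> perp G x" using all[of x L y z] P[of x] perp_points by fastforce
    then show "L \<subseteq> perp (induced G ?S) x" using P[of x] * by auto
  next
    fix x assume "x \<in> points (induced G ?S)"
    then show "\<exists>y\<in>points (induced G ?S). y \<notin> perp (induced G ?S) x"
      using perp_perp_nondeg[OF l w, of x] P[of x] by auto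
  qed
qed

end

lemma polar_space_plg: "polar_space G \<Longrightarrow> point_line_geometry G"
  by (simp add: polar_space_def)

lemma polar_space_one_or_all:
  assumes P: "polar_space G"
  shows "one_or_all G"
proof
  have plg: "point_line_geometry G" using P by (rule polar_space_plg)
  have deep: "\<not> (\<exists>x\<in>points G. \<forall>y\<in>points G. y \<noteq> x \<longrightarrow> collin G x y)"
    using P unfolding polar_space_def by (elim conjE)
  have 1: "\<forall>x\<in>points G. \<forall>L\<in>lines G. (\<exists>!y. y \<in> L \<and> y \<in> perp G x) \<or> L \<subseteq> perp G x"
    using P unfolding polar_space_def by (elim conjE)
  show "L \<subseteq> points G" if "L \<in> lines G" for L
    using line_subset_points[OF plg that] .
  have A: "(\<exists>!y. y \<in> L \<and> y \<in> perp G x) \<or> L \<subseteq> perp G x" if "x \<in> points G" "L \<in> lines G" for x L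
    using 1 that by simp
  have "L \<noteq> {}" if "L \<in> lines G" for L
    using plg that unfolding point_line_geometry_def by fast
  then show "\<exists>y\<in>L. y \<in> perp G x" if "x \<in> points G" "L \<in> lines G" for x L
    using A[OF that] that by fast
  show "L \<subseteq> perp G x" if "x \<in> points G" "L \<in> lines G" "y \<in> L" "z \<in> L" "y \<noteq> z"
    "y \<in> perp G x" "z \<in> perp G x" for x L y z
    using A[OF that(1,2)] that by metis
  show "\<exists>y\<in>points G. y \<notin> perp G x" if "x \<in> points G" for x
    using deep that by (auto simp: perp_def)
qed

subsection \<open>Projective planes\<close>

locale projective =
  fixes H :: "'a geometry"
  assumes proj: "projective_space H"
begin

lemma plg: "point_line_geometry H"
  using proj by (simp add: projective_space_def)

lemma ex1_line: "x \<in> points H \<Longrightarrow> y \<in> points H \<Longrightarrow> x \<noteq> y \<Longrightarrow> \<exists>!L. L \<in> lines H \<and> x \<in> L \<and> y \<in> L"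
  using proj by (simp add: projective_space_def)

lemma line_through:
  assumes "x \<in> points H" "y \<in> points H" "x \<noteq> y"
  obtains L where "L \<in> lines H" "x \<in> L" "y \<in> L"
  using ex1_line[OF assms] by blast

lemma line_eq:
  assumes "L \<in> lines H" "M \<in> lines H" "x \<in> L" "y \<in> L" "x \<in> M" "y \<in> M" "x \<noteq> y"
  shows "L = M"
proof -
  have "x \<in> points H" "y \<in> points H" using assms line_subset_points[OF plg] by blast+
  from ex1_line[OF this assms(7)] show ?thesis using assms(1-6) by metis
qed

lemma line_point_ne:
  assumes "L \<in> lines H"
  obtains y where "y \<in> L" "y \<noteq> x"
proof -
  obtain u v where "u \<in> L" "v \<in> L" "u \<noteq> v"
    using plg assms unfolding point_line_geometry_def by metis
  then show ?thesis using that by metis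
qed

lemma line_subspace: "L \<in> lines H \<Longrightarrow> subspace H L"
proof -
  assume L: "L \<in> lines H"
  then have "M \<subseteq> L" if "M \<in> lines H" "x \<in> L" "y \<in> L" "x \<noteq> y" "x \<in> M" "y \<in> M" for x y M
    using line_eq[OF L that(1) that(2,3,5,6,4)] by simp
  then show ?thesis unfolding subspace_def using line_subset_points[OF plg L] by simp
qed

lemma veblen:
  assumes "K \<in> lines H" "L \<in> lines H" "M \<in> lines H" "N \<in> lines H"
    and "K \<noteq> L" "x \<in> K" "x \<in> L" "x \<notin> M" "x \<notin> N"
    and "a \<in> M" "a \<in> K" "b \<in> M" "b \<in> L" "c \<in> N" "c \<in> K" "d \<in> N" "d \<in> L"
  obtains y where "y \<in> M" "y \<in> N"
proof -
  have V: "\<forall>K\<in>lines H. \<forall>L\<in>lines H. \<forall>M\<in>lines H. \<forall>N\<in>lines H. \<forall>x.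
        K \<noteq> L \<and> x \<in> K \<inter> L \<and> x \<notin> M \<and> x \<notin> N \<and>
        M \<inter> K \<noteq> {} \<and> M \<inter> L \<noteq> {} \<and> N \<inter> K \<noteq> {} \<and> N \<inter> L \<noteq> {} \<longrightarrow> M \<inter> N \<noteq> {}"
    using proj unfolding projective_space_def by (elim conjE)
  have "x \<in> K \<inter> L" "M \<inter> K \<noteq> {}" "M \<inter> L \<noteq> {}" "N \<inter> K \<noteq> {}" "N \<inter> L \<noteq> {}" using assms by auto
  with V[THEN bspec, OF assms(1), THEN bspec, OF assms(2), THEN bspec, OF assms(3),
      THEN bspec, OF assms(4), THEN spec, of x] assms(5,8,9)
  have "M \<inter> N \<noteq> {}" by (elim mp) (intro conjI)
  then show ?thesis using that by auto
qed

section \<open>Cones over a line and the generation of projective planes\<close>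

definition cone :: "'a \<Rightarrow> 'a set \<Rightarrow> 'a set" where
  "cone a M = {x. \<exists>m\<in>M. \<exists>N\<in>lines H. a \<in> N \<and> m \<in> N \<and> x \<in> N}"

lemma coneI: "m \<in> M \<Longrightarrow> N \<in> lines H \<Longrightarrow> a \<in> N \<Longrightarrow> m \<in> N \<Longrightarrow> x \<in> N \<Longrightarrow> x \<in> cone a M"
  by (auto simp: cone_def)

lemma coneE:
  assumes "x \<in> cone a M"
  obtains m N where "m \<in> M" "N \<in> lines H" "a \<in> N" "m \<in> N" "x \<in> N"
  using assms by (auto simp: cone_def)

lemma cone_superset:
  assumes "M \<in> lines H" "a \<in> points H" "a \<notin> M"
  shows "insert a M \<subseteq> cone a M"
proof
  fix x assume "x \<in> insert a M"
  moreover have "m \<in> cone a M \<and> a \<in> cone a M" if "m \<in> M" for m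
  proof -
    have "m \<in> points H" "a \<noteq> m" using that assms line_subset_points[OF plg] by auto
    then obtain N where "N \<in> lines H" "a \<in> N" "m \<in> N" using line_through assms(2) by metis
    then show ?thesis using that coneI by metis
  qed
  moreover obtain m where "m \<in> M" using line_point_ne[OF assms(1)] by metis
  ultimately show "x \<in> cone a M" by auto
qed

text \<open>A line \<open>L\<close> through two cone points but not through \<open>a\<close> meets
  \<open>M\<close> in some \<open>m0\<close>, by Veblen with vertex \<open>a\<close>. A second use
  of Veblen, with vertex on \<open>L\<close>, shows that the lines from \<open>a\<close> to the
  other points of \<open>L\<close> meet \<open>M\<close> as well.\<close>

lemma cone_subspace:
  assumes M: "M \<in> lines H" and a: "a \<in> points H" "a \<notin> M"
  shows "subspace H (cone a M)"
  unfolding subspace_def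
proof (intro conjI ballI allI impI)
  show "cone a M \<subseteq> points H" using line_subset_points[OF plg] by (auto simp: cone_def)
  fix x y L assume x: "x \<in> cone a M" and y: "y \<in> cone a M" and L: "L \<in> lines H"
    and xy: "x \<noteq> y \<and> x \<in> L \<and> y \<in> L"
  show "L \<subseteq> cone a M"
  proof (cases "L = M")
    case True then show ?thesis using cone_superset[OF M a] by auto
  next
    case LM: False
    obtain m1 N1 where 1: "m1 \<in> M" "N1 \<in> lines H" "a \<in> N1" "m1 \<in> N1" "x \<in> N1" using x coneE by metis
    obtain m2 N2 where 2: "m2 \<in> M" "N2 \<in> lines H" "a \<in> N2" "m2 \<in> N2" "y \<in> N2" using y coneE by metis
    show ?thesis
    proof (cases "a \<in> L")
      case True
      have "L = N1 \<or> L = N2" using True line_eq[OF L] 1 2 xy by metis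
      then show ?thesis using coneI[OF 1(1-4)] coneI[OF 2(1-4)] by auto
    next
      case False
      have N12: "N1 \<noteq> N2" using False line_eq[OF L] 1 2 xy by metis
      obtain m0 where m0: "m0 \<in> L" "m0 \<in> M"
        using veblen[OF 1(2) 2(2) L M N12 1(3) 2(3) False a(2), of x y m1 m2] 1 2 xy by metis
      \<comment> \<open>The Veblen vertex is \<open>z\<close>, on the lines \<open>N\<close> and
        \<open>L\<close>: \<open>M\<close> meets these in \<open>m\<close> and \<open>m0\<close>,
        and \<open>Q\<close> meets them in \<open>a\<close> and \<open>u\<close>. The vertex has to
        avoid \<open>M\<close>, so it is afterwards taken to be one of \<open>x\<close> and
        \<open>y\<close> that lies off \<open>M\<close>.\<close>
      have key: "u \<in> cone a M"
        if u: "u \<in> L" "u \<noteq> z" "z \<in> L" "z \<notin> M" and z: "N \<in> lines H" "a \<in> N" "z \<in> N" "m \<in> N" "m \<in> M" for u z N m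
      proof -
        have "u \<in> points H" "u \<noteq> a" using u L False line_subset_points[OF plg] by auto
        then obtain Q where Q: "Q \<in> lines H" "a \<in> Q" "u \<in> Q" using line_through a(1) by metis
        have "z \<notin> Q" using line_eq[OF Q(1) L, of u z] Q u False by metis
        moreover have "N \<noteq> L" using z False by auto
        ultimately obtain q where "q \<in> M" "q \<in> Q"
          using veblen[OF z(1) L M Q(1), of z m m0 a u] z u Q m0 by metis
        then show ?thesis using Q coneI by metis
      qed
      show ?thesis
      proof
        fix u assume u: "u \<in> L"
        have "x \<notin> M \<or> y \<notin> M" using LM line_eq[OF L M] xy by metis
        then show "u \<in> cone a M"
          using key[OF u _ _ _ 1(2,3,5,4,1)] key[OF u _ _ _ 2(2,3,5,4,1)] xy x y by metis
      qed
    qed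
  qed
qed

text \<open>If \<open>a\<close> is off \<open>N\<close>, two points of \<open>N\<close> lie on two
  different lines through \<open>a\<close>. Both \<open>N\<close> and \<open>M\<close> meet these
  lines away from \<open>a\<close>, so Veblen applies.\<close>

lemma cone_line_meets_base:
  assumes M: "M \<in> lines H" and a: "a \<notin> M" and C: "points H \<subseteq> cone a M" and N: "N \<in> lines H"
  obtains y where "y \<in> N" "y \<in> M"
proof -
  have sub: "x \<in> cone a M" if "x \<in> N" for x
    using that C line_subset_points[OF plg N] by auto
  show ?thesis
  proof (cases "a \<in> N")
    case True
    obtain x where x: "x \<in> N" "x \<noteq> a" using line_point_ne[OF N] by metis
    then obtain m Q where "m \<in> M" "Q \<in> lines H" "a \<in> Q" "m \<in> Q" "x \<in> Q" using sub coneE by metis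
    moreover from this have "Q = N" using line_eq[OF _ N] x True by metis
    ultimately show ?thesis using that by metis
  next
    case False
    obtain u where u: "u \<in> N" using line_point_ne[OF N] by metis
    obtain v where v: "v \<in> N" "v \<noteq> u" using line_point_ne[OF N] by metis
    obtain m1 N1 where 1: "m1 \<in> M" "N1 \<in> lines H" "a \<in> N1" "m1 \<in> N1" "u \<in> N1"
      using sub[OF u] coneE by metis
    obtain m2 N2 where 2: "m2 \<in> M" "N2 \<in> lines H" "a \<in> N2" "m2 \<in> N2" "v \<in> N2"
      using sub[OF v(1)] coneE by metis
    have "N1 \<noteq> N2" using line_eq[OF N 1(2) u v(1)] 1 2 v False by metis
    then show ?thesis
      using veblen[OF 1(2) 2(2) N M _ 1(3) 2(3) False a, of u v m1 m2] u v 1 2 that by metis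
  qed
qed

text \<open>Each line \<open>Q\<close> from \<open>a\<close> to a point of \<open>M\<close> has to
  meet \<open>N\<close>. Project a point \<open>b\<close> of \<open>N\<close> off \<open>M\<close>
  from \<open>a\<close> onto a point \<open>m2\<close> of \<open>M\<close>; Veblen with vertex
  \<open>m2\<close> and the lines \<open>Q'\<close> and \<open>M\<close> through it makes
  \<open>N\<close> and \<open>Q\<close> meet.\<close>

lemma cone_change_base:
  assumes M: "M \<in> lines H" and a: "a \<notin> M" "a \<in> points H" and C: "points H \<subseteq> cone a M"
    and N: "N \<in> lines H" "a \<notin> N"
  shows "points H \<subseteq> cone a N"
proof (cases "N = M")
  case NM: False
  obtain m0 where m0: "m0 \<in> N" "m0 \<in> M" using cone_line_meets_base[OF M a(1) C N(1)] by metis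
  obtain b where b: "b \<in> N" "b \<noteq> m0" using line_point_ne[OF N(1)] by metis
  have bM: "b \<notin> M" using line_eq[OF N(1) M] m0 b NM by metis
  have "b \<in> cone a M" using b C line_subset_points[OF plg N(1)] by auto
  then obtain m2 Q' where 2: "m2 \<in> M" "Q' \<in> lines H" "a \<in> Q'" "m2 \<in> Q'" "b \<in> Q'" by (rule coneE)
  have m2N: "m2 \<notin> N" using line_eq[OF N(1) 2(2), of m2 b] 2 bM b N(2) by metis
  show ?thesis
  proof
    fix x assume "x \<in> points H"
    then have "x \<in> cone a M" using C by auto
    then obtain m Q where 1: "m \<in> M" "Q \<in> lines H" "a \<in> Q" "m \<in> Q" "x \<in> Q" by (rule coneE)
    have "\<exists>n. n \<in> N \<and> n \<in> Q"
    proof (cases "m = m2")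
      case True
      then have "Q = Q'" using line_eq[OF 1(2) 2(2), of a m] 1 2 a by metis
      then show ?thesis using 2 b by metis
    next
      case False
      then have "m2 \<notin> Q" using line_eq[OF M 1(2), of m m2] 1 2 a by metis
      moreover have "Q' \<noteq> M" using 2 a by metis
      ultimately show ?thesis
        using veblen[OF 2(2) M N(1) 1(2) _ 2(4,1) m2N, of b m0 a m] 1 2 b m0 by metis
    qed
    then show "x \<in> cone a N" using 1 coneI by metis
  qed
qed (use C in simp)

lemma cone_lines_meet:
  assumes M: "M \<in> lines H" and a: "a \<notin> M" "a \<in> points H" and C: "points H \<subseteq> cone a M"
    and N: "N \<in> lines H" "N' \<in> lines H"
  obtains y where "y \<in> N" "y \<in> N'"
proof (cases "a \<in> N")
  case True
  show ?thesis
  proof (cases "a \<in> N'")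
    case False
    from cone_change_base[OF M a C N(2) False] show ?thesis
      using cone_line_meets_base[OF N(2) False _ N(1)] that by metis
  qed (use True that in metis)
next
  case False
  from cone_change_base[OF M a C N(1) False] show ?thesis
    using cone_line_meets_base[OF N(1) False _ N(2)] that by metis
qed

text \<open>Since no two points generate, the three generators are not on a line, so the space is a
  cone over a line and any two lines meet. Hence the line from \<open>x\<close> to any other point
  has a second point in \<open>T\<close>, namely one on \<open>N\<close>.\<close>

lemma plane_generated:
  assumes dim: "projective_space_of_dim H 2"
    and N: "N \<in> lines H" and x: "x \<in> points H" "x \<notin> N"
    and T: "subspace H T" "N \<subseteq> T" "x \<in> T"
  shows "points H \<subseteq> T"
proof -
  obtain A where A: "A \<subseteq> points H" "card A = 3" "subspace_span H A = points H"
    using dim unfolding projective_space_of_dim_def by auto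
  have least: "3 \<le> card B" if "B \<subseteq> points H" "finite B" "subspace_span H B = points H" for B
    using dim that unfolding projective_space_of_dim_def by simp
  obtain a b c where abc: "A = {a, b, c}" "a \<noteq> b" "a \<noteq> c" "b \<noteq> c"
    using A(2) card_3_iff by metis
  then obtain M where M: "M \<in> lines H" "b \<in> M" "c \<in> M" using line_through A(1) by (metis insert_subset)
  have a: "a \<in> points H" using A abc by simp
  have aM: "a \<notin> M"
  proof
    assume aM: "a \<in> M"
    have sub: "subspace H (subspace_span H {b, c})"
      by (rule subspace_span_subspace[OF plg]) (use A abc in auto)
    have bc: "b \<in> subspace_span H {b, c}" "c \<in> subspace_span H {b, c}"
      using subspace_span_superset by fast+
    have "M \<subseteq> subspace_span H {b, c}" using subspaceD[OF sub bc abc(4) M] .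
    then have "A \<subseteq> subspace_span H {b, c}" using aM abc M by auto
    then have "points H \<subseteq> subspace_span H {b, c}" using subspace_span_least[OF sub] A(3) by auto
    then have "subspace_span H {b, c} = points H" using sub by (auto simp: subspace_def)
    then have "3 \<le> card {b, c}" using A abc by (intro least) auto
    then show False using abc by simp
  qed
  have C: "points H \<subseteq> cone a M"
    using subspace_span_least[OF cone_subspace[OF M(1) a aM], of A] cone_superset[OF M(1) a aM] A abc M
    by auto
  show ?thesis
  proof
    fix y assume y: "y \<in> points H"
    show "y \<in> T"
    proof (cases "y = x")
      case False
      then obtain Q where Q: "Q \<in> lines H" "x \<in> Q" "y \<in> Q" using line_through x y by metis
      obtain n where n: "n \<in> Q" "n \<in> N" using cone_lines_meet[OF M(1) aM a C Q(1) N] .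
      have "Q \<subseteq> T" using subspaceD[OF T(1) T(3) _ _ Q(1,2) n(1)] n T(2) x(2) by auto
      then show ?thesis using Q by auto
    qed (use T in simp)
  qed
qed

section \<open>Planes spanned by two lines\<close>

text \<open>Two distinct points are asked for because a single point is a subspace that is not
  covered by lines.\<close>

lemma projective_space_induced:
  assumes P: "subspace H P" and uv: "u \<in> P" "v \<in> P" "u \<noteq> v"
  shows "projective_space (induced H P)"
  unfolding projective_space_def
proof (intro conjI)
  have PH: "P \<subseteq> points H" using P by (simp add: subspace_def)
  have line: "\<exists>!L. L \<in> lines (induced H P) \<and> x \<in> L \<and> y \<in> L" if xy: "x \<in> P" "y \<in> P" "x \<noteq> y" for x y
  proof -
    have "x \<in> points H" "y \<in> points H" using xy PH by auto
    then obtain L where L: "L \<in> lines H" "x \<in> L" "y \<in> L" using line_through xy(3) by metis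
    have LP: "L \<subseteq> P" using subspaceD[OF P xy L] .
    have uniq: "M = L" if "M \<in> lines H" "x \<in> M" "y \<in> M" for M
      using line_eq[OF that(1) L(1) that(2,3) L(2,3) \<open>x \<noteq> y\<close>] .
    show ?thesis
    proof (rule ex1I[of _ L])
      show "L \<in> lines (induced H P) \<and> x \<in> L \<and> y \<in> L" using L LP by simp
      show "M = L" if "M \<in> lines (induced H P) \<and> x \<in> M \<and> y \<in> M" for M
        by (rule uniq) (use that in auto)
    qed
  qed
  then show "\<forall>x\<in>points (induced H P). \<forall>y\<in>points (induced H P).
       x \<noteq> y \<longrightarrow> (\<exists>!L. L \<in> lines (induced H P) \<and> x \<in> L \<and> y \<in> L)" by simp
  have "\<exists>L\<in>lines (induced H P). x \<in> L" if "x \<in> P" for x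
    using line[of x u] line[of x v] uv that by metis
  then have "P \<subseteq> \<Union> (lines (induced H P))" by auto
  moreover have "\<exists>x\<in>L. \<exists>y\<in>L. x \<noteq> y" if "L \<in> lines H" for L
    using that plg unfolding point_line_geometry_def by metis
  ultimately show "point_line_geometry (induced H P)" unfolding point_line_geometry_def by auto
  show "thick_lines (induced H P)" using proj by (simp add: projective_space_def thick_lines_def)
  show "\<forall>K\<in>lines (induced H P). \<forall>L\<in>lines (induced H P). \<forall>M\<in>lines (induced H P). \<forall>N\<in>lines (induced H P).
     \<forall>x. K \<noteq> L \<and> x \<in> K \<inter> L \<and> x \<notin> M \<and> x \<notin> N \<and> M \<inter> K \<noteq> {} \<and> M \<inter> L \<noteq> {} \<and> N \<inter> K \<noteq> {} \<and> N \<inter> L \<noteq> {} \<longrightarrow>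
         M \<inter> N \<noteq> {}"
  proof (intro ballI allI impI, elim conjE)
    fix K L M N x
    assume "K \<in> lines (induced H P)" "L \<in> lines (induced H P)" "M \<in> lines (induced H P)"
      "N \<in> lines (induced H P)"
    then have lns: "K \<in> lines H" "L \<in> lines H" "M \<in> lines H" "N \<in> lines H" by auto
    assume "x \<in> K \<inter> L" and x: "K \<noteq> L" "x \<notin> M" "x \<notin> N" and
      "M \<inter> K \<noteq> {}" "M \<inter> L \<noteq> {}" "N \<inter> K \<noteq> {}" "N \<inter> L \<noteq> {}"
    then obtain a b c d where "x \<in> K" "x \<in> L" "a \<in> M" "a \<in> K" "b \<in> M" "b \<in> L"
      "c \<in> N" "c \<in> K" "d \<in> N" "d \<in> L" by auto
    from veblen[OF lns x(1) this(1,2) x(2,3) this(3-10)] show "M \<inter> N \<noteq> {}" by auto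
  qed
qed

text \<open>One further point on each line and \<open>p\<close> generate the span. Fewer points
  never do: padded to two, they lie on a line, which is a subspace and cannot contain both
  \<open>L\<close> and \<open>M\<close>.\<close>

lemma plane_of_two_lines:
  assumes L: "L \<in> lines H" "p \<in> L" and M: "M \<in> lines H" "p \<in> M" and LM: "L \<noteq> M"
  shows "projective_space_of_dim (induced H (subspace_span H (L \<union> M))) 2"
proof -
  define P where "P = subspace_span H (L \<union> M)"
  have P: "subspace H P" unfolding P_def
    using L M line_subset_points[OF plg] by (intro subspace_span_subspace[OF plg]) auto
  have LP: "L \<subseteq> P" "M \<subseteq> P" unfolding P_def using subspace_span_superset by fast+
  obtain l where l: "l \<in> L" "l \<noteq> p" using line_point_ne[OF L(1)] by metis
  obtain m where m: "m \<in> M" "m \<noteq> p" using line_point_ne[OF M(1)] by metis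
  have proj': "projective_space (induced H P)" using projective_space_induced[OF P, of p l] l L LP by auto
  interpret P: projective "induced H P" by unfold_locales (rule proj')
  have lm: "l \<noteq> m" using line_eq[OF L(1) M(1)] l m L M LM by metis
  have span3: "subspace_span (induced H P) {p, l, m} = P"
  proof
    have sP: "subspace (induced H P) (subspace_span (induced H P) {p, l, m})"
      using l m L M LP by (intro subspace_span_subspace[OF P.plg]) auto
    then have *: "subspace_span (induced H P) {p, l, m} \<subseteq> P" by (simp add: subspace_def)
    then show "subspace_span (induced H P) {p, l, m} \<subseteq> P" .
    have S: "subspace H (subspace_span (induced H P) {p, l, m})" using sP subspace_induced[OF P *] by simp
    have plm: "p \<in> subspace_span (induced H P) {p, l, m}" "l \<in> subspace_span (induced H P) {p, l, m}"
       "m \<in> subspace_span (induced H P) {p, l, m}" using subspace_span_superset by fast+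
    have "L \<subseteq> subspace_span (induced H P) {p, l, m}" "M \<subseteq> subspace_span (induced H P) {p, l, m}"
      using subspaceD[OF S plm(1,2) _ L(1)] subspaceD[OF S plm(1,3) _ M(1)] l m L M by auto
    then show "P \<subseteq> subspace_span (induced H P) {p, l, m}"
      unfolding P_def[symmetric] using subspace_span_least[OF S, of "L \<union> M"] P_def by auto
  qed
  have three: "3 \<le> card A" if A: "A \<subseteq> P" "finite A" "subspace_span (induced H P) A = P" for A
  proof (rule ccontr)
    assume "\<not> 3 \<le> card A"
    then have c: "card A \<le> 2" by simp
    have "\<exists>u v. u \<in> P \<and> v \<in> P \<and> u \<noteq> v \<and> A \<subseteq> {u, v}"
    proof -
      consider "card A = 0" | "card A = 1" | "card A = 2" using c by linarith
      then show ?thesis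
      proof cases
        case 1 then show ?thesis using A(2) l L LP by (intro exI[of _ p] exI[of _ l]) auto
      next
        case 2
        then obtain u where "A = {u}" using card_1_singletonE by metis
        moreover obtain v where "v \<in> P" "v \<noteq> u" using l L LP by (metis subsetD)
        ultimately show ?thesis using A(1) by (intro exI[of _ u] exI[of _ v]) auto
      next
        case 3
        then obtain u v where "A = {u, v}" "u \<noteq> v" by (metis card_2_iff)
        then show ?thesis using A(1) by (intro exI[of _ u] exI[of _ v]) auto
      qed
    qed
    then obtain u v where uv: "u \<in> P" "v \<in> P" "u \<noteq> v" "A \<subseteq> {u, v}" by blast
    then obtain N where N: "N \<in> lines (induced H P)" "u \<in> N" "v \<in> N" using P.line_through by (metis points_induced)
    have "P \<subseteq> N" using subspace_span_least[OF P.line_subspace[OF N(1)], of A] uv N A by auto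
    then have "L \<subseteq> N" "M \<subseteq> N" "N \<in> lines H" using LP N by auto
    then have "L = N" "M = N" using line_eq[OF L(1), of N p l] line_eq[OF M(1), of N p m] l m L M by auto
    then show False using LM by simp
  qed
  have "card {p, l, m} = 3" using l m lm by auto
  then have "\<exists>A\<subseteq>P. finite A \<and> card A = 2 + 1 \<and> subspace_span (induced H P) A = P"
    using span3 l m L M LP by (intro exI[of _ "{p, l, m}"]) auto
  then show ?thesis
    unfolding projective_space_of_dim_def P_def[symmetric] using proj' three by simp
qed

end

lemma singular_plane_projective: "singular_plane G P \<Longrightarrow> projective (induced G P)"
  by (simp add: singular_plane_def projective_space_of_dim_def projective_def)

lemma singular_plane_subspace: "singular_plane G P \<Longrightarrow> subspace G P"
  by (simp add: singular_plane_def singular_subspace_def)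

lemma singular_plane_least:
  assumes P: "singular_plane G P" and N: "N \<in> lines G" "N \<subseteq> P" and x: "x \<in> P" "x \<notin> N"
    and T: "subspace G T" "N \<subseteq> T" "x \<in> T"
  shows "P \<subseteq> T"
proof -
  interpret projective "induced G P" using P by (rule singular_plane_projective)
  have sP: "subspace G P" using P by (rule singular_plane_subspace)
  have "subspace G (P \<inter> T)" using subspace_Inter[of "{P, T}" G] sP T by auto
  then have "subspace (induced G P) (P \<inter> T)" using subspace_induced[OF sP, of "P \<inter> T"] by simp
  then have "points (induced G P) \<subseteq> P \<inter> T"
    using P N x T by (intro plane_generated[of N x]) (auto simp: singular_plane_def)
  then show ?thesis by simp
qed

text \<open>A further common point would make each plane contain the other. This yields the exact
  intersections in lines that \<open>locally_connected\<close> demands of consecutive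
  planes.\<close>

lemma singular_plane_inter:
  assumes P: "singular_plane G P" and Q: "singular_plane G Q" and ne: "P \<noteq> Q"
    and N: "N \<in> lines G" "N \<subseteq> P" "N \<subseteq> Q"
  shows "P \<inter> Q = N"
proof (rule ccontr)
  assume "P \<inter> Q \<noteq> N"
  then obtain x where x: "x \<in> P" "x \<in> Q" "x \<notin> N" using N by blast
  have "P \<subseteq> Q" "Q \<subseteq> P"
    using singular_plane_least[OF P N(1,2) x(1,3) singular_plane_subspace[OF Q] N(3) x(2)]
      singular_plane_least[OF Q N(1,3) x(2,3) singular_plane_subspace[OF P] N(2) x(1)] by auto
  then show False using ne by simp
qed

text \<open>Collinearity in the residue at \<open>p\<close>, but without asking for a symp around
  the plane; in this form it applies equally to a symp and to a sheet, and it matches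
  \<open>locally_connected\<close>.\<close>

definition coplanar :: "'a geometry \<Rightarrow> 'a \<Rightarrow> ('a set \<times> 'a set) set" where
  "coplanar G p = {(L, M). L \<in> lines G \<and> M \<in> lines G \<and> p \<in> L \<and> p \<in> M \<and>
     (\<exists>P. singular_plane G P \<and> L \<subseteq> P \<and> M \<subseteq> P)}"

subsection \<open>Polar spaces of rank at least three\<close>

locale polar_rank3 =
  fixes G :: "'a geometry"
  assumes rank3: "polar_rank_at_least G 3"
begin

lemma polar: "polar_space G"
  using rank3 by (auto simp: polar_rank_at_least_def has_polar_rank_def)

lemma plg: "point_line_geometry G"
  using polar by (rule polar_space_plg)

sublocale one_or_all G
  using polar by (rule polar_space_one_or_all)

section \<open>Maximal cliques as projective spaces\<close>

definition clique :: "'a set \<Rightarrow> bool" where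
  "clique X \<longleftrightarrow> X \<subseteq> points G \<and> (\<forall>x\<in>X. \<forall>y\<in>X. y \<in> perp G x)"

lemma clique_extend:
  assumes "clique X"
  obtains K where "X \<subseteq> K" "clique K" "\<And>Y. clique Y \<Longrightarrow> K \<subseteq> Y \<Longrightarrow> Y = K"
proof -
  have "\<exists>K\<in>{K. clique K \<and> X \<subseteq> K}. \<forall>Y\<in>{K. clique K \<and> X \<subseteq> K}. K \<subseteq> Y \<longrightarrow> Y = K"
  proof (rule subset_Zorn_nonempty)
    show "{K. clique K \<and> X \<subseteq> K} \<noteq> {}" using assms by auto
    fix \<C> assume ne: "\<C> \<noteq> {}" and ch: "subset.chain {K. clique K \<and> X \<subseteq> K} \<C>"
    then have C: "\<And>K. K \<in> \<C> \<Longrightarrow> clique K \<and> X \<subseteq> K" "\<And>K L. K \<in> \<C> \<Longrightarrow> L \<in> \<C> \<Longrightarrow> K \<subseteq> L \<or> L \<subseteq> K"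
      by (auto simp: subset_chain_def)
    have "y \<in> perp G x" if xy: "x \<in> \<Union>\<C>" "y \<in> \<Union>\<C>" for x y
    proof -
      obtain K L where "K \<in> \<C>" "x \<in> K" "L \<in> \<C>" "y \<in> L" using xy by auto
      then obtain M where "M \<in> \<C>" "x \<in> M" "y \<in> M" using C(2) by (metis subsetD)
      then show ?thesis using C(1) unfolding clique_def by metis
    qed
    moreover have "\<Union>\<C> \<subseteq> points G" using C(1) unfolding clique_def by (meson Union_least)
    moreover have "X \<subseteq> \<Union>\<C>" using ne C(1) by (metis Union_upper ex_in_conv order_trans)
    ultimately show "\<Union>\<C> \<in> {K. clique K \<and> X \<subseteq> K}" by (simp add: clique_def)
  qed
  then obtain K where K: "clique K" "X \<subseteq> K" "\<forall>Y\<in>{K. clique K \<and> X \<subseteq> K}. K \<subseteq> Y \<longrightarrow> Y = K" by auto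
  show ?thesis
  proof (rule that[OF K(2,1)])
    fix Y assume "clique Y" "K \<subseteq> Y"
    then show "Y = K" using K by auto
  qed
qed

text \<open>A maximal clique contains every line through two of its points, because by one-or-all
  adding such a line leaves it a clique. It is therefore a maximal singular subspace, and the rank
  hypothesis turns it into a projective space of dimension \<open>r - 1\<close>, at least
  two.\<close>

lemma max_clique:
  assumes "clique X"
  obtains K r where "X \<subseteq> K" "clique K" "subspace G K"
    "projective_space_of_dim (induced G K) (r - 1)" "3 \<le> r"
proof -
  obtain K where K: "X \<subseteq> K" "clique K" "\<And>Y. clique Y \<Longrightarrow> K \<subseteq> Y \<Longrightarrow> Y = K"
    using clique_extend[OF assms] by blast
  have sub: "subspace G K"
    unfolding subspace_def
  proof (intro conjI ballI allI impI)
    show "K \<subseteq> points G" using K(2) by (simp add: clique_def)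
    fix x y L assume xy: "x \<in> K" "y \<in> K" "L \<in> lines G" "x \<noteq> y \<and> x \<in> L \<and> y \<in> L"
    have *: "L \<subseteq> perp G c" if "c \<in> K" for c
      using all[of c L x y] that xy K(2) unfolding clique_def by blast
    have "c \<in> perp G u" if "c \<in> K" "u \<in> L" for c u
      using psym[of u c] * that K(2) unfolding clique_def by blast
    moreover have "v \<in> perp G u" if "v \<in> L" "u \<in> L" for u v
      using same_line xy(3) that by metis
    ultimately have "clique (K \<union> L)" unfolding clique_def
      using K(2) * line_sub[OF xy(3)] unfolding clique_def by blast
    then show "L \<subseteq> K" using K(3)[of "K \<union> L"] by auto
  qed
  have sing: "singular_subspace G T \<longleftrightarrow> subspace G T \<and> clique T" for T
    unfolding singular_subspace_def clique_def perp_def subspace_def by auto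
  have max: "maximal_singular_subspace G K" unfolding maximal_singular_subspace_def
    using sing K sub by auto
  obtain r where "3 \<le> r" "has_polar_rank G r" using rank3 by (auto simp: polar_rank_at_least_def)
  moreover from this have "projective_space_of_dim (induced G K) (r - 1)"
    using max by (simp add: has_polar_rank_def)
  ultimately show ?thesis using that K sub by metis
qed

lemma line_clique: "L \<in> lines G \<Longrightarrow> clique L"
  unfolding clique_def using same_line line_sub by blast

text \<open>That two points determine their line is not among the axioms of
  \<open>polar_space\<close>; it is inherited from a projective space around \<open>L\<close>, which
  also contains \<open>M\<close>.\<close>

lemma line_eq:
  assumes "L \<in> lines G" "M \<in> lines G" "x \<in> L" "y \<in> L" "x \<in> M" "y \<in> M" "x \<noteq> y"
  shows "L = M"
proof -
  obtain K r where K: "L \<subseteq> K" "subspace G K" "projective_space_of_dim (induced G K) (r - 1)"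
    using max_clique[OF line_clique[OF assms(1)]] by metis
  then interpret projective "induced G K"
    by unfold_locales (simp add: projective_space_of_dim_def)
  have "M \<subseteq> K" using subspaceD[OF K(2), of x y M] K assms by auto
  then show ?thesis using line_eq[of L M x y] assms K by auto
qed

lemma line_points:
  assumes "L \<in> lines G"
  obtains x y where "x \<in> L" "y \<in> L" "x \<noteq> y"
  using assms plg unfolding point_line_geometry_def by metis

text \<open>Two points generate a line, whereas the maximal clique needs at least three
  generators.\<close>

lemma max_clique_line:
  assumes L: "L \<in> lines G"
  obtains K n where "L \<subseteq> K" "clique K" "n \<in> K" "n \<notin> L"
proof -
  obtain K r where K: "L \<subseteq> K" "clique K" "subspace G K"
    "projective_space_of_dim (induced G K) (r - 1)" "3 \<le> r"
    using max_clique[OF line_clique[OF L]] by metis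
  obtain x y where xy: "x \<in> L" "y \<in> L" "x \<noteq> y" using line_points[OF L] by metis
  interpret projective "induced G K" using K by unfold_locales (simp add: projective_space_of_dim_def)
  have "K \<noteq> L"
  proof
    assume KL: "K = L"
    have sub: "subspace (induced G K) (subspace_span (induced G K) {x, y})"
      using xy KL by (intro subspace_span_subspace plg) auto
    have "L \<subseteq> subspace_span (induced G K) {x, y}"
      using subspaceD[OF sub, of x y L] subspace_span_superset[of "{x, y}" "induced G K"] xy L KL by auto
    then have "subspace_span (induced G K) {x, y} = K" using KL sub by (auto simp: subspace_def)
    then have "r - 1 + 1 \<le> card {x, y}"
      using K(4) xy KL unfolding projective_space_of_dim_def by (metis empty_subsetI finite.emptyI finite_insert insert_subset points_induced)
    then show False using K(5) xy by simp
  qed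
  then show ?thesis using K that by blast
qed

text \<open>One-or-all spreads perpendicularity from \<open>l\<close> and \<open>m\<close> to all of
  \<open>L\<close> and \<open>M\<close>. Their union is then a clique, and in a projective space
  around it two meeting lines span a plane.\<close>

lemma perp_coplanar:
  assumes L: "L \<in> lines G" "p \<in> L" "l \<in> L" "l \<noteq> p" and M: "M \<in> lines G" "p \<in> M" "m \<in> M" "m \<noteq> p"
    and LM: "L \<noteq> M" and lm: "m \<in> perp G l"
  obtains P where "singular_plane G P" "L \<subseteq> P" "M \<subseteq> P"
proof -
  have lp: "l \<in> points G" using L line_sub by auto
  have 1: "M \<subseteq> perp G l" using all[OF lp M(1,2,3)] M(4) lm same_line[OF L(1,3,2)] by auto
  have 2: "L \<subseteq> perp G u" if u: "u \<in> M" for u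
  proof -
    have up: "u \<in> points G" using M u line_sub by auto
    have "l \<in> perp G u" using 1 u psym lp by blast
    then show ?thesis using all[OF up L(1,2,3)] L(4) same_line[OF M(1) u M(2)] by auto
  qed
  have "u \<in> perp G v" if "u \<in> M" "v \<in> L" for u v
    using 2[OF that(1)] that line_sub[OF M(1)] psym by blast
  then have "clique (L \<union> M)" unfolding clique_def using 2 line_sub[OF L(1)] line_sub[OF M(1)]
    same_line[OF L(1)] same_line[OF M(1)] by blast
  then obtain K r where K: "L \<union> M \<subseteq> K" "clique K" "subspace G K" "projective_space_of_dim (induced G K) (r - 1)"
    using max_clique by metis
  interpret projective "induced G K" using K by unfold_locales (simp add: projective_space_of_dim_def)
  define P where "P = subspace_span (induced G K) (L \<union> M)"
  have sP: "subspace (induced G K) P" unfolding P_def using K by (intro subspace_span_subspace plg) auto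
  then have PK: "P \<subseteq> K" by (simp add: subspace_def)
  have "subspace G P" using sP subspace_induced[OF K(3) PK] by simp
  moreover have "collin G x y" if "x \<in> P" "y \<in> P" "x \<noteq> y" for x y
  proof -
    have "y \<in> perp G x" using that PK K(2) unfolding clique_def by blast
    then show ?thesis using that(3) by (auto simp: perp_def)
  qed
  moreover have "projective_space_of_dim (induced G P) 2"
    using plane_of_two_lines[of L p M] L M LM K(1) unfolding P_def[symmetric] induced_induced[OF PK] by simp
  ultimately have "singular_plane G P" by (simp add: singular_plane_def singular_subspace_def)
  moreover have "L \<union> M \<subseteq> P" unfolding P_def by (rule subspace_span_superset)
  ultimately show ?thesis using that by simp
qed

section \<open>Connected residues and perps of lines in a polar space\<close>

lemma coplanarI:
  assumes "L \<in> lines G" "p \<in> L" "l \<in> L" "l \<noteq> p" "M \<in> lines G" "p \<in> M" "m \<in> M" "m \<noteq> p" "m \<in> perp G l"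
  shows "(L, M) \<in> (coplanar G p)\<^sup>*"
proof (cases "L = M")
  case False
  then show ?thesis using perp_coplanar[OF assms(1-8) False assms(9)] assms
    by (intro r_into_rtrancl) (auto simp: coplanar_def)
qed simp

text \<open>Let \<open>N\<close> be a line that meets \<open>L\<close> in \<open>l\<close>, avoids
  \<open>p\<close> and lies in \<open>perp G p\<close>; it exists because a maximal clique on
  \<open>L\<close> is larger than \<open>L\<close>. Some \<open>u\<close> on \<open>N\<close> is
  perpendicular to \<open>m\<close>, and the line \<open>pu\<close> is coplanar with both
  \<open>L\<close> and \<open>M\<close>.\<close>

lemma residue_connected:
  assumes L: "L \<in> lines G" "p \<in> L" and M: "M \<in> lines G" "p \<in> M"
  shows "(L, M) \<in> (coplanar G p)\<^sup>*"
proof -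
  obtain l where l: "l \<in> L" "l \<noteq> p" using line_points[OF L(1)] by metis
  obtain m where m: "m \<in> M" "m \<noteq> p" using line_points[OF M(1)] by metis
  obtain K n where K: "L \<subseteq> K" "clique K" "n \<in> K" "n \<notin> L" using max_clique_line[OF L(1)] .
  have nl: "n \<in> perp G l" "n \<noteq> l" using K l unfolding clique_def by auto
  obtain N where N: "N \<in> lines G" "l \<in> N" "n \<in> N" using perp_line[OF nl] .
  have pN: "p \<notin> N" using line_eq[OF L(1) N(1), of p l] L l N K by metis
  have mp: "m \<in> points G" "p \<in> points G" using m M line_sub by auto
  have "p \<in> perp G l" "p \<in> perp G n" using K L l unfolding clique_def by auto
  moreover have "l \<in> points G" "n \<in> points G" using K L l unfolding clique_def by auto
  ultimately have "l \<in> perp G p" "n \<in> perp G p" using psym by metis+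
  then have NP: "N \<subseteq> perp G p" using all[OF mp(2) N(1,2,3)] nl by auto
  obtain u where u: "u \<in> N" "u \<in> perp G m" using hit[OF mp(1) N(1)] by auto
  have up: "u \<in> perp G p" "u \<noteq> p" using u NP pN by auto
  obtain Q where Q: "Q \<in> lines G" "p \<in> Q" "u \<in> Q" using perp_line[OF up] .
  have "u \<in> perp G l" using same_line[OF N(1,2) u(1)] .
  then have "(L, Q) \<in> (coplanar G p)\<^sup>*" using coplanarI[OF L l Q up(2)] by simp
  moreover have "m \<in> perp G u" using psym[OF u(2) mp(1)] .
  then have "(Q, M) \<in> (coplanar G p)\<^sup>*" using coplanarI[OF Q up(2) M m] by simp
  ultimately show ?thesis by simp
qed

text \<open>For \<open>p\<close> and \<open>l\<close> on \<open>L\<close>, choose \<open>w\<close> perpendicular to \<open>p\<close> but not to \<open>l\<close>. Then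
  \<open>l\<^sup>\<bottom> \<inter> w\<^sup>\<bottom>\<close> is nondegenerate and contains, besides \<open>p\<close>, a point \<open>c\<close> of a plane on \<open>L\<close>; so it has
  a point that is perpendicular to \<open>p\<close> (hence to \<open>L\<close>) but not to \<open>c\<close>.\<close>

lemma line_perp_not_clique:
  assumes L: "L \<in> lines G"
  obtains a b where "a \<in> points G" "b \<in> points G" "L \<subseteq> perp G a" "L \<subseteq> perp G b" "b \<notin> perp G a"
proof -
  obtain p l where pl: "p \<in> L" "l \<in> L" "p \<noteq> l" using line_points[OF L] .
  have pts: "p \<in> points G" "l \<in> points G" using pl line_sub[OF L] by auto
  have "l \<in> perp G p" using same_line[OF L pl(1,2)] .
  then obtain w where w: "w \<in> perp G p" "w \<notin> perp G l"
    using perp_not_subset[OF pts(1)] pl(3) by metis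
  have wp: "w \<in> points G" using w perp_points by metis
  obtain K n where K: "L \<subseteq> K" "clique K" "n \<in> K" "n \<notin> L" using max_clique_line[OF L] .
  have nl: "n \<in> perp G l" "n \<noteq> l" using K pl unfolding clique_def by auto
  obtain N where N: "N \<in> lines G" "l \<in> N" "n \<in> N" using perp_line[OF nl] .
  have "l \<in> perp G p" "n \<in> perp G p" using K pl unfolding clique_def by auto
  then have NP: "N \<subseteq> perp G p" using all[OF pts(1) N] nl by auto
  obtain c where c: "c \<in> N" "c \<in> perp G w" using hit[OF wp N(1)] by auto
  have cl: "c \<in> perp G l" using same_line[OF N(1,2) c(1)] .
  have cp: "c \<in> perp G p" using c NP by auto
  have cn: "c \<noteq> p" using line_eq[OF L N(1), of p l] pl c N K by metis
  let ?S = "perp G l \<inter> perp G w"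
  interpret S: one_or_all "induced G ?S" using perp_perp_one_or_all[OF pts(2) wp w(2)] .
  have S: "subspace G ?S" using perp_perp_subspace[OF pts(2) wp] .
  have pS: "p \<in> ?S" using same_line[OF L pl(2,1)] psym[OF w(1) pts(1)] by simp
  have cS: "c \<in> ?S" using cl c by simp
  obtain b where "b \<in> perp (induced G ?S) p" "b \<notin> perp (induced G ?S) c"
    using S.perp_not_subset[of p c] pS cS cn cp perp_induced[OF S pS] by auto
  then have b: "b \<in> perp G p" "b \<in> ?S" "b \<notin> perp G c"
    using perp_induced[OF S pS] perp_induced[OF S cS] by auto
  have bp: "b \<in> points G" "c \<in> points G" using b cp perp_points by metis+
  have "p \<in> perp G c" "l \<in> perp G c" "p \<in> perp G b" "l \<in> perp G b"
    using cp cl b psym pts by auto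
  then have "L \<subseteq> perp G c" "L \<subseteq> perp G b" using all[OF bp(2) L pl] all[OF bp(1) L pl] by auto
  then show ?thesis using that bp b by metis
qed

end

text \<open>A single common point is perpendicular to itself, hence to all common points, against
  \<open>perp_perp_nondeg\<close>. So a non-collinear pair inside a symp never falls under the
  one-point alternative of (PPS2).\<close>

lemma (in one_or_all) common_perp_not_single:
  assumes "x \<in> points G" "y \<in> points G" "y \<notin> perp G x"
  shows "perp G x \<inter> perp G y \<noteq> {c}"
proof
  assume c: "perp G x \<inter> perp G y = {c}"
  then have "c \<in> perp G x" "c \<in> perp G y" by auto
  then obtain d where d: "d \<in> perp G x \<inter> perp G y" "d \<notin> perp G c" using perp_perp_nondeg[OF assms] by blast
  moreover have "c \<in> points G" using c perp_points by fastforce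
  ultimately show False using c by (auto simp: perp_refl)
qed

lemma (in one_or_all) common_perp:
  assumes "point_line_geometry G" "x \<in> points G" "y \<in> points G" "y \<notin> perp G x"
  shows "\<exists>z. z \<in> points G \<and> collin G x z \<and> collin G z y"
proof -
  obtain N where N: "N \<in> lines G" "y \<in> N" using assms(1,3) unfolding point_line_geometry_def by blast
  obtain z where z: "z \<in> N" "z \<in> perp G x" using hit[OF assms(2) N(1)] by blast
  have "z \<noteq> y" "z \<noteq> x" using z assms N same_line by metis+
  then show ?thesis using z N unfolding perp_def collin_def by auto
qed

text \<open>Suppose the clique meets every line. For \<open>a\<close> outside it, take a clique
  point \<open>l\<close> on a line through \<open>a\<close>, and \<open>w\<close> perpendicular to
  \<open>a\<close> but not to \<open>l\<close>. The line \<open>aw\<close> has a clique point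
  \<open>m\<close>, so \<open>l\<close> is perpendicular to \<open>a\<close> and \<open>m\<close>
  and therefore to \<open>w\<close>.\<close>

lemma (in one_or_all) clique_misses_line:
  assumes plg: "point_line_geometry G" and A: "A \<subseteq> points G" "\<And>u v. u \<in> A \<Longrightarrow> v \<in> A \<Longrightarrow> v \<in> perp G u"
    and ne: "points G \<noteq> {}"
  shows "\<exists>L\<in>lines G. L \<inter> A = {}"
proof (rule ccontr)
  assume "\<not> ?thesis"
  then have meet: "\<exists>l. l \<in> L \<and> l \<in> A" if "L \<in> lines G" for L using that by auto
  obtain x where x: "x \<in> points G" using ne by auto
  obtain y where y: "y \<in> points G" "y \<notin> perp G x" using nondeg[OF x] by auto
  obtain a where a: "a \<in> points G" "a \<notin> A" using A(2)[of x y] x y by auto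
  obtain L where L: "L \<in> lines G" "a \<in> L" using a plg unfolding point_line_geometry_def by auto
  obtain l where l: "l \<in> L" "l \<in> A" using meet[OF L(1)] by auto
  have "l \<in> perp G a" "l \<noteq> a" using same_line[OF L l(1)] l a by auto
  then obtain w where w: "w \<in> perp G a" "w \<notin> perp G l" using perp_not_subset[OF a(1)] by auto
  have lp: "l \<in> points G" using l A by auto
  have al: "a \<in> perp G l" using same_line[OF L(1) l(1) L(2)] .
  then have "w \<noteq> a" using w by auto
  then obtain M where M: "M \<in> lines G" "a \<in> M" "w \<in> M" using perp_line[OF w(1)] by auto
  obtain m where m: "m \<in> M" "m \<in> A" using meet[OF M(1)] by auto
  have "m \<noteq> a" using m a by auto
  then have "M \<subseteq> perp G l" using all[OF lp M(1) m(1) M(2) _ A(2)[OF l(2) m(2)] al] by simp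
  then show False using w M by auto
qed

subsection \<open>Transport along isomorphisms\<close>

text \<open>\<open>f\<close> is injective on \<open>points G\<close> only, so images of lines can be
  compared once lines are known to consist of points. Nothing else is asked of \<open>G\<close>,
  which lets \<open>iso_induced\<close> restrict to arbitrary point sets.\<close>

locale geo_iso =
  fixes f :: "'a \<Rightarrow> 'b" and G :: "'a geometry" and H :: "'b geometry"
  assumes iso: "geometry_iso f G H"
    and line_sub: "L \<in> lines G \<Longrightarrow> L \<subseteq> points G"
begin

lemma inj: "inj_on f (points G)"
  using iso by (simp add: geometry_iso_def bij_betw_def)

lemma points_eq: "points H = f ` points G"
  using iso by (simp add: geometry_iso_def bij_betw_def)

lemma lines_eq: "lines H = (`) f ` lines G"
  using iso by (simp add: geometry_iso_def)

lemma f_points: "x \<in> points G \<Longrightarrow> f x \<in> points H"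
  by (simp add: points_eq)

lemma f_eq: "x \<in> points G \<Longrightarrow> y \<in> points G \<Longrightarrow> f x = f y \<longleftrightarrow> x = y"
  using inj by (auto dest: inj_onD)

lemma f_mem: "x \<in> points G \<Longrightarrow> S \<subseteq> points G \<Longrightarrow> f x \<in> f ` S \<longleftrightarrow> x \<in> S"
  by (rule inj_on_image_mem_iff[OF inj])

lemma f_sub: "S \<subseteq> points G \<Longrightarrow> T \<subseteq> points G \<Longrightarrow> f ` S \<subseteq> f ` T \<longleftrightarrow> S \<subseteq> T"
proof -
  assume "S \<subseteq> points G" "T \<subseteq> points G"
  then have "f x \<in> f ` T \<longleftrightarrow> x \<in> T" if "x \<in> S" for x using that f_mem[of x T] by auto
  then show ?thesis unfolding image_subset_iff by (simp add: subset_eq)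
qed

lemma f_set_eq: "S \<subseteq> points G \<Longrightarrow> T \<subseteq> points G \<Longrightarrow> f ` S = f ` T \<longleftrightarrow> S = T"
  by (rule inj_on_image_eq_iff[OF inj])

lemma line_sub_image: "L \<in> lines H \<Longrightarrow> L \<subseteq> points H"
  using line_sub by (auto simp: lines_eq points_eq)

lemma setE:
  assumes "T \<subseteq> points H"
  obtains S where "S \<subseteq> points G" "T = f ` S"
  using assms unfolding points_eq by (metis subset_imageE)

lemma collin_iff: "x \<in> points G \<Longrightarrow> y \<in> points G \<Longrightarrow> collin H (f x) (f y) \<longleftrightarrow> collin G x y"
proof -
  assume "x \<in> points G" "y \<in> points G"
  moreover from this have "(\<exists>L\<in>lines G. f x \<in> f ` L \<and> f y \<in> f ` L) \<longleftrightarrow> (\<exists>L\<in>lines G. x \<in> L \<and> y \<in> L)"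
    using f_mem line_sub by (intro bex_cong) auto
  ultimately show ?thesis unfolding collin_def lines_eq by (simp add: f_eq)
qed

lemma perp_image: "x \<in> points G \<Longrightarrow> perp H (f x) = f ` perp G x"
  unfolding perp_def points_eq using collin_iff f_eq by auto

lemma plg_image: "point_line_geometry G \<Longrightarrow> point_line_geometry H"
proof -
  assume plg: "point_line_geometry G"
  have "\<exists>x\<in>f ` L. \<exists>y\<in>f ` L. x \<noteq> y" if "L \<in> lines G" for L
  proof -
    obtain x y where "x \<in> L" "y \<in> L" "x \<noteq> y" using plg \<open>L \<in> lines G\<close> unfolding point_line_geometry_def by metis
    moreover from this have "f x \<noteq> f y" using f_eq line_sub[OF that] by auto
    ultimately show ?thesis by auto
  qed
  moreover have "\<Union>(lines H) = points H"
  proof -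
    have "\<Union>(lines H) = f ` \<Union>(lines G)" unfolding lines_eq by auto
    also have "\<Union>(lines G) = points G" using plg by (simp add: point_line_geometry_def)
    finally show ?thesis by (simp add: points_eq)
  qed
  moreover have "\<forall>L\<in>lines H. L \<subseteq> points H" using line_sub_image by simp
  ultimately show ?thesis unfolding point_line_geometry_def by (simp add: lines_eq)
qed

lemma thick_image:
  assumes "thick_lines G"
  shows "thick_lines H"
  unfolding thick_lines_def lines_eq
proof (clarify)
  fix L assume L: "L \<in> lines G"
  then obtain x y z where xyz: "x \<in> L" "y \<in> L" "z \<in> L" "x \<noteq> y" "x \<noteq> z" "y \<noteq> z"
    using assms unfolding thick_lines_def by metis
  then have "f x \<noteq> f y" "f x \<noteq> f z" "f y \<noteq> f z" using f_eq line_sub[OF L] by auto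
  then show "\<exists>x\<in>f ` L. \<exists>y\<in>f ` L. \<exists>z\<in>f ` L. x \<noteq> y \<and> x \<noteq> z \<and> y \<noteq> z" using xyz by blast
qed

lemma subspace_image:
  assumes "S \<subseteq> points G"
  shows "subspace H (f ` S) \<longleftrightarrow> subspace G S"
proof
  assume S: "subspace G S"
  have "f ` L \<subseteq> f ` S"
    if "x \<in> S" "y \<in> S" "L \<in> lines G" "f x \<noteq> f y" "f x \<in> f ` L" "f y \<in> f ` L" for x y L
    using subspaceD[OF S that(1,2) _ that(3)] that f_mem[of x L] f_mem[of y L] line_sub[of L] assms by blast
  then show "subspace H (f ` S)" unfolding subspace_def lines_eq points_eq using assms by auto
next
  assume S: "subspace H (f ` S)"
  have "L \<subseteq> S"
    if "x \<in> S" "y \<in> S" "L \<in> lines G" "x \<noteq> y" "x \<in> L" "y \<in> L" for x y L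
  proof -
    have "f x \<noteq> f y" using that f_eq assms by (metis subsetD)
    moreover have "f ` L \<in> lines H" using that by (simp add: lines_eq)
    ultimately have "f ` L \<subseteq> f ` S" using subspaceD[OF S, of "f x" "f y" "f ` L"] that by simp
    then show ?thesis using f_sub assms line_sub that(3) by simp
  qed
  then show "subspace G S" unfolding subspace_def using assms by blast
qed

lemma singular_image:
  assumes "S \<subseteq> points G"
  shows "singular_subspace H (f ` S) \<longleftrightarrow> singular_subspace G S"
proof -
  have "(f x \<noteq> f y \<longrightarrow> collin H (f x) (f y)) \<longleftrightarrow> (x \<noteq> y \<longrightarrow> collin G x y)" if "x \<in> S" "y \<in> S" for x y
    using that assms f_eq collin_iff by (metis subsetD)
  then show ?thesis unfolding singular_subspace_def subspace_image[OF assms] by simp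
qed

lemma singular_subspace_points: "singular_subspace K S \<Longrightarrow> S \<subseteq> points K"
  by (simp add: singular_subspace_def subspace_def)

lemma maximal_singular_image:
  assumes S: "S \<subseteq> points G" and max: "maximal_singular_subspace H (f ` S)"
  shows "maximal_singular_subspace G S"
  unfolding maximal_singular_subspace_def
proof (intro conjI allI impI)
  have m: "singular_subspace H (f ` S)" "\<And>T. singular_subspace H T \<Longrightarrow> f ` S \<subseteq> T \<Longrightarrow> T = f ` S"
    using max unfolding maximal_singular_subspace_def by auto
  show "singular_subspace G S" using m(1) S singular_image by simp
  fix T assume T: "singular_subspace G T \<and> S \<subseteq> T"
  then have Tp: "T \<subseteq> points G" using singular_subspace_points by blast
  have "f ` T = f ` S" using T Tp by (intro m(2)) (auto simp: singular_image)
  then show "T = S" using f_set_eq Tp S by simp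
qed

lemma iso_induced:
  assumes "S \<subseteq> points G"
  shows "geo_iso f (induced G S) (induced H (f ` S))"
proof
  have "(`) f ` {L \<in> lines G. L \<subseteq> S} = {L \<in> lines H. L \<subseteq> f ` S}"
    unfolding lines_eq using f_sub[OF line_sub assms] by auto
  then show "geometry_iso f (induced G S) (induced H (f ` S))"
    using inj assms by (auto simp: geometry_iso_def bij_betw_def intro: inj_on_subset)
qed auto

section \<open>Projective spaces under isomorphisms\<close>

text \<open>Turns generation into a statement about individual subspaces, so that
  \<open>span_image\<close> can match the subspaces of both sides one by one instead of moving an
  intersection along \<open>f\<close>.\<close>

lemma span_eq_points_iff:
  assumes "point_line_geometry K" "A \<subseteq> points K"
  shows "subspace_span K A = points K \<longleftrightarrow> (\<forall>S. subspace K S \<and> A \<subseteq> S \<longrightarrow> S = points K)"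
proof
  assume *: "subspace_span K A = points K"
  have "S = points K" if "subspace K S" "A \<subseteq> S" for S
  proof
    show "S \<subseteq> points K" using that by (simp add: subspace_def)
    show "points K \<subseteq> S" using subspace_span_least[OF that] * by simp
  qed
  then show "\<forall>S. subspace K S \<and> A \<subseteq> S \<longrightarrow> S = points K" by blast
next
  assume "\<forall>S. subspace K S \<and> A \<subseteq> S \<longrightarrow> S = points K"
  then show "subspace_span K A = points K"
    using subspace_span_subspace[OF assms] subspace_span_superset[of A K] by simp
qed

lemma span_image:
  assumes plg: "point_line_geometry G" and A: "A \<subseteq> points G"
  shows "subspace_span H (f ` A) = points H \<longleftrightarrow> subspace_span G A = points G"
proof -
  have "f ` A \<subseteq> points H" using A by (auto simp: points_eq)
  note H = span_eq_points_iff[OF plg_image[OF plg] this] and G = span_eq_points_iff[OF plg A]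
  show ?thesis unfolding H G
  proof (intro iffI allI impI; elim conjE)
    fix S assume *: "\<forall>S. subspace H S \<and> f ` A \<subseteq> S \<longrightarrow> S = points H" and S: "subspace G S" "A \<subseteq> S"
    then have Sp: "S \<subseteq> points G" by (simp add: subspace_def)
    have "f ` S = points H" using * S subspace_image[OF Sp] by (simp add: image_mono)
    then show "S = points G" using f_set_eq Sp points_eq by simp
  next
    fix T assume *: "\<forall>S. subspace G S \<and> A \<subseteq> S \<longrightarrow> S = points G" and T: "subspace H T" "f ` A \<subseteq> T"
    then have "T \<subseteq> points H" by (simp add: subspace_def)
    then obtain S where S: "S \<subseteq> points G" "T = f ` S" by (rule setE)
    then have "S = points G" using * T subspace_image f_sub[OF A] by simp
    then show "T = points H" using S points_eq by simp
  qed
qed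

lemma projective_image:
  assumes P: "projective_space G"
  shows "projective_space H"
  unfolding projective_space_def
proof (intro conjI ballI allI impI)
  interpret projective G using P by unfold_locales
  show "point_line_geometry H" using plg by (rule plg_image)
  show "thick_lines H" using P by (intro thick_image) (simp add: projective_space_def)
  fix x' y' assume "x' \<in> points H" "y' \<in> points H" "x' \<noteq> y'"
  then obtain x y where xy: "x' = f x" "y' = f y" "x \<in> points G" "y \<in> points G" "x \<noteq> y"
    unfolding points_eq by auto
  obtain L where L: "L \<in> lines G" "x \<in> L" "y \<in> L" using line_through xy by metis
  show "\<exists>!L. L \<in> lines H \<and> x' \<in> L \<and> y' \<in> L"
  proof (rule ex1I[of _ "f ` L"])
    show "f ` L \<in> lines H \<and> x' \<in> f ` L \<and> y' \<in> f ` L" using L xy by (auto simp: lines_eq)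
    fix M' assume "M' \<in> lines H \<and> x' \<in> M' \<and> y' \<in> M'"
    then obtain M where M: "M \<in> lines G" "M' = f ` M" "f x \<in> f ` M" "f y \<in> f ` M"
      using xy by (auto simp: lines_eq)
    then have "x \<in> M" "y \<in> M" using f_mem line_sub xy by blast+
    then show "M' = f ` L" using line_eq[OF M(1) L(1)] L xy M by blast
  qed
next
  interpret projective G using P by unfold_locales
  fix K' L' M' N' x'
  assume "K' \<in> lines H" "L' \<in> lines H" "M' \<in> lines H" "N' \<in> lines H"
  then obtain K L M N where e: "K' = f ` K" "L' = f ` L" "M' = f ` M" "N' = f ` N"
    and l: "K \<in> lines G" "L \<in> lines G" "M \<in> lines G" "N \<in> lines G"
    by (auto simp: lines_eq)
  have Int: "f ` S \<inter> f ` T = f ` (S \<inter> T)" if "S \<in> lines G" "T \<in> lines G" for S T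
    using inj_on_image_Int[OF inj line_sub[OF that(1)] line_sub[OF that(2)]] by simp
  assume *: "K' \<noteq> L' \<and> x' \<in> K' \<inter> L' \<and> x' \<notin> M' \<and> x' \<notin> N' \<and>
        M' \<inter> K' \<noteq> {} \<and> M' \<inter> L' \<noteq> {} \<and> N' \<inter> K' \<noteq> {} \<and> N' \<inter> L' \<noteq> {}"
  then have KL: "K \<noteq> L" and i: "M \<inter> K \<noteq> {}" "M \<inter> L \<noteq> {}" "N \<inter> K \<noteq> {}" "N \<inter> L \<noteq> {}" "x' \<in> f ` (K \<inter> L)"
    unfolding e using Int l by auto
  from i(5) obtain x where x: "x' = f x" "x \<in> K" "x \<in> L" by auto
  from i(1-4) obtain a b c d where i: "a \<in> M" "a \<in> K" "b \<in> M" "b \<in> L"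
    "c \<in> N" "c \<in> K" "d \<in> N" "d \<in> L" by auto
  have xn: "x \<notin> M" "x \<notin> N" using * unfolding e x by auto
  obtain y where "y \<in> M" "y \<in> N" using veblen[OF l KL x(2,3) xn i] .
  then show "M' \<inter> N' \<noteq> {}" unfolding e by auto
qed

lemma projective_dim_image:
  assumes P: "projective_space_of_dim G n"
  shows "projective_space_of_dim H n"
proof -
  have G: "projective_space G" using P by (simp add: projective_space_of_dim_def)
  have plg: "point_line_geometry G" using G by (simp add: projective_space_def)
  obtain A where A: "A \<subseteq> points G" "finite A" "card A = n + 1" "subspace_span G A = points G"
    using P unfolding projective_space_of_dim_def by auto
  have card: "card (f ` B) = card B" if "B \<subseteq> points G" for B
    using card_image inj inj_on_subset that by metis
  have min: "n + 1 \<le> card B" if "B \<subseteq> points G" "finite B" "subspace_span G B = points G" for B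
    using P that unfolding projective_space_of_dim_def by simp
  show ?thesis unfolding projective_space_of_dim_def
  proof (intro conjI allI impI)
    show "projective_space H" using G by (rule projective_image)
    show "\<exists>A\<subseteq>points H. finite A \<and> card A = n + 1 \<and> subspace_span H A = points H"
      using A card[of A] span_image[OF plg A(1)] by (intro exI[of _ "f ` A"]) (auto simp: points_eq)
    fix B' assume B': "B' \<subseteq> points H" "finite B' \<and> subspace_span H B' = points H"
    then obtain B where B: "B \<subseteq> points G" "B' = f ` B" using setE by metis
    then have "finite B" using B' inj by (metis finite_imageD inj_on_subset)
    then show "n + 1 \<le> card B'" using min[OF B(1)] B B' span_image[OF plg B(1)] card by simp
  qed
qed

section \<open>Polar spaces under isomorphisms\<close>

lemma polar_image:
  assumes P: "polar_space G"
  shows "polar_space H"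
  unfolding polar_space_def
proof (intro conjI)
  have plg: "point_line_geometry G" using P by (rule polar_space_plg)
  show "point_line_geometry H" using plg by (rule plg_image)
  show "thick_lines H" using P by (intro thick_image) (simp add: polar_space_def)
  have "\<not> (\<exists>x\<in>points G. \<forall>y\<in>points G. y \<noteq> x \<longrightarrow> collin G x y)"
    using P unfolding polar_space_def by (elim conjE)
  then show "\<not> (\<exists>x\<in>points H. \<forall>y\<in>points H. y \<noteq> x \<longrightarrow> collin H x y)"
    unfolding points_eq using collin_iff f_eq by auto
  have fin: "\<forall>C. (\<forall>S\<in>C. singular_subspace G S) \<and> chain_subset C \<longrightarrow> finite C"
    using P unfolding polar_space_def by (elim conjE)
  show "\<forall>C. (\<forall>S\<in>C. singular_subspace H S) \<and> chain_subset C \<longrightarrow> finite C"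
  proof (intro allI impI, elim conjE)
    fix C assume C: "\<forall>S\<in>C. singular_subspace H S" "chain_subset C"
    \<comment> \<open>Each member of \<open>C\<close> is the image of a member of \<open>D\<close>,
      so it is enough that the chain of preimages is finite.\<close>
    define D where "D = {S. S \<subseteq> points G \<and> f ` S \<in> C}"
    have "\<forall>S\<in>D. singular_subspace G S" using C(1) singular_image unfolding D_def by auto
    moreover have "chain_subset D"
      unfolding chain_subset_def
    proof (intro ballI)
      fix A B assume "A \<in> D" "B \<in> D"
      then have AB: "A \<subseteq> points G" "B \<subseteq> points G" "f ` A \<in> C" "f ` B \<in> C" by (auto simp: D_def)
      then have "f ` A \<subseteq> f ` B \<or> f ` B \<subseteq> f ` A" using C(2) by (simp add: chain_subset_def)
      then show "A \<subseteq> B \<or> B \<subseteq> A" unfolding f_sub[OF AB(1,2)] f_sub[OF AB(2,1)] .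
    qed
    ultimately have "finite D" using fin by simp
    moreover have "C \<subseteq> (`) f ` D"
    proof
      fix T assume T: "T \<in> C"
      then have "T \<subseteq> points H" using C(1) singular_subspace_points by blast
      then obtain S where "S \<subseteq> points G" "T = f ` S" by (rule setE)
      then show "T \<in> (`) f ` D" using T by (auto simp: D_def)
    qed
    ultimately show "finite C" using finite_surj by blast
  qed
  have A: "\<forall>x\<in>points G. \<forall>L\<in>lines G. (\<exists>!y. y \<in> L \<and> y \<in> perp G x) \<or> L \<subseteq> perp G x"
    using P unfolding polar_space_def by (elim conjE)
  show "\<forall>x\<in>points H. \<forall>L\<in>lines H. (\<exists>!y. y \<in> L \<and> y \<in> perp H x) \<or> L \<subseteq> perp H x"
  proof (intro ballI)
    fix x' L' assume "x' \<in> points H" "L' \<in> lines H"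
    then obtain x L where xL: "x' = f x" "L' = f ` L" "x \<in> points G" "L \<in> lines G"
      by (auto simp: points_eq lines_eq)
    have perp: "perp H x' = f ` perp G x" "perp G x \<subseteq> points G"
      using perp_image xL by (auto simp: perp_def)
    have L: "L \<subseteq> points G" using line_sub xL by simp
    consider y where "y \<in> L" "y \<in> perp G x" "\<And>z. z \<in> L \<Longrightarrow> z \<in> perp G x \<Longrightarrow> z = y" | "L \<subseteq> perp G x"
      using A xL(3,4) by metis
    then show "(\<exists>!y. y \<in> L' \<and> y \<in> perp H x') \<or> L' \<subseteq> perp H x'"
    proof cases
      case 1
      have "\<exists>!y. y \<in> L' \<and> y \<in> perp H x'"
      proof (rule ex1I[of _ "f y"])
        show "f y \<in> L' \<and> f y \<in> perp H x'" using 1(1,2) unfolding xL(2) perp(1) by simp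
        fix z' assume z': "z' \<in> L' \<and> z' \<in> perp H x'"
        then obtain z where z: "z' = f z" "z \<in> L" unfolding xL by blast
        have "f z \<in> f ` perp G x" using z' z perp(1) by simp
        then have "z \<in> perp G x" using f_mem[OF _ perp(2)] z(2) L by blast
        then show "z' = f y" using 1(3) z by metis
      qed
      then show ?thesis ..
    next
      case 2
      then show ?thesis using xL perp by (simp add: image_mono)
    qed
  qed
qed

lemma polar_rank_image:
  assumes "polar_rank_at_least G d"
  shows "polar_rank_at_least H d"
proof -
  obtain r where r: "d \<le> r" "polar_space G" "2 \<le> r"
    "\<And>M. maximal_singular_subspace G M \<Longrightarrow> projective_space_of_dim (induced G M) (r - 1)"
    using assms unfolding polar_rank_at_least_def has_polar_rank_def by auto
  have "projective_space_of_dim (induced H M) (r - 1)" if M: "maximal_singular_subspace H M" for M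
  proof -
    have "M \<subseteq> points H" using M singular_subspace_points unfolding maximal_singular_subspace_def by blast
    then obtain S where S: "S \<subseteq> points G" "M = f ` S" by (rule setE)
    then interpret S: geo_iso f "induced G S" "induced H M" using iso_induced by simp
    show ?thesis using r(4) maximal_singular_image S M by (intro S.projective_dim_image) simp
  qed
  then show ?thesis unfolding polar_rank_at_least_def has_polar_rank_def
    using r polar_image by auto
qed

section \<open>Distance, convexity and parapolar spaces under isomorphisms\<close>

lemma coll_path_image:
  assumes "set ps \<subseteq> points G"
  shows "coll_path H (f x) (f y) (map f ps) \<longleftrightarrow> ps \<noteq> [] \<and> f (hd ps) = f x \<and> f (last ps) = f y \<and> successively (collin G) ps"
proof -
  have "successively (\<lambda>x y. collin H (f x) (f y)) ps \<longleftrightarrow> successively (collin G) ps"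
  proof (rule successively_cong)
    fix x y assume "x \<in> set ps" "y \<in> set ps"
    then show "collin H (f x) (f y) \<longleftrightarrow> collin G x y" using assms by (intro collin_iff) auto
  qed simp
  moreover have "set (map f ps) \<subseteq> points H" using assms by (auto simp: points_eq)
  ultimately show ?thesis
    unfolding coll_path_def successively_map by (cases "ps = []") (simp_all add: hd_map last_map)
qed

lemma coll_path_iff:
  assumes "x \<in> points G" "y \<in> points G" "set ps \<subseteq> points G"
  shows "coll_path H (f x) (f y) (map f ps) \<longleftrightarrow> coll_path G x y ps"
proof (cases "ps = []")
  case False
  then have "hd ps \<in> points G" "last ps \<in> points G" using assms(3) by auto
  then show ?thesis using assms f_eq unfolding coll_path_image[OF assms(3)] by (auto simp: coll_path_def)
qed (simp add: coll_path_def)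

lemma pathE:
  assumes "coll_path H u v qs"
  obtains ps where "set ps \<subseteq> points G" "qs = map f ps"
proof -
  have "set qs \<subseteq> f ` points G" using assms by (simp add: coll_path_def points_eq)
  then have "map f (map (inv_into (points G) f) qs) = qs"
    unfolding map_map by (intro map_idI) (auto simp: f_inv_into_f)
  moreover have "set (map (inv_into (points G) f) qs) \<subseteq> points G"
    using \<open>set qs \<subseteq> f ` points G\<close> by (auto intro: inv_into_into)
  ultimately show ?thesis using that by metis
qed

lemma gdist_image:
  assumes "x \<in> points G" "y \<in> points G"
  shows "gdist H (f x) (f y) = gdist G x y"
proof -
  have "{enat (length ps - 1) | ps. coll_path H (f x) (f y) ps} = {enat (length ps - 1) | ps. coll_path G x y ps}"
    (is "?A = ?B")
  proof
    show "?A \<subseteq> ?B"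
    proof
      fix e assume "e \<in> ?A"
      then obtain qs where qs: "e = enat (length qs - 1)" "coll_path H (f x) (f y) qs" by auto
      then obtain ps where ps: "set ps \<subseteq> points G" "qs = map f ps" using pathE by metis
      then have "coll_path G x y ps" using qs coll_path_iff[OF assms] by simp
      then show "e \<in> ?B" using qs ps by auto
    qed
    show "?B \<subseteq> ?A"
    proof
      fix e assume "e \<in> ?B"
      then obtain ps where ps: "e = enat (length ps - 1)" "coll_path G x y ps" by auto
      then have "set ps \<subseteq> points G" by (simp add: coll_path_def)
      then have "coll_path H (f x) (f y) (map f ps)" using coll_path_iff[OF assms] ps(2) by blast
      moreover have "e = enat (length (map f ps) - 1)" using ps by simp
      ultimately show "e \<in> ?A" by blast
    qed
  qed
  then show ?thesis by (simp add: gdist_def)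
qed

lemma connected_image:
  assumes "connected_geometry G"
  shows "connected_geometry H"
  using assms gdist_image unfolding connected_geometry_def points_eq by simp

lemma convex_image:
  assumes "S \<subseteq> points G"
  shows "convex_subspace H (f ` S) \<longleftrightarrow> convex_subspace G S"
proof -
  have sp: "shortest_path H (f x) (f y) (map f ps) \<longleftrightarrow> shortest_path G x y ps"
    if "x \<in> S" "y \<in> S" "set ps \<subseteq> points G" for x y ps
  proof -
    have "x \<in> points G" "y \<in> points G" using that assms by auto
    then show ?thesis using that coll_path_iff[of x y ps] gdist_image[of x y] by (simp add: shortest_path_def)
  qed
  show ?thesis
  proof
    assume C: "convex_subspace H (f ` S)"
    have "set ps \<subseteq> S" if "x \<in> S" "y \<in> S" "shortest_path G x y ps" for x y ps
    proof -
      have ps: "set ps \<subseteq> points G" using that by (simp add: shortest_path_def coll_path_def)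
      then have "shortest_path H (f x) (f y) (map f ps)" using sp that by simp
      then have "set (map f ps) \<subseteq> f ` S" using C that unfolding convex_subspace_def by blast
      then show ?thesis using f_sub[OF ps assms] by simp
    qed
    then show "convex_subspace G S" using C subspace_image[OF assms] unfolding convex_subspace_def by blast
  next
    assume C: "convex_subspace G S"
    have "set qs \<subseteq> f ` S" if xy: "x \<in> S" "y \<in> S" "shortest_path H (f x) (f y) qs" for x y qs
    proof -
      obtain ps where ps: "set ps \<subseteq> points G" "qs = map f ps"
        using xy(3) pathE unfolding shortest_path_def by metis
      then have "shortest_path G x y ps" using sp xy by simp
      then have "set ps \<subseteq> S" using C xy unfolding convex_subspace_def by blast
      then show ?thesis using ps by auto
    qed
    then show "convex_subspace H (f ` S)" using C subspace_image[OF assms] unfolding convex_subspace_def by blast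
  qed
qed

lemma convex_closure_image:
  assumes plg: "point_line_geometry G" and A: "A \<subseteq> points G"
  shows "convex_closure H (f ` A) = f ` convex_closure G A"
proof
  have c: "convex_subspace G (convex_closure G A)" using convex_closure_convex[OF plg A] .
  then have "convex_closure G A \<subseteq> points G" by (simp add: convex_subspace_def subspace_def)
  then have "convex_subspace H (f ` convex_closure G A)" using c convex_image by simp
  then show "convex_closure H (f ` A) \<subseteq> f ` convex_closure G A"
    using convex_closure_superset[of A G] by (intro convex_closure_least) auto
  have fA: "f ` A \<subseteq> points H" using A by (auto simp: points_eq)
  then have d: "convex_subspace H (convex_closure H (f ` A))" using convex_closure_convex[OF plg_image[OF plg]] by simp
  then have "convex_closure H (f ` A) \<subseteq> points H" by (simp add: convex_subspace_def subspace_def)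
  then obtain S where S: "S \<subseteq> points G" "convex_closure H (f ` A) = f ` S" by (rule setE)
  then have "A \<subseteq> S" using f_sub[OF A S(1)] convex_closure_superset[of "f ` A" H] by simp
  then have "convex_closure G A \<subseteq> S" using d S convex_image by (intro convex_closure_least) auto
  then show "f ` convex_closure G A \<subseteq> convex_closure H (f ` A)" using S by auto
qed

lemma perp_Int_image:
  assumes "x \<in> points G" "y \<in> points G"
  shows "perp H (f x) \<inter> perp H (f y) = f ` (perp G x \<inter> perp G y)"
  unfolding perp_image[OF assms(1)] perp_image[OF assms(2)]
  using inj by (intro inj_on_image_Int[symmetric]) (auto simp: perp_def)

lemma polar_closure_image:
  assumes plg: "point_line_geometry G" and xy: "x \<in> points G" "y \<in> points G"
    and P: "polar_space (induced G (convex_closure G {x, y}))"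
  shows "polar_space (induced H (convex_closure H {f x, f y}))"
proof -
  have e: "convex_closure H {f x, f y} = f ` convex_closure G {x, y}"
    using convex_closure_image[OF plg, of "{x, y}"] xy by simp
  have "convex_closure G {x, y} \<subseteq> points G"
    using convex_closure_convex[OF plg, of "{x, y}"] xy by (simp add: convex_subspace_def subspace_def)
  then interpret C: geo_iso f "induced G (convex_closure G {x, y})" "induced H (f ` convex_closure G {x, y})"
    by (rule iso_induced)
  show ?thesis unfolding e using P by (rule C.polar_image)
qed

lemma symp_image:
  assumes plg: "point_line_geometry G" and S: "symp G S"
  shows "symp H (f ` S)"
proof -
  obtain p q where pq: "p \<in> points G" "q \<in> points G" "p \<noteq> q" "\<not> collin G p q" "perp G p \<inter> perp G q \<noteq> {}"
    "S = convex_closure G {p, q}" "polar_space (induced G S)"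
    using S unfolding symp_def by auto
  have "f ` S = convex_closure H {f p, f q}"
    using convex_closure_image[OF plg, of "{p, q}"] pq by simp
  moreover have "polar_space (induced H (convex_closure H {f p, f q}))"
    using polar_closure_image[OF plg pq(1,2)] pq by simp
  ultimately show ?thesis unfolding symp_def using pq f_points f_eq collin_iff perp_Int_image
    by (intro bexI[of _ "f p"] bexI[of _ "f q"]) auto
qed

text \<open>Applied to the isomorphism from \<open>G\<close> onto its buttoning, this gives
  parapolarity of the buttoned geometry with no direct check of its axioms.\<close>

lemma parapolar_image:
  assumes P: "parapolar_space G"
  shows "parapolar_space H"
  unfolding parapolar_space_def
proof (intro conjI)
  note Pd = P[unfolded parapolar_space_def]
  have plg: "point_line_geometry G" using Pd by (elim conjE)
  then show "point_line_geometry H" by (rule plg_image)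
  have "connected_geometry G" using Pd by (elim conjE)
  then show "connected_geometry H" by (rule connected_image)
  have 3: "\<forall>L\<in>lines G. \<forall>p\<in>points G - L.
        (\<forall>x\<in>L. \<not> collin G p x) \<or> (\<exists>!x. x \<in> L \<and> collin G p x) \<or> (\<forall>x\<in>L. collin G p x)"
    using Pd by (elim conjE)
  show "\<forall>L\<in>lines H. \<forall>p\<in>points H - L.
        (\<forall>x\<in>L. \<not> collin H p x) \<or> (\<exists>!x. x \<in> L \<and> collin H p x) \<or> (\<forall>x\<in>L. collin H p x)"
  proof (intro ballI)
    fix L' p' assume "L' \<in> lines H" "p' \<in> points H - L'"
    then obtain L p where L: "L' = f ` L" "p' = f p" "L \<in> lines G" "p \<in> points G - L"
      by (auto simp: lines_eq points_eq)
    have col: "collin H p' (f x) \<longleftrightarrow> collin G p x" if "x \<in> L" for x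
      using collin_iff[of p x] L line_sub[OF L(3)] that by auto
    have "(\<forall>x\<in>L. \<not> collin G p x) \<or> (\<exists>!x. x \<in> L \<and> collin G p x) \<or> (\<forall>x\<in>L. collin G p x)"
      using 3[THEN bspec, OF L(3), THEN bspec, OF L(4)] .
    then consider "\<forall>x\<in>L. \<not> collin G p x" | x where "x \<in> L" "collin G p x" "\<And>y. y \<in> L \<Longrightarrow> collin G p y \<Longrightarrow> y = x"
      | "\<forall>x\<in>L. collin G p x"
      by (elim disjE ex1E) blast+
    then show "(\<forall>x\<in>L'. \<not> collin H p' x) \<or> (\<exists>!x. x \<in> L' \<and> collin H p' x) \<or> (\<forall>x\<in>L'. collin H p' x)"
    proof cases
      case 1 then show ?thesis using col L by simp
    next
      case 2
      have "\<exists>!x. x \<in> L' \<and> collin H p' x"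
      proof (rule ex1I[of _ "f x"])
        show "f x \<in> L' \<and> collin H p' (f x)" using 2(1,2) col L(1) by simp
        fix y' assume "y' \<in> L' \<and> collin H p' y'"
        then obtain y where "y' = f y" "y \<in> L" "collin H p' (f y)" using L(1) by blast
        then show "y' = f x" using 2(3) col by metis
      qed
      then show ?thesis by simp
    next
      case 3 then show ?thesis using col L by simp
    qed
  qed
  have "\<exists>p\<in>points G. \<exists>L\<in>lines G. \<forall>x\<in>L. x \<notin> perp G p" using Pd by (elim conjE)
  then obtain p L where pL: "p \<in> points G" "L \<in> lines G" "\<forall>x\<in>L. x \<notin> perp G p" by auto
  have "f x \<notin> f ` perp G p" if "x \<in> L" for x
  proof -
    have "x \<in> points G" "perp G p \<subseteq> points G" using that line_sub[OF pL(2)] by (auto simp: perp_def)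
    then show ?thesis using f_mem pL(3) that by metis
  qed
  then have "\<forall>x\<in>f ` L. x \<notin> perp H (f p)" using perp_image[OF pL(1)] by simp
  then show "\<exists>p\<in>points H. \<exists>L\<in>lines H. \<forall>x\<in>L. x \<notin> perp H p"
    using pL f_points lines_eq by (intro bexI[of _ "f p"] bexI[of _ "f ` L"]) auto
  have 5: "\<forall>p\<in>points G. \<forall>q\<in>points G.
        p \<noteq> q \<and> \<not> collin G p q \<and> perp G p \<inter> perp G q \<noteq> {} \<longrightarrow>
        polar_space (induced G (convex_closure G {p, q})) \<or>
        (\<exists>x. perp G p \<inter> perp G q = {x})" using Pd by (elim conjE)
  show "\<forall>p\<in>points H. \<forall>q\<in>points H.
        p \<noteq> q \<and> \<not> collin H p q \<and> perp H p \<inter> perp H q \<noteq> {} \<longrightarrow>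
        polar_space (induced H (convex_closure H {p, q})) \<or>
        (\<exists>x. perp H p \<inter> perp H q = {x})"
  proof (intro ballI impI)
    fix p' q' assume "p' \<in> points H" "q' \<in> points H"
    then obtain p q where pq: "p' = f p" "q' = f q" "p \<in> points G" "q \<in> points G" by (auto simp: points_eq)
    note I = perp_Int_image[OF pq(3,4)]
    assume "p' \<noteq> q' \<and> \<not> collin H p' q' \<and> perp H p' \<inter> perp H q' \<noteq> {}"
    then have "p \<noteq> q \<and> \<not> collin G p q \<and> perp G p \<inter> perp G q \<noteq> {}"
      using I collin_iff pq by auto
    then consider "polar_space (induced G (convex_closure G {p, q}))" | x where "perp G p \<inter> perp G q = {x}"
      using 5[THEN bspec, OF pq(3), THEN bspec, OF pq(4)] by (elim disjE exE impE) auto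
    then show "polar_space (induced H (convex_closure H {p', q'})) \<or> (\<exists>x. perp H p' \<inter> perp H q' = {x})"
    proof cases
      case 1
      then show ?thesis using polar_closure_image[OF plg] pq by simp
    next
      case 2
      then have "perp H p' \<inter> perp H q' = {f x}" using I pq by simp
      then show ?thesis by blast
    qed
  qed
  have 6: "\<forall>L\<in>lines G. \<exists>S. symp G S \<and> L \<subseteq> S" using Pd by (elim conjE)
  show "\<forall>L\<in>lines H. \<exists>S. symp H S \<and> L \<subseteq> S"
  proof
    fix L' assume "L' \<in> lines H"
    then obtain L where L: "L \<in> lines G" "L' = f ` L" by (auto simp: lines_eq)
    then obtain S where "symp G S" "L \<subseteq> S" using 6 by auto
    then show "\<exists>S. symp H S \<and> L' \<subseteq> S" using symp_image[OF plg] L by (metis image_mono)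
  qed
qed

lemma singular_plane_image:
  assumes "P \<subseteq> points G" "singular_plane G P"
  shows "singular_plane H (f ` P)"
proof -
  interpret P: geo_iso f "induced G P" "induced H (f ` P)" using iso_induced[OF assms(1)] .
  show ?thesis using assms P.projective_dim_image singular_image by (auto simp: singular_plane_def)
qed

end

subsection \<open>Connected components and local connectedness\<close>

lemma component_eq:
  assumes "C \<in> components G" "x \<in> C"
  shows "C = (adj G)\<^sup>* `` {x}"
proof -
  obtain c where c: "C = (adj G)\<^sup>* `` {c}" using assms(1) unfolding components_adj by auto
  then have cx: "(c, x) \<in> (adj G)\<^sup>*" using assms(2) by auto
  then have xc: "(x, c) \<in> (adj G)\<^sup>*" using sym_adj_rtrancl by (meson symD)
  show ?thesis unfolding c using cx xc rtrancl_trans by fast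
qed

lemma component_points: "C \<in> components G \<Longrightarrow> C \<subseteq> points G"
  unfolding components_def by auto

lemma ex_component:
  assumes "x \<in> points G"
  obtains C where "C \<in> components G" "x \<in> C"
  using assms unfolding components_adj by auto

lemma component_nonempty:
  assumes "C \<in> components G"
  obtains x where "x \<in> C"
  using assms unfolding components_adj by auto

lemma components_disjoint: "C \<in> components G \<Longrightarrow> D \<in> components G \<Longrightarrow> x \<in> C \<Longrightarrow> x \<in> D \<Longrightarrow> C = D"
  using component_eq[of C G x] component_eq[of D G x] by simp

lemma component_closed:
  assumes "point_line_geometry G" "C \<in> components G" "x \<in> C" "collin G x y"
  shows "y \<in> C"
proof -
  have "(x, y) \<in> adj G" using assms(4) collin_points[OF assms(1,4)] by (simp add: adj_def)
  then show ?thesis unfolding component_eq[OF assms(2,3)] by auto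
qed

lemma component_line:
  assumes "point_line_geometry G" "C \<in> components G" "x \<in> C" "L \<in> lines G" "x \<in> L"
  shows "L \<subseteq> C"
proof
  fix y assume "y \<in> L"
  then show "y \<in> C" using component_closed[OF assms(1-3), of y] assms(3-5) by (cases "y = x") (auto intro: collinI)
qed

lemma component_subspace:
  assumes "point_line_geometry G" "C \<in> components G"
  shows "subspace G C"
  unfolding subspace_def using component_points[OF assms(2)] component_line[OF assms] by simp

lemma component_plg:
  assumes plg: "point_line_geometry G" and C: "C \<in> components G"
  shows "point_line_geometry (induced G C)"
proof -
  have "\<exists>L\<in>lines (induced G C). x \<in> L" if x: "x \<in> C" for x
  proof -
    have "x \<in> \<Union>(lines G)" using plg x component_points[OF C] unfolding point_line_geometry_def by auto
    then obtain L where L: "L \<in> lines G" "x \<in> L" by auto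
    then show ?thesis using component_line[OF plg C x L] by auto
  qed
  then have "\<Union> (lines (induced G C)) = C" by auto
  moreover have "\<exists>x\<in>L. \<exists>y\<in>L. x \<noteq> y" if "L \<in> lines G" for L
    using plg that by (simp add: point_line_geometry_def)
  ultimately show ?thesis by (simp add: point_line_geometry_def)
qed

lemma component_connected:
  assumes plg: "point_line_geometry G" and C: "C \<in> components G"
  shows "connected_geometry (induced G C)"
  unfolding connected_geometry_adj
proof (intro ballI)
  fix x y assume xy: "x \<in> points (induced G C)" "y \<in> points (induced G C)"
  then have "(x, y) \<in> (adj G)\<^sup>*" using component_eq[OF C, of x] by auto
  then have "y \<in> C \<and> (x, y) \<in> (adj (induced G C))\<^sup>*"
  proof (induction rule: rtrancl_induct)
    case base then show ?case using xy by simp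
  next
    case (step y z)
    then have yz: "collin G y z" by (simp add: adj_def)
    have z: "z \<in> C" using component_closed[OF plg C _ yz] step by auto
    from yz have "(y, z) \<in> adj (induced G C)"
      using step z collin_induced[OF component_subspace[OF plg C], of y z] by (simp add: adj_def)
    then show ?case using step z by auto
  qed
  then show "(x, y) \<in> (adj (induced G C))\<^sup>*" by simp
qed

text \<open>A chain of coplanar lines is turned into a chain of planes. A plane equal to the
  previous one is not appended, as it would not meet it in a line; two different ones share a line
  of the chain and nothing more by \<open>singular_plane_inter\<close>.\<close>

lemma locally_connectedI:
  assumes conn: "\<And>p L M. \<lbrakk>L \<in> lines G; M \<in> lines G; p \<in> L; p \<in> M\<rbrakk> \<Longrightarrow> (L, M) \<in> (coplanar G p)\<^sup>*"
  shows "locally_connected G"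
  unfolding locally_connected_def
proof (intro ballI impI, elim conjE)
  fix p L M assume *: "L \<in> lines G" "M \<in> lines G" "p \<in> L" "p \<in> M" "L \<noteq> M"
  then have "(L, M) \<in> (coplanar G p)\<^sup>+" using conn[OF *(1-4)] by (metis rtranclD)
  then show "\<exists>Ps. Ps \<noteq> [] \<and> (\<forall>P\<in>set Ps. singular_plane G P) \<and> L \<subseteq> hd Ps \<and> M \<subseteq> last Ps \<and>
           successively (\<lambda>P Q. P \<inter> Q \<in> lines G \<and> p \<in> P \<inter> Q) Ps"
  proof (induction rule: trancl_induct)
    case (base M)
    then obtain P where "singular_plane G P" "L \<subseteq> P" "M \<subseteq> P" unfolding coplanar_def by auto
    then show ?case by (intro exI[of _ "[P]"]) simp
  next
    case (step M N)
    then obtain P where P: "singular_plane G P" "M \<subseteq> P" "N \<subseteq> P" and M: "M \<in> lines G" "p \<in> M"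
      unfolding coplanar_def by auto
    obtain Ps where Ps: "Ps \<noteq> []" "\<forall>P\<in>set Ps. singular_plane G P" "L \<subseteq> hd Ps" "M \<subseteq> last Ps"
      "successively (\<lambda>P Q. P \<inter> Q \<in> lines G \<and> p \<in> P \<inter> Q) Ps" using step.IH by auto
    show ?case
    proof (cases "P = last Ps")
      case True then show ?thesis using Ps P by (intro exI[of _ Ps]) simp
    next
      case False
      have "singular_plane G (last Ps)" using Ps(1,2) by simp
      then have "last Ps \<inter> P = M" using singular_plane_inter[OF _ P(1) _ M(1) Ps(4) P(2)] False by metis
      moreover have "p \<in> last Ps" "p \<in> P" using M P Ps by auto
      ultimately show ?thesis using Ps P M by (intro exI[of _ "Ps @ [P]"]) (simp add: successively_append_iff)
    qed
  qed
qed

subsection \<open>Parapolar spaces of symplectic rank at least three\<close>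

locale parapolar_rank3 =
  fixes G :: "'a geometry"
  assumes para: "parapolar_space G" and rank: "symplectic_rank_at_least G 3"
begin

lemma plg: "point_line_geometry G"
  using para unfolding parapolar_space_def by (elim conjE)

lemma connected: "connected_geometry G"
  using para unfolding parapolar_space_def by (elim conjE)

lemma line_sub: "L \<in> lines G \<Longrightarrow> L \<subseteq> points G"
  by (rule line_subset_points[OF plg])

lemma line_in_symp:
  assumes "L \<in> lines G"
  obtains S where "symp G S" "L \<subseteq> S"
proof -
  have "\<forall>L\<in>lines G. \<exists>S. symp G S \<and> L \<subseteq> S" using para unfolding parapolar_space_def by (elim conjE)
  then show ?thesis using assms that by auto
qed

lemma none_one_or_all:
  assumes "L \<in> lines G" "p \<in> points G - L" "x \<in> L" "y \<in> L" "x \<noteq> y" "collin G p x" "collin G p y" "z \<in> L"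
  shows "collin G p z"
proof -
  have "\<forall>L\<in>lines G. \<forall>p\<in>points G - L.
        (\<forall>x\<in>L. \<not> collin G p x) \<or> (\<exists>!x. x \<in> L \<and> collin G p x) \<or> (\<forall>x\<in>L. collin G p x)"
    using para unfolding parapolar_space_def by (elim conjE)
  from this[THEN bspec, OF assms(1), THEN bspec, OF assms(2)] show ?thesis
    using assms(3-8) by metis
qed

lemma symp_convex:
  assumes "symp G S"
  shows "convex_subspace G S"
proof -
  obtain p q where "p \<in> points G" "q \<in> points G" "S = convex_closure G {p, q}"
    using assms unfolding symp_def by auto
  then show ?thesis using convex_closure_convex[OF plg, of "{p, q}"] by simp
qed

lemma symp_subspace: "symp G S \<Longrightarrow> subspace G S"
  using symp_convex by (simp add: convex_subspace_def)

lemma symp_points: "symp G S \<Longrightarrow> S \<subseteq> points G"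
  using symp_subspace by (simp add: subspace_def)

lemma symp_polar: "symp G S \<Longrightarrow> polar_rank3 (induced G S)"
  using rank by (simp add: symplectic_rank_at_least_def polar_rank3_def)

lemma symp_mid:
  assumes "symp G S" "x \<in> S" "y \<in> S" "x \<noteq> y" "\<not> collin G x y" "collin G x z" "collin G z y"
  shows "z \<in> S"
  using convex_subspace_mid[OF plg symp_convex] assms by metis

lemma symp_perp: "symp G S \<Longrightarrow> x \<in> S \<Longrightarrow> perp (induced G S) x = perp G x \<inter> S"
  by (rule perp_induced[OF symp_subspace])

text \<open>A symp around \<open>L\<close> is a subspace with two points of \<open>M\<close>, so it
  contains \<open>M\<close>, and in a polar space two points determine their line.\<close>

lemma line_eq:
  assumes "L \<in> lines G" "M \<in> lines G" "x \<in> L" "y \<in> L" "x \<in> M" "y \<in> M" "x \<noteq> y"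
  shows "L = M"
proof -
  obtain S where S: "symp G S" "L \<subseteq> S" using line_in_symp[OF assms(1)] .
  interpret polar_rank3 "induced G S" using symp_polar[OF S(1)] .
  have "M \<subseteq> S" using subspaceD[OF symp_subspace[OF S(1)], of x y M] assms S(2) by blast
  then show ?thesis using line_eq[of L M x y] assms S(2) by simp
qed

lemma symp_of_two_mids:
  assumes p: "p \<in> points G" and q: "q \<in> points G" and pq: "p \<noteq> q" "\<not> collin G p q"
    and c: "collin G c p" "collin G c q" and d: "collin G d p" "collin G d q" and cd: "c \<noteq> d"
  shows "symp G (convex_closure G {p, q})"
proof -
  have "\<forall>p\<in>points G. \<forall>q\<in>points G.
        p \<noteq> q \<and> \<not> collin G p q \<and> perp G p \<inter> perp G q \<noteq> {} \<longrightarrow>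
        polar_space (induced G (convex_closure G {p, q})) \<or>
        (\<exists>x. perp G p \<inter> perp G q = {x})" using para unfolding parapolar_space_def by (elim conjE)
  note * = this[THEN bspec, OF p, THEN bspec, OF q]
  have cd': "c \<in> perp G p \<inter> perp G q" "d \<in> perp G p \<inter> perp G q"
    using c d collin_points[OF plg] by (auto simp: perp_def collin_sym)
  then have ne: "perp G p \<inter> perp G q \<noteq> {}" by auto
  have "\<not> (\<exists>x. perp G p \<inter> perp G q = {x})" using cd' cd by (metis singletonD)
  then have "polar_space (induced G (convex_closure G {p, q}))" using * pq ne by simp
  then show ?thesis unfolding symp_def using p q pq ne by auto
qed

text \<open>If \<open>m\<close> is not in a symp \<open>S\<close> on \<open>L\<close>, then \<open>m\<^sup>\<bottom> \<inter> S\<close> is a clique by convexity, whereas \<open>L\<^sup>\<bottom> \<inter> S\<close>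
  is not; a point of the latter that is not collinear to \<open>m\<close> defines with \<open>m\<close> the wanted symp.\<close>

lemma triangle_in_symp:
  assumes L: "L \<in> lines G" "p \<in> L" "l \<in> L" and M: "M \<in> lines G" "p \<in> M" "m \<in> M"
    and col: "collin G p l" "collin G p m" "collin G l m"
  obtains S where "symp G S" "L \<subseteq> S" "M \<subseteq> S"
proof -
  obtain S where S: "symp G S" "L \<subseteq> S" using line_in_symp[OF L(1)] .
  have ne: "p \<noteq> l" "p \<noteq> m" "l \<noteq> m" using col by (auto simp: collin_def)
  have pS: "p \<in> S" "l \<in> S" using S L by auto
  have pts: "p \<in> points G" "l \<in> points G" "m \<in> points G" using L M line_sub by auto
  show ?thesis
  proof (cases "m \<in> S")
    case True
    then have "M \<subseteq> S" using subspaceD[OF symp_subspace[OF S(1)] pS(1) True ne(2) M] by simp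
    then show ?thesis using that S by simp
  next
    case False
    interpret S: polar_rank3 "induced G S" using symp_polar[OF S(1)] .
    obtain a b where ab: "a \<in> S" "b \<in> S" "L \<subseteq> perp (induced G S) a" "L \<subseteq> perp (induced G S) b"
      "b \<notin> perp (induced G S) a"
      using S.line_perp_not_clique[of L] L(1) S(2) by auto
    have ab': "L \<subseteq> perp G a" "L \<subseteq> perp G b" "b \<notin> perp G a"
      using ab symp_perp[OF S(1)] by auto
    have "b \<in> points G" using ab symp_points[OF S(1)] by auto
    then have nab: "a \<noteq> b" "\<not> collin G a b" using ab'(3) by (auto simp: perp_def)
    have "\<not> collin G m a \<or> \<not> collin G m b"
      using symp_mid[OF S(1) ab(1,2) nab, of m] False by (auto simp: collin_sym)
    then obtain y where y: "y \<in> S" "L \<subseteq> perp G y" "\<not> collin G m y" using ab ab' by blast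
    have yp: "y \<in> points G" using y symp_points[OF S(1)] by auto
    have my: "m \<noteq> y" using y False by auto
    have "p \<noteq> y" "l \<noteq> y" using y col by (auto simp: collin_sym)
    then have py: "collin G p y" "collin G l y" using y(2) L by (auto simp: perp_def collin_sym)
    define T where "T = convex_closure G {m, y}"
    have T: "symp G T" unfolding T_def
      using symp_of_two_mids[OF pts(3) yp my y(3) col(2) py(1) col(3) py(2) ne(1)] .
    have mT: "m \<in> T" "y \<in> T" using convex_closure_superset[of "{m, y}" G] by (auto simp: T_def)
    have "p \<in> T" "l \<in> T"
      using symp_mid[OF T mT my y(3)] col py by (auto simp: collin_sym)
    then have "L \<subseteq> T" "M \<subseteq> T"
      using subspaceD[OF symp_subspace[OF T], of p l L] subspaceD[OF symp_subspace[OF T], of p m M] ne mT L M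
      by simp_all
    then show ?thesis using that T by simp
  qed
qed

section \<open>Components of the point-residuals\<close>

text \<open>Naming a component by one of its lines lets every point of the unbuttoning be written as
  \<open>(p, comp p L)\<close> with \<open>L\<close> through \<open>p\<close>.\<close>

definition comp :: "'a \<Rightarrow> 'a set \<Rightarrow> 'a set set" where
  "comp p L = (adj (point_residual G p))\<^sup>* `` {L}"

lemma comp_self: "L \<in> comp p L"
  by (simp add: comp_def)

lemma comp_eq: "M \<in> comp p L \<longleftrightarrow> comp p L = comp p M"
proof
  assume M: "M \<in> comp p L"
  then have "(L, M) \<in> (adj (point_residual G p))\<^sup>*" by (simp add: comp_def)
  moreover from this have "(M, L) \<in> (adj (point_residual G p))\<^sup>*"
    using sym_adj_rtrancl by (meson symD)
  ultimately show "comp p L = comp p M" unfolding comp_def using rtrancl_trans by fast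
qed (simp add: comp_self)

lemma residual_points: "points (point_residual G p) = {L \<in> lines G. p \<in> L}"
  by (simp add: point_residual_def)

lemma residual_components:
  "components (point_residual G p) = {comp p L | L. L \<in> lines G \<and> p \<in> L}"
  unfolding components_adj residual_points comp_def by auto

lemma residual_adj:
  "(L, M) \<in> adj (point_residual G p) \<longleftrightarrow>
    L \<noteq> M \<and> L \<in> lines G \<and> p \<in> L \<and> M \<in> lines G \<and> p \<in> M \<and>
    (\<exists>P S. singular_plane G P \<and> symp G S \<and> P \<subseteq> S \<and> L \<subseteq> P \<and> M \<subseteq> P)" (is "?l \<longleftrightarrow> ?r")
proof
  assume ?l
  then obtain N where N: "N \<in> lines (point_residual G p)" "L \<in> N" "M \<in> N" "L \<noteq> M"
    by (auto simp: adj_def collin_def)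
  then obtain P S where "N = {L \<in> lines G. p \<in> L \<and> L \<subseteq> P}" "singular_plane G P" "symp G S" "P \<subseteq> S"
    unfolding point_residual_def by auto
  then show ?r using N by auto
next
  assume r: ?r
  then obtain P S where "singular_plane G P" "symp G S" "P \<subseteq> S" "L \<subseteq> P" "M \<subseteq> P" by auto
  moreover from this r have "{L \<in> lines G. p \<in> L \<and> L \<subseteq> P} \<in> lines (point_residual G p)"
    unfolding point_residual_def by auto
  ultimately have "collin (point_residual G p) L M" using r by (intro collinI) auto
  then show ?l using r by (simp add: adj_def residual_points)
qed

text \<open>The lines of \<open>S\<close> on \<open>p\<close> are linked by planes of
  \<open>S\<close>. These are planes of \<open>G\<close> inside a symp, which is precisely what a
  line of \<open>point_residual\<close> has to be.\<close>

lemma symp_comp: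
  assumes S: "symp G S" and L: "L \<in> lines G" "p \<in> L" "L \<subseteq> S" and M: "M \<in> lines G" "p \<in> M" "M \<subseteq> S"
  shows "comp p L = comp p M"
proof -
  interpret S: polar_rank3 "induced G S" using symp_polar[OF S(1)] .
  have "coplanar (induced G S) p \<subseteq> (adj (point_residual G p))\<^sup>*"
  proof
    fix z assume z: "z \<in> coplanar (induced G S) p"
    obtain A B where AB: "z = (A, B)" by force
    obtain P where P: "singular_plane (induced G S) P" "A \<subseteq> P" "B \<subseteq> P" and
      l: "A \<in> lines G" "B \<in> lines G" "p \<in> A" "p \<in> B"
      using z unfolding coplanar_def AB by auto
    have PS: "P \<subseteq> S" using singular_plane_subspace[OF P(1)] by (simp add: subspace_def)
    then have "singular_plane G P" using P singular_plane_induced[OF symp_subspace[OF S]] by simp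
    then show "z \<in> (adj (point_residual G p))\<^sup>*" unfolding AB
      using residual_adj[of A B p] P l PS S by (cases "A = B") auto
  qed
  then have "(coplanar (induced G S) p)\<^sup>* \<subseteq> (adj (point_residual G p))\<^sup>*"
    by (metis rtrancl_idemp rtrancl_mono)
  moreover have "(L, M) \<in> (coplanar (induced G S) p)\<^sup>*"
    using S.residue_connected[of L p M] L M by simp
  ultimately have "M \<in> comp p L" by (auto simp: comp_def)
  then show ?thesis by (simp add: comp_eq)
qed

lemma triangle_comp:
  assumes L: "L \<in> lines G" "p \<in> L" "l \<in> L" and M: "M \<in> lines G" "p \<in> M" "m \<in> M"
    and col: "collin G p l" "collin G p m" "collin G l m"
  shows "comp p L = comp p M"
proof -
  obtain S where "symp G S" "L \<subseteq> S" "M \<subseteq> S" using triangle_in_symp[OF assms] .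
  then show ?thesis using symp_comp L M by metis
qed

text \<open>\<open>a\<close> and \<open>b\<close> have the two common neighbours \<open>c\<close>
  and \<open>d\<close>, so they lie in a symp; by convexity it contains \<open>c\<close>, and with
  it both lines. If \<open>c\<close> were the only common neighbour, the lines could belong to
  different components.\<close>

lemma quadrangle_comp:
  assumes L: "L \<in> lines G" "c \<in> L" "a \<in> L" and M: "M \<in> lines G" "c \<in> M" "b \<in> M"
    and ab: "a \<noteq> b" "\<not> collin G a b" and c: "collin G c a" "collin G c b"
    and d: "collin G d a" "collin G d b" "c \<noteq> d"
  shows "comp c L = comp c M"
proof -
  have pts: "a \<in> points G" "b \<in> points G" using L M line_sub by auto
  define S where "S = convex_closure G {a, b}"
  have S: "symp G S" unfolding S_def using symp_of_two_mids[OF pts ab c d] .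
  have aS: "a \<in> S" "b \<in> S" using convex_closure_superset[of "{a, b}" G] by (auto simp: S_def)
  have cS: "c \<in> S" using symp_mid[OF S aS ab, of c] c by (simp add: collin_sym)
  have ne: "c \<noteq> a" "c \<noteq> b" using c by (auto simp: collin_def)
  have "L \<subseteq> S" "M \<subseteq> S"
    using subspaceD[OF symp_subspace[OF S] cS aS(1) ne(1) L] subspaceD[OF symp_subspace[OF S] cS aS(2) ne(2) M] .
  then show ?thesis using symp_comp[OF S L(1,2) _ M(1,2)] by simp
qed

text \<open>Collinear points of a residue are coplanar lines, so lines that no chain of planes
  connects lie in different components. They give two points of the unbuttoning over
  \<open>p\<close>, which makes the equivalence relation non-trivial.\<close>

lemma not_locally_connected:
  assumes "\<not> locally_connected G"
  obtains p L M where "L \<in> lines G" "M \<in> lines G" "p \<in> L" "p \<in> M" "comp p L \<noteq> comp p M"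
proof -
  obtain p L M where *: "L \<in> lines G" "M \<in> lines G" "p \<in> L" "p \<in> M" "(L, M) \<notin> (coplanar G p)\<^sup>*"
    using locally_connectedI assms by metis
  have "adj (point_residual G p) \<subseteq> coplanar G p"
    using residual_adj unfolding coplanar_def by auto
  then have "(adj (point_residual G p))\<^sup>* \<subseteq> (coplanar G p)\<^sup>*" by (rule rtrancl_mono)
  then have "M \<notin> comp p L" using * by (auto simp: comp_def)
  then show ?thesis using that * comp_eq by metis
qed

subsection \<open>The unbuttoning\<close>

abbreviation U :: "('a \<times> 'a set set) geometry" where
  "U \<equiv> unbuttoning G"

abbreviation lift_line :: "'a set \<Rightarrow> ('a \<times> 'a set set) set" where
  "lift_line L \<equiv> (\<lambda>p. (p, comp p L)) ` L"

lemma U_points: "points U = {(p, comp p L) | p L. L \<in> lines G \<and> p \<in> L}"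
  unfolding unbuttoning_def unbuttoning_points_def residual_components using line_sub by auto

text \<open>At each point of \<open>L\<close> exactly one residue component contains
  \<open>L\<close>, so the projection to \<open>G\<close> is injective on every line of the
  unbuttoning.\<close>

lemma unbuttoning_line_eq: "L \<in> lines G \<Longrightarrow> unbuttoning_line G L = lift_line L"
proof
  assume L: "L \<in> lines G"
  show "unbuttoning_line G L \<subseteq> lift_line L"
  proof
    fix x assume "x \<in> unbuttoning_line G L"
    then obtain p M where "x = (p, comp p M)" "p \<in> L" "L \<in> comp p M"
      unfolding unbuttoning_line_def unbuttoning_points_def residual_components by auto
    moreover from this have "comp p M = comp p L" using comp_eq by metis
    ultimately show "x \<in> lift_line L" by auto
  qed
  show "lift_line L \<subseteq> unbuttoning_line G L"
    unfolding unbuttoning_line_def unbuttoning_points_def residual_components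
    using L line_sub comp_self by auto
qed

lemma U_lines: "lines U = {lift_line L | L. L \<in> lines G}"
  unfolding unbuttoning_def using unbuttoning_line_eq by auto

lemma U_pointE:
  assumes "x \<in> points U"
  obtains L where "L \<in> lines G" "fst x \<in> L" "x = (fst x, comp (fst x) L)"
  using assms unfolding U_points by auto

lemma U_pointI: "L \<in> lines G \<Longrightarrow> p \<in> L \<Longrightarrow> (p, comp p L) \<in> points U"
  unfolding U_points by auto

lemma fst_points: "x \<in> points U \<Longrightarrow> fst x \<in> points G"
  using U_pointE line_sub by (metis subsetD)

lemma mem_lift_line: "x \<in> lift_line L \<longleftrightarrow> fst x \<in> L \<and> snd x = comp (fst x) L"
  by (cases x) auto

lemma U_plg: "point_line_geometry U"
  unfolding point_line_geometry_def
proof (intro conjI ballI)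
  fix K assume "K \<in> lines U"
  then obtain L where L: "L \<in> lines G" "K = lift_line L" unfolding U_lines by auto
  show "K \<subseteq> points U" using L U_pointI by auto
  obtain x y where "x \<in> L" "y \<in> L" "x \<noteq> y" using plg L(1) unfolding point_line_geometry_def by metis
  then show "\<exists>x\<in>K. \<exists>y\<in>K. x \<noteq> y" using L by auto
next
  show "\<Union> (lines U) = points U" unfolding U_lines U_points by auto
qed

lemma U_collin:
  "collin U x y \<longleftrightarrow> fst x \<noteq> fst y \<and> (\<exists>L\<in>lines G. x \<in> lift_line L \<and> y \<in> lift_line L)"
proof -
  have "x \<noteq> y \<longleftrightarrow> fst x \<noteq> fst y" if "x \<in> lift_line L" "y \<in> lift_line L" for L
    using that by auto
  then show ?thesis unfolding collin_def U_lines by auto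
qed

lemma U_collinE:
  assumes "collin U x y"
  obtains L where "L \<in> lines G" "fst x \<noteq> fst y" "fst x \<in> L" "fst y \<in> L"
    "snd x = comp (fst x) L" "snd y = comp (fst y) L"
  using assms unfolding U_collin mem_lift_line by auto

lemma U_collinI:
  assumes "L \<in> lines G" "fst x \<noteq> fst y" "fst x \<in> L" "fst y \<in> L"
    "snd x = comp (fst x) L" "snd y = comp (fst y) L"
  shows "collin U x y"
  using assms unfolding U_collin mem_lift_line by auto

lemma U_collin_fst: "collin U x y \<Longrightarrow> collin G (fst x) (fst y)"
  by (elim U_collinE) (rule collinI)

section \<open>Lifting triangles and closing short walks\<close>

text \<open>The triangle in \<open>G\<close> lies in a symp, so at \<open>fst y\<close> the two
  sides belong to one residue component, and likewise at \<open>fst z\<close>. Hence the line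
  joining the projections lifts to a line on \<open>y\<close> and \<open>z\<close>.\<close>

lemma U_triangle:
  assumes xy: "collin U x y" and xz: "collin U x z" and yz: "collin G (fst y) (fst z)"
  shows "collin U y z"
proof -
  obtain L where L: "L \<in> lines G" "fst x \<in> L" "fst y \<in> L" "snd y = comp (fst y) L"
    using xy by (rule U_collinE)
  obtain M where M: "M \<in> lines G" "fst x \<in> M" "fst z \<in> M" "snd z = comp (fst z) M"
    using xz by (rule U_collinE)
  obtain N where N: "N \<in> lines G" "fst y \<in> N" "fst z \<in> N" "fst y \<noteq> fst z"
    using yz unfolding collin_def by auto
  note c = U_collin_fst[OF xy] U_collin_fst[OF xz]
  have "comp (fst y) L = comp (fst y) N"
    using triangle_comp[OF L(1,3,2) N(1-3)] c yz by (simp add: collin_sym)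
  moreover have "comp (fst z) M = comp (fst z) N"
    using triangle_comp[OF M(1,3,2) N(1,3,2)] c yz by (simp add: collin_sym)
  ultimately show ?thesis using U_collinI[OF N(1,4,2,3)] L(4) M(4) by simp
qed

text \<open>The \<open>U_end\<close> lemmas treat a walk from \<open>x\<close> to \<open>y\<close>
  with both ends over the same point; \<open>a\<close> and \<open>b\<close> lie next to the ends,
  and the lines \<open>xa\<close> and \<open>yb\<close> determine the components at the base point.
  Here these lines project to one line.\<close>

lemma U_end_eq:
  assumes xa: "collin U x a" and yb: "collin U y b" and xy: "fst x = fst y" and ab: "fst a = fst b"
  shows "x = y"
proof -
  obtain L where L: "L \<in> lines G" "fst x \<noteq> fst a" "fst x \<in> L" "fst a \<in> L" "snd x = comp (fst x) L"
    using xa by (rule U_collinE)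
  obtain M where M: "M \<in> lines G" "fst y \<in> M" "fst b \<in> M" "snd y = comp (fst y) M"
    using yb by (rule U_collinE)
  have "L = M" using line_eq[OF L(1) M(1)] L M xy ab by metis
  then show ?thesis using L M xy by (simp add: prod_eq_iff)
qed

lemma U_end_triangle:
  assumes xa: "collin U x a" and yb: "collin U y b" and xy: "fst x = fst y"
    and ab: "collin G (fst a) (fst b)"
  shows "x = y"
proof -
  obtain L where L: "L \<in> lines G" "fst x \<in> L" "fst a \<in> L" "snd x = comp (fst x) L"
    using xa by (rule U_collinE)
  obtain M where M: "M \<in> lines G" "fst y \<in> M" "fst b \<in> M" "snd y = comp (fst y) M"
    using yb by (rule U_collinE)
  have "comp (fst x) L = comp (fst x) M"
    using triangle_comp[OF L(1-3) M(1)] M(2,3) U_collin_fst[OF xa] U_collin_fst[OF yb] xy ab by simp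
  then show ?thesis using L M xy by (simp add: prod_eq_iff)
qed

text \<open>If the projections of \<open>a\<close> and \<open>b\<close> are distinct and not
  collinear, the base point and \<open>c\<close> are two different common neighbours of theirs,
  which produces a symp containing both lines.\<close>

lemma U_end_quadrangle:
  assumes xa: "collin U x a" and yb: "collin U y b" and xy: "fst x = fst y"
    and c: "collin G (fst a) c" "collin G c (fst b)" "c \<noteq> fst x"
  shows "x = y"
proof -
  consider "fst a = fst b" | "collin G (fst a) (fst b)" | "fst a \<noteq> fst b" "\<not> collin G (fst a) (fst b)"
    by blast
  then show ?thesis
  proof cases
    case 1 then show ?thesis using U_end_eq[OF xa yb xy] by simp
  next
    case 2 then show ?thesis using U_end_triangle[OF xa yb xy] by simp
  next
    case 3
    obtain L where L: "L \<in> lines G" "fst x \<in> L" "fst a \<in> L" "snd x = comp (fst x) L"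
      using xa by (rule U_collinE)
    obtain M where M: "M \<in> lines G" "fst y \<in> M" "fst b \<in> M" "snd y = comp (fst y) M"
      using yb by (rule U_collinE)
    have "comp (fst x) L = comp (fst x) M"
      using quadrangle_comp[OF L(1-3) M(1) _ M(3) 3, of c] M(2) U_collin_fst[OF xa] U_collin_fst[OF yb] xy c
      by (simp add: collin_sym)
    then show ?thesis using L M xy by (simp add: prod_eq_iff)
  qed
qed

end

section \<open>Lifting symps to the unbuttoning\<close>

context parapolar_rank3
begin

text \<open>All lines of the symp \<open>S\<close> through \<open>p\<close> are in the same component, so the choice is immaterial.\<close>

definition lift :: "'a set \<Rightarrow> 'a \<Rightarrow> 'a \<times> 'a set set" where
  "lift S p = (p, comp p (SOME L. L \<in> lines G \<and> p \<in> L \<and> L \<subseteq> S))"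

lemma fst_lift [simp]: "fst (lift S p) = p"
  by (simp add: lift_def)

lemma lift_eq_iff [simp]: "lift S p = lift S q \<longleftrightarrow> p = q"
  by (metis fst_lift)

lemma lift_eq:
  assumes S: "symp G S" and L: "L \<in> lines G" "p \<in> L" "L \<subseteq> S"
  shows "lift S p = (p, comp p L)"
proof -
  have "(SOME L. L \<in> lines G \<and> p \<in> L \<and> L \<subseteq> S) \<in> lines G \<and> p \<in> (SOME L. L \<in> lines G \<and> p \<in> L \<and> L \<subseteq> S)
    \<and> (SOME L. L \<in> lines G \<and> p \<in> L \<and> L \<subseteq> S) \<subseteq> S"
    by (rule someI[of _ L]) (use L in simp)
  then show ?thesis unfolding lift_def using symp_comp[OF S _ _ _ L] by auto
qed

lemma symp_lineE:
  assumes S: "symp G S" and p: "p \<in> S"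
  obtains L where "L \<in> lines G" "p \<in> L" "L \<subseteq> S"
proof -
  interpret S: polar_rank3 "induced G S" using symp_polar[OF S] .
  have "p \<in> \<Union>(lines (induced G S))" using S.plg p by (simp add: point_line_geometry_def)
  then show ?thesis using that by auto
qed

lemma lift_line_eq: "symp G S \<Longrightarrow> L \<in> lines G \<Longrightarrow> L \<subseteq> S \<Longrightarrow> lift S ` L = lift_line L"
  using lift_eq by (intro image_cong) simp_all

lemma lift_points:
  assumes S: "symp G S" and p: "p \<in> S"
  shows "lift S p \<in> points U"
  using symp_lineE[OF assms] lift_eq[OF S] U_pointI by metis

lemma in_lift:
  assumes S: "symp G S" and L: "L \<in> lines G" "fst x \<in> L" "snd x = comp (fst x) L"
    and q: "q \<in> L" "q \<noteq> fst x" "q \<in> S" "fst x \<in> S"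
  shows "x = lift S (fst x)"
proof -
  have "L \<subseteq> S" using subspaceD[OF symp_subspace[OF S] q(3,4,2) L(1) q(1) L(2)] .
  then show ?thesis using lift_eq[OF S L(1,2)] L(3) by (simp add: prod_eq_iff)
qed

text \<open>\<open>fst\<close> inverts \<open>lift S\<close>: a line of \<open>U\<close> within the
  lift projects to a line inside \<open>S\<close>, and the lift of that line is the given
  one.\<close>

lemma lift_iso:
  assumes S: "symp G S"
  shows "geo_iso (lift S) (induced G S) (induced U (lift S ` S))"
proof
  have "(`) (lift S) ` {L \<in> lines G. L \<subseteq> S} = {K \<in> lines U. K \<subseteq> lift S ` S}" (is "?A = ?B")
  proof
    show "?A \<subseteq> ?B"
    proof
      fix K assume "K \<in> ?A"
      then obtain L where L: "L \<in> lines G" "L \<subseteq> S" "K = lift S ` L" by auto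
      then have "K \<subseteq> lift S ` S" by auto
      moreover have "K \<in> lines U" unfolding L(3) lift_line_eq[OF S L(1,2)] U_lines using L(1) by auto
      ultimately show "K \<in> ?B" by simp
    qed
    show "?B \<subseteq> ?A"
    proof
      fix K assume "K \<in> ?B"
      then obtain L where L: "L \<in> lines G" "K = lift_line L" "K \<subseteq> lift S ` S" unfolding U_lines by auto
      have "fst ` K \<subseteq> fst ` lift S ` S" using L(3) by (rule image_mono)
      then have "L \<subseteq> S" unfolding L(2) image_image by simp
      then have "K = lift S ` L" using L(2) lift_line_eq[OF S L(1)] by simp
      then show "K \<in> ?A" using L(1) \<open>L \<subseteq> S\<close> by blast
    qed
  qed
  then show "geometry_iso (lift S) (induced G S) (induced U (lift S ` S))"
    by (simp add: geometry_iso_def bij_betw_def inj_on_def)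
qed simp

lemma lift_subspace:
  assumes S: "symp G S"
  shows "subspace U (lift S ` S)"
  unfolding subspace_def
proof (intro conjI ballI allI impI)
  show "lift S ` S \<subseteq> points U" using lift_points[OF S] by auto
  fix x y K assume x: "x \<in> lift S ` S" "y \<in> lift S ` S" and "K \<in> lines U" and K: "x \<noteq> y \<and> x \<in> K \<and> y \<in> K"
  then obtain L where L: "L \<in> lines G" "K = lift_line L" unfolding U_lines by auto
  obtain p q where pq: "x = lift S p" "y = lift S q" "p \<in> S" "q \<in> S" using x by auto
  then have "p \<noteq> q" "p \<in> L" "q \<in> L" using K L(2) by (auto simp: lift_def)
  then have "L \<subseteq> S" using subspaceD[OF symp_subspace[OF S] pq(3,4) _ L(1)] by simp
  then show "K \<subseteq> lift S ` S" using L lift_line_eq[OF S L(1)] by (metis image_mono)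
qed

lemma lift_collin:
  assumes S: "symp G S" and pq: "p \<in> S" "q \<in> S"
  shows "collin U (lift S p) (lift S q) \<longleftrightarrow> collin G p q"
proof -
  interpret geo_iso "lift S" "induced G S" "induced U (lift S ` S)" using lift_iso[OF S] .
  show ?thesis using collin_iff[of p q] pq collin_induced[OF symp_subspace[OF S] pq]
      collin_induced[OF lift_subspace[OF S], of "lift S p" "lift S q"] by simp
qed

text \<open>Convexity of \<open>S\<close> puts \<open>fst z\<close> into \<open>S\<close>. The line
  through \<open>p\<close> and \<open>fst z\<close> is then a line of \<open>S\<close>, so the
  component in \<open>z\<close> is the one that \<open>lift S\<close> selects.\<close>

lemma lift_mid:
  assumes S: "symp G S" and pq: "p \<in> S" "q \<in> S" "p \<noteq> q" "\<not> collin G p q"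
    and z: "collin U (lift S p) z" "collin U z (lift S q)"
  shows "z \<in> lift S ` S"
proof -
  have zS: "fst z \<in> S" using symp_mid[OF S pq, of "fst z"] U_collin_fst[OF z(1)] U_collin_fst[OF z(2)] by simp
  obtain L where L: "L \<in> lines G" "p \<noteq> fst z" "p \<in> L" "fst z \<in> L" "snd z = comp (fst z) L"
    using z(1) by (rule U_collinE) simp
  have "z = lift S (fst z)" using in_lift[OF S L(1,4,5,3,2) pq(1) zS] .
  then show ?thesis using zS by auto
qed

lemma symp_diam:
  assumes S: "symp G S" and pq: "p \<in> S" "q \<in> S" "p \<noteq> q" "\<not> collin G p q"
  obtains z where "z \<in> S" "collin G p z" "collin G z q"
proof -
  interpret S: polar_rank3 "induced G S" using symp_polar[OF S] .
  have "q \<notin> perp G p" using pq by (simp add: perp_def)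
  then have "\<exists>z. z \<in> points (induced G S) \<and> collin (induced G S) p z \<and> collin (induced G S) z q"
    using S.common_perp[OF S.plg, of p q] pq symp_perp[OF S pq(1)] by simp
  then show ?thesis using that collin_inducedD by (metis points_induced)
qed

text \<open>For \<open>x\<close> off \<open>K\<close>, the axiom on none, one or all points gives
  collinearity of the projections in \<open>G\<close>, and \<open>U_triangle\<close> with apex
  \<open>y\<close> lifts it.\<close>

lemma U_all:
  assumes x: "x \<in> points U" and K: "K \<in> lines U" and yz: "y \<in> K" "z \<in> K" "y \<noteq> z"
    and xy: "y \<in> perp U x" "z \<in> perp U x"
  shows "K \<subseteq> perp U x"
proof
  fix u assume u: "u \<in> K"
  have up: "u \<in> points U" using line_subset_points[OF U_plg K] u by auto
  have same: "a \<in> perp U b" if "a \<in> K" "b \<in> K" for a b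
    using that line_subset_points[OF U_plg K] collinI[OF K, of b a] by (auto simp: perp_def)
  obtain L where L: "L \<in> lines G" "K = lift_line L" using K unfolding U_lines by auto
  have fL: "fst ` K = L" unfolding L image_image by simp
  have finj: "a = b" if "a \<in> K" "b \<in> K" "fst a = fst b" for a b using that unfolding L by auto
  show "u \<in> perp U x"
  proof (cases "x \<in> K")
    case True then show ?thesis using same[OF u] by simp
  next
    case False
    then have c: "collin U x y" "collin U x z" using xy yz by (auto simp: perp_def)
    \<comment> \<open>Other points of the fibres over \<open>L\<close> exist in general. But
      \<open>x\<close> is collinear to \<open>y\<close>; were \<open>fst x\<close> on
      \<open>L\<close>, the line joining the two projections would be \<open>L\<close>, and
      \<open>x\<close> would lie on \<open>K\<close>.\<close>
    have xL: "fst x \<notin> L"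
    proof
      assume "fst x \<in> L"
      moreover obtain M where M: "M \<in> lines G" "fst x \<noteq> fst y" "fst x \<in> M" "fst y \<in> M" "snd x = comp (fst x) M"
        using c(1) by (rule U_collinE)
      ultimately have "M = L" using line_eq[OF M(1) L(1), of "fst x" "fst y"] yz fL by auto
      then have "x \<in> K" using M \<open>fst x \<in> L\<close> unfolding L mem_lift_line by simp
      then show False using False by simp
    qed
    show ?thesis
    proof (cases "u = y")
      case False
      have "collin G (fst x) (fst u)"
      proof (rule none_one_or_all[OF L(1), of _ "fst y" "fst z"])
        show "fst x \<in> points G - L" using xL fst_points[OF x] by simp
        show "fst y \<in> L" "fst z \<in> L" "fst u \<in> L" using yz u fL by auto
        show "fst y \<noteq> fst z" using finj yz by metis
      qed (use c U_collin_fst in auto)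
      moreover have "collin U y u" using collinI[OF K yz(1) u] False by auto
      ultimately have "collin U x u" using U_triangle[of y x u] c(1) by (simp add: collin_sym)
      then show ?thesis using up by (simp add: perp_def)
    qed (use xy in simp)
  qed
qed

text \<open>All conditions descend to \<open>G\<close>: \<open>U_end_eq\<close> keeps
  \<open>x\<close>, \<open>y\<close> and also \<open>c\<close>, \<open>d\<close> apart, and
  \<open>U_triangle\<close> keeps \<open>x\<close> and \<open>y\<close> non-collinear. The symp
  found there contains \<open>fst c\<close>, so the lines from \<open>x\<close> and \<open>y\<close>
  to \<open>c\<close> project into it, and this fixes the components in \<open>x\<close> and
  \<open>y\<close>.\<close>

lemma U_two_mids:
  assumes x: "x \<in> points U" and y: "y \<in> points U" and xy: "x \<noteq> y" "\<not> collin U x y"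
    and c: "collin U x c" "collin U y c" and d: "collin U x d" "collin U y d" and cd: "c \<noteq> d"
  obtains S where "symp G S" "S = convex_closure G {fst x, fst y}" "x = lift S (fst x)" "y = lift S (fst y)"
proof -
  note f = U_collin_fst[OF c(1)] U_collin_fst[OF c(2)] U_collin_fst[OF d(1)] U_collin_fst[OF d(2)]
  have ne: "fst x \<noteq> fst y" using U_end_eq[OF c] xy by auto
  have nc: "\<not> collin G (fst x) (fst y)" using U_triangle[of c x y] c xy by (auto simp: collin_sym)
  have cd': "fst c \<noteq> fst d" using U_end_eq[of c x d x] c d cd by (auto simp: collin_sym)
  define S where "S = convex_closure G {fst x, fst y}"
  have S: "symp G S" unfolding S_def
    using symp_of_two_mids[OF fst_points[OF x] fst_points[OF y] ne nc, of "fst c" "fst d"] f cd' by (simp add: collin_sym)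
  have xS: "fst x \<in> S" "fst y \<in> S" using convex_closure_superset[of "{fst x, fst y}" G] by (auto simp: S_def)
  have cS: "fst c \<in> S" using symp_mid[OF S xS ne nc, of "fst c"] f by (simp add: collin_sym)
  obtain L where L: "L \<in> lines G" "fst x \<noteq> fst c" "fst x \<in> L" "fst c \<in> L" "snd x = comp (fst x) L"
    using c(1) by (rule U_collinE)
  obtain M where M: "M \<in> lines G" "fst y \<noteq> fst c" "fst y \<in> M" "fst c \<in> M" "snd y = comp (fst y) M"
    using c(2) by (rule U_collinE)
  have "x = lift S (fst x)" using in_lift[OF S L(1,3,5,4) _ cS xS(1)] L(2) by simp
  moreover have "y = lift S (fst y)" using in_lift[OF S M(1,3,5,4) _ cS xS(2)] M(2) by simp
  ultimately show ?thesis using that S S_def by simp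
qed

end

subsection \<open>The sheets\<close>

locale sheet = parapolar_rank3 +
  fixes C :: "('a \<times> 'a set set) set"
  assumes C: "C \<in> components U"
begin

abbreviation H :: "('a \<times> 'a set set) geometry" where
  "H \<equiv> induced U C"

lemma C_subspace: "subspace U C"
  by (rule component_subspace[OF U_plg C])

lemma H_plg: "point_line_geometry H"
  by (rule component_plg[OF U_plg C])

lemma C_points: "C \<subseteq> points U"
  by (rule component_points[OF C])

lemma C_closed: "x \<in> C \<Longrightarrow> collin U x y \<Longrightarrow> y \<in> C"
  by (rule component_closed[OF U_plg C])

lemma H_collin: "x \<in> C \<Longrightarrow> collin H x y \<longleftrightarrow> collin U x y"
  using collin_induced[OF C_subspace, of x y] C_closed[of x y] collin_inducedD[of U C x y] by metis

lemma H_perp: "x \<in> C \<Longrightarrow> perp H x = perp U x"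
  using perp_induced[OF C_subspace, of x] C_closed[of x] by (auto simp: perp_def)

text \<open>A symp has diameter two, and its collinearities lift, so its lift cannot leave a
  connected component.\<close>

lemma lift_in_C:
  assumes S: "symp G S" and p: "p \<in> S" "lift S p \<in> C"
  shows "lift S ` S \<subseteq> C"
proof -
  have "lift S q \<in> C" if q: "q \<in> S" for q
  proof -
    consider "p = q" | "collin G p q" | "p \<noteq> q" "\<not> collin G p q" by blast
    then show ?thesis
    proof cases
      case 1 then show ?thesis using p by simp
    next
      case 2 then show ?thesis using C_closed[OF p(2)] lift_collin[OF S p(1) q] by simp
    next
      case 3
      obtain z where z: "z \<in> S" "collin G p z" "collin G z q" using symp_diam[OF S p(1) q 3] .
      then have "lift S z \<in> C" using C_closed[OF p(2)] lift_collin[OF S p(1)] by simp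
      then show ?thesis using C_closed lift_collin[OF S z(1) q] z by simp
    qed
  qed
  then show ?thesis by auto
qed

lemma symp_through:
  assumes K: "K \<in> lines H"
  obtains S where "symp G S" "lift S ` S \<subseteq> C" "K \<subseteq> lift S ` S"
proof -
  obtain L where L: "L \<in> lines G" "K = lift_line L" "K \<subseteq> C" using K unfolding lines_induced U_lines by auto
  obtain S where S: "symp G S" "L \<subseteq> S" using line_in_symp[OF L(1)] .
  have KL: "K = lift S ` L" using lift_line_eq[OF S(1) L(1) S(2)] L by simp
  obtain p where p: "p \<in> L" using plg L(1) unfolding point_line_geometry_def by metis
  have "lift S ` S \<subseteq> C" using lift_in_C[OF S(1), of p] p S(2) KL L(3) by auto
  moreover have "K \<subseteq> lift S ` S" using KL S(2) by auto
  ultimately show ?thesis using that S by simp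
qed

lemma ex_symp: "\<exists>S. symp G S \<and> lift S ` S \<subseteq> C"
proof -
  obtain x where "x \<in> C" using component_nonempty[OF C] .
  then have "x \<in> \<Union>(lines H)" using H_plg by (simp add: point_line_geometry_def)
  then obtain K where "K \<in> lines H" by auto
  then show ?thesis using symp_through by metis
qed

lemma lift_H_induced: "lift S ` S \<subseteq> C \<Longrightarrow> induced H (lift S ` S) = induced U (lift S ` S)"
  by (rule induced_induced)

lemma lift_H_subspace: "symp G S \<Longrightarrow> lift S ` S \<subseteq> C \<Longrightarrow> subspace H (lift S ` S)"
  using lift_subspace subspace_induced[OF C_subspace] by simp

lemma lift_polar_rank:
  assumes S: "symp G S"
  shows "polar_rank_at_least (induced U (lift S ` S)) 3"
proof -
  interpret geo_iso "lift S" "induced G S" "induced U (lift S ` S)" using lift_iso[OF S] .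
  show ?thesis using symp_polar[OF S] unfolding polar_rank3_def by (rule polar_rank_image)
qed

lemma lift_polar: "symp G S \<Longrightarrow> polar_space (induced U (lift S ` S))"
  using lift_polar_rank unfolding polar_rank_at_least_def has_polar_rank_def by auto

section \<open>Convex closures and symps in a sheet\<close>

lemma lift_convex:
  assumes S: "symp G S" and SC: "lift S ` S \<subseteq> C"
  shows "convex_subspace H (lift S ` S)"
proof (rule convex_subspaceI[OF H_plg lift_H_subspace[OF assms]])
  fix x y assume *: "x \<in> lift S ` S" "y \<in> lift S ` S" "x \<noteq> y" "\<not> collin H x y"
  then obtain p q where "x = lift S p" "y = lift S q" "p \<in> S" "q \<in> S" by auto
  moreover have "x \<in> C" using * SC by auto
  ultimately have pq: "x = lift S p" "y = lift S q" "p \<in> S" "q \<in> S" "p \<noteq> q" "\<not> collin G p q"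
    using lift_collin[OF S] H_collin *(3,4) by auto
  obtain z where z: "z \<in> S" "collin G p z" "collin G z q" using symp_diam[OF S pq(3-6)] .
  have "lift S p \<in> C" "lift S z \<in> C" using pq z SC by auto
  then have "collin H x (lift S z)" "collin H (lift S z) y" using lift_collin[OF S] H_collin z pq by auto
  then show "\<exists>z. collin H x z \<and> collin H z y" by blast
next
  fix x y z assume *: "x \<in> lift S ` S" "y \<in> lift S ` S" "x \<noteq> y" "\<not> collin H x y" "collin H x z" "collin H z y"
  then obtain p q where "x = lift S p" "y = lift S q" "p \<in> S" "q \<in> S" by auto
  moreover have "x \<in> C" using * SC by auto
  ultimately have pq: "x = lift S p" "y = lift S q" "p \<in> S" "q \<in> S" "p \<noteq> q" "\<not> collin G p q"
    using lift_collin[OF S] H_collin *(3,4) by auto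
  have "collin U x z" "collin U z y" using *(5,6) by (auto dest: collin_inducedD)
  then show "z \<in> lift S ` S" using lift_mid[OF S pq(3-6), of z] pq(1,2) by simp
qed

text \<open>A symp of the parapolar space is the least convex subspace on two of its points, hence a convex
  subspace of the sheet on the lifts of these points cannot meet the lift of the symp in less
  than everything.\<close>

lemma closure_lift:
  assumes S: "symp G S" "lift S ` S \<subseteq> C" and pq: "p \<in> points G" "q \<in> points G" "S = convex_closure G {p, q}"
  shows "convex_closure H {lift S p, lift S q} = lift S ` S"
proof
  have pS: "p \<in> S" "q \<in> S" using convex_closure_superset[of "{p, q}" G] pq(3) by auto
  then show "convex_closure H {lift S p, lift S q} \<subseteq> lift S ` S"
    by (intro convex_closure_least lift_convex[OF S]) auto
  define T where "T = convex_closure H {lift S p, lift S q}"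
  have "{lift S p, lift S q} \<subseteq> points H" using S(2) pS by auto
  then have T: "convex_subspace H T" unfolding T_def by (rule convex_closure_convex[OF H_plg])
  then have sT: "subspace H T" by (simp add: convex_subspace_def)
  define T' where "T' = {s \<in> S. lift S s \<in> T}"
  have T'S: "T' \<subseteq> S" "\<And>s. s \<in> T' \<Longrightarrow> lift S s \<in> T" "\<And>s. s \<in> T' \<Longrightarrow> lift S s \<in> C"
    using S(2) by (auto simp: T'_def)
  have "convex_subspace G T'"
  proof (rule convex_subspaceI[OF plg])
    show "subspace G T'" unfolding subspace_def
    proof (intro conjI ballI allI impI)
      show "T' \<subseteq> points G" using T'S(1) symp_points[OF S(1)] by auto
      fix x y L assume xy: "x \<in> T'" "y \<in> T'" and L: "L \<in> lines G" "x \<noteq> y \<and> x \<in> L \<and> y \<in> L"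
      have LS: "L \<subseteq> S" using subspaceD[OF symp_subspace[OF S(1)], of x y L] xy T'S(1) L by auto
      have e: "lift S ` L = lift_line L" using lift_line_eq[OF S(1) L(1) LS] .
      moreover have "lift_line L \<subseteq> C" unfolding e[symmetric] using LS S(2) by auto
      ultimately have "lift S ` L \<in> lines H" using L(1) unfolding lines_induced U_lines by auto
      then have "lift S ` L \<subseteq> T" using subspaceD[OF sT T'S(2)[OF xy(1)] T'S(2)[OF xy(2)]] L by simp
      then show "L \<subseteq> T'" using LS by (auto simp: T'_def)
    qed
  next
    fix x y assume xy: "x \<in> T'" "y \<in> T'" "x \<noteq> y" "\<not> collin G x y"
    then show "\<exists>z. collin G x z \<and> collin G z y" using symp_diam[OF S(1), of x y] T'S(1) by (metis subsetD)
  next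
    fix x y z assume xy: "x \<in> T'" "y \<in> T'" "x \<noteq> y" "\<not> collin G x y" and z: "collin G x z" "collin G z y"
    have xS: "x \<in> S" "y \<in> S" using xy T'S(1) by auto
    have zS: "z \<in> S" using symp_mid[OF S(1) xS xy(3,4) z] .
    have xC: "lift S x \<in> C" "lift S z \<in> C" using xS zS S(2) by auto
    have "lift S z \<in> T"
      by (rule convex_subspace_mid[OF H_plg T T'S(2)[OF xy(1)] T'S(2)[OF xy(2)]])
        (use lift_collin[OF S(1)] xS zS xy z H_collin xC in auto)
    then show "z \<in> T'" using zS by (simp add: T'_def)
  qed
  moreover have "{p, q} \<subseteq> T'" using pS convex_closure_superset[of "{lift S p, lift S q}" H] by (auto simp: T'_def T_def)
  ultimately have "S \<subseteq> T'" unfolding pq(3) by (rule convex_closure_least)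
  then show "lift S ` S \<subseteq> convex_closure H {lift S p, lift S q}" by (auto simp: T'_def T_def)
qed

text \<open>A second common neighbour brings \<open>x\<close> and \<open>y\<close> into the lift of
  one symp by \<open>U_two_mids\<close>, and \<open>closure_lift\<close> then identifies their
  convex closure.\<close>

lemma H_closure:
  assumes x: "x \<in> C" and y: "y \<in> C" and xy: "x \<noteq> y" "\<not> collin H x y"
    and c: "c \<in> perp H x \<inter> perp H y" and ns: "perp H x \<inter> perp H y \<noteq> {c}"
  obtains S where "symp G S" "lift S ` S \<subseteq> C" "convex_closure H {x, y} = lift S ` S"
proof -
  obtain d where d: "d \<in> perp H x \<inter> perp H y" "d \<noteq> c" using c ns by blast
  have nc: "\<not> collin U x y" using xy H_collin x by simp
  have col: "collin U x e" "collin U y e" if "e \<in> perp H x \<inter> perp H y" for e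
  proof -
    have "e \<in> perp U x" "e \<in> perp U y" using that H_perp[OF x] H_perp[OF y] by auto
    then show "collin U x e" "collin U y e" using xy(1) nc by (auto simp: perp_def collin_sym)
  qed
  obtain S where S: "symp G S" "S = convex_closure G {fst x, fst y}" "x = lift S (fst x)" "y = lift S (fst y)"
    using U_two_mids[OF _ _ xy(1) nc col[OF c] col[OF d(1)]] x y C_points d(2) by blast
  have p: "fst x \<in> points G" "fst y \<in> points G" using fst_points x y C_points by (meson subsetD)+
  have "fst x \<in> S" using convex_closure_superset[of "{fst x, fst y}" G] S(2) by simp
  then have SC: "lift S ` S \<subseteq> C" using lift_in_C[OF S(1), of "fst x"] S(3) x by simp
  show ?thesis using that[OF S(1) SC] closure_lift[OF S(1) SC p S(2)] S(3,4) by simp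
qed

lemma symp_lift:
  assumes S: "symp G S" and SC: "lift S ` S \<subseteq> C"
  shows "symp H (lift S ` S)"
proof -
  obtain p q where pq: "p \<in> points G" "q \<in> points G" "p \<noteq> q" "\<not> collin G p q" "S = convex_closure G {p, q}"
    using S unfolding symp_def by auto
  have pS: "p \<in> S" "q \<in> S" using convex_closure_superset[of "{p, q}" G] pq by auto
  obtain z where z: "z \<in> S" "collin G p z" "collin G z q" using symp_diam[OF S pS pq(3,4)] .
  have inC: "lift S p \<in> C" "lift S q \<in> C" "lift S z \<in> C" using pS z SC by auto
  have "lift S z \<in> perp H (lift S p) \<inter> perp H (lift S q)"
    using inC z H_collin lift_collin[OF S] pS by (auto simp: perp_def collin_sym)
  moreover have "\<not> collin H (lift S p) (lift S q)" using inC H_collin lift_collin[OF S] pS pq by simp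
  moreover have "polar_space (induced H (lift S ` S))" using lift_polar[OF S] lift_H_induced[OF SC] by simp
  ultimately show ?thesis unfolding symp_def
    using inC pq closure_lift[OF S SC pq(1,2,5)]
    by (intro bexI[of _ "lift S p"] bexI[of _ "lift S q"]) auto
qed

text \<open>The defining pair of \<open>T\<close> has more than one common neighbour: a unique one
  would lie in \<open>T\<close> by convexity and contradict \<open>common_perp_not_single\<close> in
  the polar space \<open>T\<close>. So \<open>H_closure\<close> applies.\<close>

lemma symp_H:
  assumes "symp H T"
  obtains S where "symp G S" "lift S ` S \<subseteq> C" "T = lift S ` S"
proof -
  obtain x y c where xy: "x \<in> C" "y \<in> C" "x \<noteq> y" "\<not> collin H x y" "c \<in> perp H x \<inter> perp H y"
    "T = convex_closure H {x, y}" and T: "polar_space (induced H T)"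
    using assms unfolding symp_def points_induced by blast
  have "perp H x \<inter> perp H y \<noteq> {c}"
  proof
    assume c: "perp H x \<inter> perp H y = {c}"
    interpret T: one_or_all "induced H T" using polar_space_one_or_all[OF T] .
    have "{x, y} \<subseteq> points H" using xy by simp
    then have cT: "convex_subspace H T" unfolding xy(6) by (rule convex_closure_convex[OF H_plg])
    then have sT: "subspace H T" by (simp add: convex_subspace_def)
    have xT: "x \<in> T" "y \<in> T" using convex_closure_superset[of "{x, y}" H] xy(6) by auto
    have "collin H x c" "collin H c y" using xy by (auto simp: perp_def collin_sym)
    then have "c \<in> T" using convex_subspace_mid[OF H_plg cT xT xy(3,4)] by simp
    then have "perp (induced H T) x \<inter> perp (induced H T) y = {c}"
      using c perp_induced[OF sT xT(1)] perp_induced[OF sT xT(2)] by auto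
    moreover have "y \<notin> perp (induced H T) x"
      using perp_induced[OF sT xT(1)] xy(3,4) by (auto simp: perp_def)
    ultimately show False using T.common_perp_not_single[of x y c] xT by simp
  qed
  then show ?thesis using H_closure[OF xy(1-5)] that xy(6) by metis
qed

lemma H_symplectic_rank: "symplectic_rank_at_least H 3"
  unfolding symplectic_rank_at_least_def
proof (intro allI impI)
  fix T assume "symp H T"
  then obtain S where "symp G S" "lift S ` S \<subseteq> C" "T = lift S ` S" by (rule symp_H)
  then show "polar_rank_at_least (induced H T) 3" using lift_polar_rank lift_H_induced by simp
qed

lemma H_all:
  assumes "x \<in> C" "K \<in> lines H" "y \<in> K" "z \<in> K" "y \<noteq> z" "y \<in> perp H x" "z \<in> perp H x"
  shows "K \<subseteq> perp H x"
  using U_all[of x K y z] assms H_perp C_points by auto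

lemma H_parapolar:
  assumes "\<exists>p\<in>points H. \<exists>L\<in>lines H. \<forall>x\<in>L. x \<notin> perp H p"
  shows "parapolar_space H"
  unfolding parapolar_space_def
proof (intro conjI assms)
  show "point_line_geometry H" by (rule H_plg)
  show "connected_geometry H" by (rule component_connected[OF U_plg C])
  show "\<forall>L\<in>lines H. \<forall>p\<in>points H - L.
        (\<forall>x\<in>L. \<not> collin H p x) \<or> (\<exists>!x. x \<in> L \<and> collin H p x) \<or> (\<forall>x\<in>L. collin H p x)"
  proof (intro ballI)
    fix L p assume L: "L \<in> lines H" and p: "p \<in> points H - L"
    have c: "collin H p x \<longleftrightarrow> x \<in> perp H p" if "x \<in> L" for x
      using that p L by (auto simp: perp_def)
    have a: "L \<subseteq> perp H p" if "y \<in> L" "z \<in> L" "y \<noteq> z" "y \<in> perp H p" "z \<in> perp H p" for y z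
      using H_all[of p L y z] L p that by simp
    show "(\<forall>x\<in>L. \<not> collin H p x) \<or> (\<exists>!x. x \<in> L \<and> collin H p x) \<or> (\<forall>x\<in>L. collin H p x)"
    proof (cases "\<exists>x\<in>L. x \<in> perp H p")
      case True
      then obtain x where x: "x \<in> L" "x \<in> perp H p" by auto
      show ?thesis
      proof (cases "\<exists>y\<in>L. y \<noteq> x \<and> y \<in> perp H p")
        case True
        then have "L \<subseteq> perp H p" using a x by metis
        then show ?thesis using c by auto
      next
        case False
        have "\<exists>!x. x \<in> L \<and> collin H p x"
        proof (rule ex1I[of _ x])
          show "x \<in> L \<and> collin H p x" using x c by simp
          show "y = x" if "y \<in> L \<and> collin H p y" for y using that c False by metis
        qed
        then show ?thesis by simp
      qed
    qed (use c in simp)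
  qed
  show "\<forall>p\<in>points H. \<forall>q\<in>points H.
        p \<noteq> q \<and> \<not> collin H p q \<and> perp H p \<inter> perp H q \<noteq> {} \<longrightarrow>
        polar_space (induced H (convex_closure H {p, q})) \<or>
        (\<exists>x. perp H p \<inter> perp H q = {x})"
  proof (intro ballI impI, elim conjE)
    fix x y assume xy: "x \<in> points H" "y \<in> points H" "x \<noteq> y" "\<not> collin H x y" "perp H x \<inter> perp H y \<noteq> {}"
    then obtain c where c: "c \<in> perp H x \<inter> perp H y" by auto
    show "polar_space (induced H (convex_closure H {x, y})) \<or> (\<exists>z. perp H x \<inter> perp H y = {z})"
    proof (cases "perp H x \<inter> perp H y = {c}")
      case False
      obtain S where "symp G S" "lift S ` S \<subseteq> C" "convex_closure H {x, y} = lift S ` S"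
        using H_closure[OF _ _ xy(3,4) c False] xy(1,2) by auto
      then have "polar_space (induced H (convex_closure H {x, y}))" using lift_polar lift_H_induced by simp
      then show ?thesis ..
    qed blast
  qed
  show "\<forall>L\<in>lines H. \<exists>S. symp H S \<and> L \<subseteq> S"
  proof
    fix K assume "K \<in> lines H"
    then obtain S where "symp G S" "lift S ` S \<subseteq> C" "K \<subseteq> lift S ` S" by (rule symp_through)
    then show "\<exists>S. symp H S \<and> K \<subseteq> S" using symp_lift by blast
  qed
qed

text \<open>For a point \<open>z\<close> of the sheet off the lift, the points of \<open>S\<close>
  whose lifts are collinear to \<open>z\<close> form a clique, as otherwise \<open>lift_mid\<close>
  would put \<open>z\<close> into the lift. Some line of \<open>S\<close> misses this clique, and no
  point of its lift is collinear to \<open>z\<close>.\<close>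

lemma H_is_lift:
  assumes "\<not> (\<exists>p\<in>points H. \<exists>L\<in>lines H. \<forall>x\<in>L. x \<notin> perp H p)"
    and S: "symp G S" and SC: "lift S ` S \<subseteq> C"
  shows "C = lift S ` S"
proof (rule ccontr)
  assume "C \<noteq> lift S ` S"
  then obtain z where z: "z \<in> C" "z \<notin> lift S ` S" using SC by auto
  interpret S: polar_rank3 "induced G S" using symp_polar[OF S] .
  define A where "A = {p \<in> S. lift S p \<in> perp H z}"
  have "\<exists>L\<in>lines (induced G S). L \<inter> A = {}"
  proof (rule S.clique_misses_line[OF S.plg])
    show "A \<subseteq> points (induced G S)" by (auto simp: A_def)
    obtain p q where "p \<in> {p, q}" "S = convex_closure G {p, q}" using S unfolding symp_def by auto
    then have "p \<in> S" using convex_closure_superset[of "{p, q}" G] by simp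
    then show "points (induced G S) \<noteq> {}" by auto
    fix u v assume uv: "u \<in> A" "v \<in> A"
    then have uS: "u \<in> S" "v \<in> S" by (auto simp: A_def)
    have "lift S u \<noteq> z" "lift S v \<noteq> z" using uS z by auto
    then have "collin U z (lift S u)" "collin U z (lift S v)" using uv H_collin[OF z(1)]
      by (auto simp: A_def perp_def)
    then have "u = v \<or> collin G u v" using lift_mid[OF S uS, of z] z(2) by (auto simp: collin_sym)
    then show "v \<in> perp (induced G S) u"
      unfolding symp_perp[OF S uS(1)] using uS symp_points[OF S] by (auto simp: perp_def)
  qed
  then obtain L where L: "L \<in> lines G" "L \<subseteq> S" "L \<inter> A = {}" by auto
  have e: "lift S ` L = lift_line L" using lift_line_eq[OF S L(1,2)] .
  moreover have "lift S ` L \<subseteq> C" using L SC by auto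
  ultimately have "lift S ` L \<in> lines H" using L(1) unfolding lines_induced U_lines by auto
  moreover have "z \<in> points H" using z(1) by simp
  ultimately obtain x where "x \<in> lift S ` L" "x \<in> perp H z" using assms(1) by metis
  then show False using L by (auto simp: A_def)
qed

lemma H_polar_or_parapolar: "polar_or_parapolar_space 3 H"
proof (cases "\<exists>p\<in>points H. \<exists>L\<in>lines H. \<forall>x\<in>L. x \<notin> perp H p")
  case True
  then show ?thesis using H_parapolar H_symplectic_rank by (simp add: polar_or_parapolar_space_def)
next
  case False
  obtain S where S: "symp G S" "lift S ` S \<subseteq> C" using ex_symp by auto
  then have "C = lift S ` S" using H_is_lift[OF False] by simp
  then show ?thesis using lift_polar[OF S(1)] lift_polar_rank[OF S(1)] by (simp add: polar_or_parapolar_space_def)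
qed

section \<open>Local connectedness of the sheets\<close>

text \<open>Consecutive lines lie in a plane inside a symp \<open>S\<close>. All lines of the chain
  belong to \<open>comp p L\<close>, so the lift of \<open>S\<close> passes through the same point
  of the sheet every time, and it carries the plane to a plane of the sheet.\<close>

lemma H_coplanar:
  assumes L: "(L, M) \<in> (adj (point_residual G p))\<^sup>*" and x: "(p, comp p L) \<in> C" "L \<in> lines G" "p \<in> L"
  shows "(lift_line L, lift_line M) \<in> (coplanar H (p, comp p L))\<^sup>*"
  using L
proof (induction rule: rtrancl_induct)
  case (step M N)
  obtain P S where P: "singular_plane G P" "symp G S" "P \<subseteq> S" "M \<subseteq> P" "N \<subseteq> P"
    and l: "M \<in> lines G" "p \<in> M" "N \<in> lines G" "p \<in> N"
    using step(2) unfolding residual_adj by auto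
  have "(L, N) \<in> (adj (point_residual G p))\<^sup>*" using step(1,2) by simp
  then have c: "comp p M = comp p L" "comp p N = comp p L" using step(1) comp_eq unfolding comp_def by blast+
  have MS: "M \<subseteq> S" "N \<subseteq> S" using P by auto
  have eM: "lift S ` M = lift_line M" "lift S ` N = lift_line N"
    using lift_line_eq[OF P(2) l(1) MS(1)] lift_line_eq[OF P(2) l(3) MS(2)] .
  have lp: "lift S p = (p, comp p L)" using lift_eq[OF P(2) l(1,2) MS(1)] c by simp
  then have SC: "lift S ` S \<subseteq> C" using lift_in_C[OF P(2), of p] x(1) l MS by auto
  interpret geo_iso "lift S" "induced G S" "induced U (lift S ` S)" using lift_iso[OF P(2)] .
  have "singular_plane (induced G S) P" using P singular_plane_induced[OF symp_subspace[OF P(2)] P(3)] by simp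
  then have "singular_plane (induced U (lift S ` S)) (lift S ` P)" using P by (intro singular_plane_image) auto
  then have "singular_plane H (lift S ` P)"
    using singular_plane_induced[OF lift_H_subspace[OF P(2) SC], of "lift S ` P"] lift_H_induced[OF SC] P(3) by (simp add: image_mono)
  moreover have "lift_line M \<subseteq> lift S ` P" "lift_line N \<subseteq> lift S ` P" using P eM by (metis image_mono)+
  moreover have "lift_line M \<subseteq> C" "lift_line N \<subseteq> C" using MS SC unfolding eM[symmetric] by auto
  then have "lift_line M \<in> lines H" "lift_line N \<in> lines H"
    using l unfolding lines_induced U_lines by auto
  moreover have "(p, comp p L) \<in> lift_line M" "(p, comp p L) \<in> lift_line N" using l c by (auto simp: image_iff)
  ultimately have "(lift_line M, lift_line N) \<in> coplanar H (p, comp p L)" unfolding coplanar_def by blast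
  then show ?case using step.IH by simp
qed simp

text \<open>The lines of the sheet through \<open>(p, comp p L)\<close> are lifts of lines in the
  single component \<open>comp p L\<close>; chains within this component lift.\<close>

lemma H_locally_connected: "locally_connected H"
proof (rule locally_connectedI)
  fix x K K' assume K: "K \<in> lines H" "K' \<in> lines H" "x \<in> K" "x \<in> K'"
  obtain L where L: "L \<in> lines G" "K = lift_line L" "K \<subseteq> C" using K(1) unfolding lines_induced U_lines by auto
  obtain M where M: "M \<in> lines G" "K' = lift_line M" using K(2) unfolding lines_induced U_lines by auto
  obtain p where p: "p \<in> L" "x = (p, comp p L)" using K(3) L by auto
  have "p \<in> M" "comp p M = comp p L" using K(4) M p by auto
  then have "M \<in> comp p L" using comp_eq by metis
  then have "(L, M) \<in> (adj (point_residual G p))\<^sup>*" by (simp add: comp_def)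
  then show "(K, K') \<in> (coplanar H x)\<^sup>*" using H_coplanar[of L M p] L M p K by auto
qed

end

lemma polar_or_parapolar_space_mono:
  fixes K :: "'z geometry"
  assumes "polar_or_parapolar_space d K" "e \<le> d"
  shows "polar_or_parapolar_space e K"
proof -
  have "polar_rank_at_least M e" if "polar_rank_at_least M d" for M :: "'z geometry"
    using that assms(2) unfolding polar_rank_at_least_def by (meson le_trans)
  then show ?thesis using assms(1)
    unfolding polar_or_parapolar_space_def symplectic_rank_at_least_def by blast
qed

subsection \<open>Buttoning the sheets\<close>

context parapolar_rank3
begin

text \<open>Distances and classes in the buttoning conditions can thereby be computed in the
  unbuttoning itself.\<close>

lemma union_sheets: "family_union (components U) (component_family U) = U"
proof -
  have "(\<Union>C\<in>components U. C) = points U"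
  proof
    show "(\<Union>C\<in>components U. C) \<subseteq> points U" using component_points[of _ U] by auto
    show "points U \<subseteq> (\<Union>C\<in>components U. C)"
    proof
      fix x assume "x \<in> points U"
      then obtain C where "C \<in> components U" "x \<in> C" by (rule ex_component)
      then show "x \<in> (\<Union>C\<in>components U. C)" by auto
    qed
  qed
  moreover have "(\<Union>C\<in>components U. {K \<in> lines U. K \<subseteq> C}) = lines U"
  proof
    show "lines U \<subseteq> (\<Union>C\<in>components U. {K \<in> lines U. K \<subseteq> C})"
    proof
      fix K assume K: "K \<in> lines U"
      then obtain x where x: "x \<in> K" using U_plg unfolding point_line_geometry_def by metis
      then have "x \<in> points U" using line_subset_points[OF U_plg K] by auto
      then obtain C where C: "C \<in> components U" "x \<in> C" by (rule ex_component)
      then have "K \<subseteq> C" using component_line[OF U_plg C K x] by simp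
      then show "K \<in> (\<Union>C\<in>components U. {K \<in> lines U. K \<subseteq> C})" using C K by auto
    qed
  qed auto
  ultimately show ?thesis unfolding family_union_def component_family_def by simp
qed

abbreviation same_fst :: "(('a \<times> 'a set set) \<times> ('a \<times> 'a set set)) set" where
  "same_fst \<equiv> same_first_coordinate (points U)"

lemma same_fst_equiv: "equiv (points U) same_fst"
  unfolding same_first_coordinate_def by (auto intro!: equivI refl_onI symI transI)

text \<open>Walks of length \<open>n\<close> in the unbuttoning that may jump between points with the same first
  coordinate, except over \<open>p\<close>.\<close>

definition jump :: "'a \<Rightarrow> (('a \<times> 'a set set) \<times> ('a \<times> 'a set set)) set" where
  "jump p = {(x, y). fst x = fst y \<and> (x = y \<or> fst x \<noteq> p)}"

definition walk :: "'a \<Rightarrow> nat \<Rightarrow> (('a \<times> 'a set set) \<times> ('a \<times> 'a set set)) set" where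
  "walk p n = jump p O (adj U O jump p) ^^ n"

lemma jump_trans: "jump p O jump p = jump p"
  unfolding jump_def by auto

lemma jump_refl: "(x, x) \<in> jump p"
  by (simp add: jump_def)

text \<open>Jumps compose to jumps, so those at the junction of two walks merge, and the length of a
  walk counts collinearity edges only.\<close>

lemma walk_jump: "walk p n O jump p = walk p n"
proof (cases n)
  case (Suc m)
  then show ?thesis by (simp add: walk_def O_assoc jump_trans)
qed (simp add: walk_def jump_trans)

lemma walk_trans: "walk p m O walk p n = walk p (m + n)"
proof -
  have "walk p m O walk p n = (walk p m O jump p) O (adj U O jump p) ^^ n"
    by (simp add: walk_def O_assoc)
  also have "\<dots> = walk p m O (adj U O jump p) ^^ n" by (simp add: walk_jump)
  also have "\<dots> = walk p (m + n)" by (simp add: walk_def O_assoc relpow_add)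
  finally show ?thesis .
qed

lemma gdist_walk:
  assumes "gdist U x y = enat n"
  shows "(x, y) \<in> walk p n"
proof -
  have "adj U \<subseteq> adj U O jump p" using jump_refl by (auto intro: relcompI)
  then have "adj U ^^ n \<subseteq> (adj U O jump p) ^^ n" by (induction n) (simp_all add: relcomp_mono)
  then have "(x, y) \<in> (adj U O jump p) ^^ n" using gdist_relpow[OF assms] by auto
  then show ?thesis unfolding walk_def using jump_refl by blast
qed

text \<open>One edge changes the first coordinate and cannot close up. Two edges project to the same
  line traversed back and forth, three to a triangle, and four to a quadrangle unless the walk
  visits \<open>p\<close> halfway.\<close>

lemma short_walk_closed:
  assumes w: "(x, y) \<in> walk p n" and n: "n \<le> 4" and xy: "fst x = p" "fst y = p"
  shows "x = y"
proof -
  \<comment> \<open>\<open>x\<close> lies over \<open>p\<close>, where a jump cannot move, so the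
    initial jump disappears.\<close>
  have w': "(x, y) \<in> (adj U O jump p) ^^ n" using w xy unfolding walk_def by (auto simp: jump_def)
  have adjD: "collin U a b" if "(a, b) \<in> adj U" for a b using that by (simp add: adj_def)
  have jumpD: "fst a = fst b" "fst a = p \<Longrightarrow> a = b" if "(a, b) \<in> jump p" for a b
    using that by (auto simp: jump_def)
  have neq: "fst a \<noteq> fst b" if "(a, b) \<in> adj U" for a b using adjD[OF that] by (rule U_collinE)
  consider "n = 0" | "n = 1" | "n = 2" | "n = 3" | "n = 4" using n by linarith
  then show ?thesis
  proof cases
    case 1 then show ?thesis using w' by simp
  next
    case 2
    then obtain a where "(x, a) \<in> adj U" "(a, y) \<in> jump p" using w' by auto
    then show ?thesis using neq jumpD xy by metis
  next
    case 3
    then have "(x, y) \<in> (adj U O jump p) O (adj U O jump p)" using w' by (simp add: numeral_2_eq_2)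
    then obtain a a' b where *: "(x, a) \<in> adj U" "(a, a') \<in> jump p" "(a', b) \<in> adj U" "(b, y) \<in> jump p"
      by blast
    then have "b = y" using jumpD xy by metis
    then have "collin U y a'" using adjD[OF *(3)] by (simp add: collin_sym)
    then show ?thesis using U_end_eq[OF adjD[OF *(1)]] xy jumpD(1)[OF *(2)] by simp
  next
    case 4
    then have "(x, y) \<in> (adj U O jump p) O (adj U O jump p) O (adj U O jump p)"
      using w' by (simp add: numeral_3_eq_3 O_assoc)
    then obtain a a' b b' c where *: "(x, a) \<in> adj U" "(a, a') \<in> jump p" "(a', b) \<in> adj U" "(b, b') \<in> jump p"
      "(b', c) \<in> adj U" "(c, y) \<in> jump p" by blast
    then have "c = y" using jumpD xy by metis
    then have "collin U y b'" using adjD[OF *(5)] by (simp add: collin_sym)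
    moreover have "collin G (fst a) (fst b')"
      using U_collin_fst[OF adjD[OF *(3)]] jumpD(1)[OF *(2)] jumpD(1)[OF *(4)] by simp
    ultimately show ?thesis using U_end_triangle[OF adjD[OF *(1)]] xy by simp
  next
    case 5
    then have "(x, y) \<in> (adj U O jump p) O (adj U O jump p) O (adj U O jump p) O (adj U O jump p)"
      using w' by (simp add: eval_nat_numeral O_assoc)
    then obtain a a' b b' c c' d where *: "(x, a) \<in> adj U" "(a, a') \<in> jump p" "(a', b) \<in> adj U"
      "(b, b') \<in> jump p" "(b', c) \<in> adj U" "(c, c') \<in> jump p" "(c', d) \<in> adj U" "(d, y) \<in> jump p" by blast
    then have "d = y" using jumpD xy by metis
    then have yc: "collin U y c'" using adjD[OF *(7)] by (simp add: collin_sym)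
    have f: "fst a = fst a'" "fst b = fst b'" "fst c = fst c'" using * jumpD(1) by metis+
    show ?thesis
    proof (cases "fst b = p")
      \<comment> \<open>The walk is over \<open>p\<close> again after two edges. No jump is allowed
        there, so it splits into two closed walks with two edges each.\<close>
      case True
      then have b: "b = b'" using jumpD(2)[OF *(4)] by simp
      have "collin U b a'" using adjD[OF *(3)] by (simp add: collin_sym)
      then have "x = b" using U_end_eq[OF adjD[OF *(1)]] xy True f by simp
      moreover have "b = y" using U_end_eq[OF adjD[OF *(5)] yc] xy True f b by simp
      ultimately show ?thesis by simp
    next
      case False
      then show ?thesis
        using U_end_quadrangle[OF adjD[OF *(1)] yc, of "fst b"] xy f
          U_collin_fst[OF adjD[OF *(3)]] U_collin_fst[OF adjD[OF *(5)]] by simp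
    qed
  qed
qed

lemma class_fst:
  assumes "P \<in> points U // same_fst" "x \<in> P"
  shows "x \<in> points U" "P = same_fst `` {x}"
proof -
  obtain z where z: "z \<in> points U" "P = same_fst `` {z}" using assms(1) by (rule quotientE)
  then show "x \<in> points U" using assms(2) by (auto simp: same_first_coordinate_def)
  show "P = same_fst `` {x}" using z assms(2) unfolding same_first_coordinate_def by auto
qed

text \<open>A sum of at most four gives a walk of at most four edges from \<open>p2\<close> to
  \<open>p1\<close> whose jumps take place in the classes \<open>Q\<close>, \<open>T\<close>,
  \<open>S\<close>. These differ from \<open>P\<close>, so no jump is over the first coordinate of
  \<open>P\<close>, and \<open>short_walk_closed\<close> identifies \<open>p1\<close> and
  \<open>p2\<close>.\<close>

lemma same_fst_C1: "buttoning_C1 U same_fst"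
  unfolding buttoning_C1_def
proof (intro ballI impI)
  fix P Q T S p1 p2 q1 q2 t1 t2 s1 s2
  assume cl: "P \<in> points U // same_fst" "Q \<in> points U // same_fst" "T \<in> points U // same_fst" "S \<in> points U // same_fst"
    and PQ: "P \<notin> {Q, T, S}" and p: "p1 \<in> P" "p2 \<in> P" "p1 \<noteq> p2"
    and q: "q1 \<in> Q" "q2 \<in> Q" and t: "t1 \<in> T" "t2 \<in> T" and s: "s1 \<in> S" "s2 \<in> S"
  show "5 \<le> gdist U p2 q1 + gdist U q2 t1 + gdist U t2 s1 + gdist U s2 p1"
  proof (rule ccontr)
    assume "\<not> ?thesis"
    then have lt: "gdist U p2 q1 + gdist U q2 t1 + gdist U t2 s1 + gdist U s2 p1 < 5" by simp
    \<comment> \<open>An infinite summand would make the sum infinite, so all four distances are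
      natural numbers.\<close>
    then obtain a b c d where e: "gdist U p2 q1 = enat a" "gdist U q2 t1 = enat b"
      "gdist U t2 s1 = enat c" "gdist U s2 p1 = enat d"
      by (cases "gdist U p2 q1"; cases "gdist U q2 t1"; cases "gdist U t2 s1"; cases "gdist U s2 p1") auto
    define x where "x = fst p1"
    have fp: "fst p2 = x" using class_fst(2)[OF cl(1) p(1)] p(2) by (auto simp: same_first_coordinate_def x_def)
    have jump: "(u, v) \<in> jump x" if "W \<in> points U // same_fst" "W \<noteq> P" "u \<in> W" "v \<in> W" for W u v
    proof -
      have "fst u = fst v" using class_fst(2)[OF that(1,3)] that(4) by (auto simp: same_first_coordinate_def)
      moreover have "fst u \<noteq> x"
      proof
        assume "fst u = x"
        then have "same_fst `` {u} = same_fst `` {p1}"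
          using class_fst(1)[OF that(1,3)] class_fst(1)[OF cl(1) p(1)]
          by (auto simp: same_first_coordinate_def x_def)
        then show False using class_fst(2)[OF that(1,3)] class_fst(2)[OF cl(1) p(1)] that(2) by simp
      qed
      ultimately show ?thesis by (simp add: jump_def)
    qed
    have J: "(q1, q2) \<in> jump x" "(t1, t2) \<in> jump x" "(s1, s2) \<in> jump x"
      using jump[OF cl(2) _ q] jump[OF cl(3) _ t] jump[OF cl(4) _ s] PQ by auto
    have W: "(p2, q2) \<in> walk x a" "(q2, t2) \<in> walk x b" "(t2, s2) \<in> walk x c" "(s2, p1) \<in> walk x d"
      using gdist_walk[OF e(1), of x] gdist_walk[OF e(2), of x] gdist_walk[OF e(3), of x] gdist_walk[OF e(4), of x]
        J walk_jump[of x] by blast+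
    then have "(p2, p1) \<in> walk x (a + b + c + d)" using walk_trans[of x] by blast
    moreover have "a + b + c + d \<le> 4" using lt unfolding e by (simp add: numeral_eq_enat)
    ultimately show False using short_walk_closed fp p(3) x_def by metis
  qed
qed

text \<open>A path in \<open>G\<close> is followed edge by edge: the lift of the line on an edge
  lies in one sheet, and this sheet shares a class with every sheet that has a point over an end of
  the edge.\<close>

lemma same_fst_C2: "buttoning_C2 (components U) (component_family U) same_fst"
proof -
  define R where "R = {(k, l). k \<in> components U \<and> l \<in> components U \<and>
        (\<exists>x\<in>points (component_family U k). \<exists>y\<in>points (component_family U l). (x, y) \<in> same_fst)}"
  have edge: "(C, D) \<in> R" if "C \<in> components U" "D \<in> components U" "x \<in> C" "y \<in> D" "fst x = fst y" for C D x y
  proof -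
    have "x \<in> points U" "y \<in> points U" using that component_points[of _ U] by auto
    then show ?thesis using that unfolding R_def component_family_def same_first_coordinate_def by auto
  qed
  \<comment> \<open>The invariant speaks of all sheets over \<open>b\<close>, since the lift of the
    next line may lie in a different sheet than that of the previous one.\<close>
  have path: "\<forall>D y. D \<in> components U \<and> y \<in> D \<and> fst y = b \<longrightarrow> (C, D) \<in> R\<^sup>*"
    if "(a, b) \<in> (adj G)\<^sup>*" and C: "C \<in> components U" "x \<in> C" "fst x = a" for a b C x
    using that(1)
  proof (induction rule: rtrancl_induct)
    case base
    then show ?case using edge[OF C(1) _ C(2)] C(3) by auto
  next
    case (step b c)
    then obtain L where L: "L \<in> lines G" "b \<in> L" "c \<in> L" unfolding adj_def collin_def by auto
    have K: "lift_line L \<in> lines U" using L unfolding U_lines by auto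
    have "(b, comp b L) \<in> points U" using U_pointI L by simp
    then obtain E where E: "E \<in> components U" "(b, comp b L) \<in> E" by (rule ex_component)
    have "lift_line L \<subseteq> E" using component_line[OF U_plg E K] L by auto
    then have cE: "(c, comp c L) \<in> E" using L by auto
    have CE: "(C, E) \<in> R\<^sup>*" using step.IH E by auto
    show ?case
    proof (intro allI impI, elim conjE)
      fix D y assume "D \<in> components U" "y \<in> D" "fst y = c"
      then have "(E, D) \<in> R" using edge[OF E(1) _ cE] by simp
      then show "(C, D) \<in> R\<^sup>*" using CE by simp
    qed
  qed
  have "(C, D) \<in> R\<^sup>*" if CD: "C \<in> components U" "D \<in> components U" for C D
  proof -
    obtain x where x: "x \<in> C" using component_nonempty[OF CD(1)] .
    obtain y where y: "y \<in> D" using component_nonempty[OF CD(2)] .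
    have "fst x \<in> points G" "fst y \<in> points G"
      using fst_points[of x] fst_points[of y] x y component_points[OF CD(1)] component_points[OF CD(2)] by auto
    then have "(fst x, fst y) \<in> (adj G)\<^sup>*" using connected unfolding connected_geometry_adj by simp
    then show ?thesis using path[OF _ CD(1) x] CD(2) y by blast
  qed
  then show ?thesis unfolding buttoning_C2_def R_def by blast
qed

lemma sheet: "C \<in> components U \<Longrightarrow> sheet G C"
  using parapolar_rank3_axioms by (simp add: sheet_def sheet_axioms_def)

lemma sheet_properties:
  assumes "C \<in> components U"
  shows "locally_connected (component_family U C) \<and> polar_or_parapolar_space 3 (component_family U C)"
proof -
  interpret sheet G C using assms by (rule sheet)
  show ?thesis unfolding component_family_def using H_locally_connected H_polar_or_parapolar by simp
qed

lemma ex_line_through: "p \<in> points G \<Longrightarrow> \<exists>L\<in>lines G. p \<in> L"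
  using plg unfolding point_line_geometry_def by auto

lemma components_nonempty: "components U \<noteq> {}"
proof -
  have "\<exists>p\<in>points G. \<exists>L\<in>lines G. \<forall>x\<in>L. x \<notin> perp G p"
    using para unfolding parapolar_space_def by (elim conjE)
  then obtain p where "p \<in> points G" by auto
  then obtain L where "L \<in> lines G" "p \<in> L" using ex_line_through by auto
  then have "(p, comp p L) \<in> points U" using U_pointI by simp
  then show ?thesis using ex_component by (metis empty_iff)
qed

lemma same_fst_buttoning_data: "buttoning_data (components U) (component_family U) same_fst"
  unfolding buttoning_data_def union_sheets
proof (intro conjI ballI)
  show "disjoint_family_on (\<lambda>C. points (component_family U C)) (components U)"
    using components_disjoint unfolding disjoint_family_on_def component_family_def by fastforce
  fix C assume "C \<in> components U"
  then show "locally_connected (component_family U C)" "polar_or_parapolar_space 2 (component_family U C)"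
    using sheet_properties polar_or_parapolar_space_mono[of 3 _ 2] by auto
qed (use components_nonempty same_fst_equiv same_fst_C1 same_fst_C2 in auto)

section \<open>Recovering the parapolar space from its sheets\<close>

text \<open>The classes of the relation are the fibres of \<open>fst\<close>. Each fibre is
  non-empty because every point of \<open>G\<close> is on a line, which makes the map to fibres
  injective; the fibres met by a lifted line are those over the points of the line.\<close>

lemma fibre_iso: "geometry_iso (\<lambda>p. {x \<in> points U. fst x = p}) G (buttoning (components U) (component_family U) same_fst)"
proof -
  let ?f = "\<lambda>p. {x \<in> points U. fst x = p}"
  have cl: "same_fst `` {x} = ?f (fst x)" if "x \<in> points U" for x
    using that by (auto simp: same_first_coordinate_def)
  have "inj_on ?f (points G)"
  proof (rule inj_onI)
    fix p q assume p: "p \<in> points G" and e: "?f p = ?f q"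
    obtain L where "L \<in> lines G" "p \<in> L" using ex_line_through[OF p] by auto
    then have "(p, comp p L) \<in> ?f p" using U_pointI by simp
    then show "p = q" unfolding e by simp
  qed
  moreover have "?f ` points G = points U // same_fst"
  proof
    show "?f ` points G \<subseteq> points U // same_fst"
    proof
      fix X assume "X \<in> ?f ` points G"
      then obtain p where p: "p \<in> points G" "X = ?f p" by auto
      obtain L where "L \<in> lines G" "p \<in> L" using ex_line_through[OF p(1)] by auto
      then have x: "(p, comp p L) \<in> points U" using U_pointI by simp
      have "X = same_fst `` {(p, comp p L)}" using cl[OF x] p(2) by simp
      then show "X \<in> points U // same_fst" using x by (auto simp: quotient_def)
    qed
    show "points U // same_fst \<subseteq> ?f ` points G"
    proof
      fix X assume "X \<in> points U // same_fst"
      then obtain x where "x \<in> points U" "X = same_fst `` {x}" by (rule quotientE)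
      then show "X \<in> ?f ` points G" using cl fst_points by auto
    qed
  qed
  moreover have "(\<lambda>L. ?f ` L) ` lines G = (\<lambda>L. (\<lambda>x. same_fst `` {x}) ` L) ` lines U"
  proof -
    have "(\<lambda>x. same_fst `` {x}) ` lift_line L = ?f ` L" if "L \<in> lines G" for L
      unfolding image_image using that cl U_pointI by (intro image_cong) auto
    moreover have "lines U = lift_line ` lines G" unfolding U_lines by auto
    ultimately show ?thesis by (simp add: image_image)
  qed
  ultimately show ?thesis unfolding geometry_iso_def buttoning_def union_sheets bij_betw_def by simp
qed

lemma same_fst_nontrivial:
  assumes "\<not> locally_connected G"
  shows "nontrivial_on (points U) same_fst"
proof -
  obtain p L M where *: "L \<in> lines G" "M \<in> lines G" "p \<in> L" "p \<in> M" "comp p L \<noteq> comp p M"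
    using not_locally_connected[OF assms] .
  then have "((p, comp p L), (p, comp p M)) \<in> same_fst"
    using U_pointI by (simp add: same_first_coordinate_def)
  then show ?thesis using * unfolding nontrivial_on_def by auto
qed

end

theorem theoremA8:
  fixes G :: "'a geometry"
  assumes "parapolar_space G"
    and "symplectic_rank_at_least G 3"
  defines "I \<equiv> components (unbuttoning G)"
    and "F \<equiv> component_family (unbuttoning G)"
    and "R \<equiv> same_first_coordinate (points (unbuttoning G))"
  shows "locally_connected G \<or>
    ((\<forall>C\<in>I. locally_connected (F C) \<and> polar_or_parapolar_space 3 (F C)) \<and>
     buttoning_data I F R \<and>
     nontrivial_on (points (family_union I F)) R \<and>
     parapolar_space (buttoning I F R) \<and>
     isomorphic G (buttoning I F R))"
proof (cases "locally_connected G")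
  case False
  interpret parapolar_rank3 G using assms(1,2) by unfold_locales
  interpret iso: geo_iso "\<lambda>p. {x \<in> points (unbuttoning G). fst x = p}" G "buttoning I F R"
    unfolding I_def F_def R_def using fibre_iso line_sub by unfold_locales auto
  have "nontrivial_on (points (family_union I F)) R"
    unfolding I_def F_def R_def union_sheets using False by (rule same_fst_nontrivial)
  moreover have "parapolar_space (buttoning I F R)" using assms(1) by (rule iso.parapolar_image)
  moreover have "isomorphic G (buttoning I F R)" using iso.iso unfolding isomorphic_def by blast
  ultimately show ?thesis using sheet_properties same_fst_buttoning_data
    unfolding I_def F_def R_def by blast
qed simp

end
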